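(* Let $\mathcal B$ be a pivotal bicategory whose categories of 1-morphisms are idempotent complete and $\mathbb C$-linear, and suppose that for every $a\in\mathcal B$ a linear map $\langle-\rangle_a:\mathrm{End}_{\mathcal B}(I_a)\to\mathbb C$ is given. Let $X:(a,A)\to(b,B)$ be a 1-morphism in the orbifold completion $\mathcal B_{\mathrm{orb}}$ such that $$\langle\mathrm{tr}_{\mathrm l}(\Psi)\rangle_a=\langle\mathrm{tr}_{\mathrm r}(\Psi)\rangle_b\qquad\text{for all 2-morphisms }\Psi:X\to X\text{ in }\mathcal B.$$ Then, for any 1-morphism $Y:(a,A)\to(b,B)$ in $\mathcal B_{\mathrm{orb}}$: if the pairing $$\langle-,-\rangle_X:\mathrm{Hom}_{\mathcal B}(Y,X)\times\mathrm{Hom}_{\mathcal B}(X,Y)\to\mathbb C,\qquad\langle\Psi_1,\Psi_2\rangle_X=\langle\mathrm{tr}_{\mathrm l}(\Psi_1\circ\Psi_2)\rangle_a$$ is nondegenerate, then its restriction to $\mathrm{Hom}_{\mathcal B_{\mathrm{orb}}}(Y,X)\times\mathrm{Hom}_{\mathcal B_{\mathrm{orb}}}(X,Y)$, i.e. to bimodule maps, is nondegenerate.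
   Context: Conventions: in a bicategory $\mathcal B$ the composite of $X\in\mathcal B(a,b)$ and $Y\in\mathcal B(b,c)$ is $Y\otimes X\in\mathcal B(a,c)$; $I_a$ is the unit 1-morphism; associators and unitors are suppressed. Pivotal bicategory: every $X\in\mathcal B(a,b)$ comes with a chosen $X^\dagger={}^\dagger X\in\mathcal B(b,a)$ and adjunction maps $\mathrm{ev}_X:X^\dagger\otimes X\to I_a$, $\mathrm{coev}_X:I_b\to X\otimes X^\dagger$ (for $X^\dagger\dashv X$) and $\widetilde{\mathrm{ev}}_X:X\otimes X^\dagger\to I_b$, $\widetilde{\mathrm{coev}}_X:I_a\to X^\dagger\otimes X$ (for $X\dashv X^\dagger$), such that for all $\phi:Z\to X$ one has $(1_{Z^\dagger}\otimes\widetilde{\mathrm{ev}}_X)(1\otimes\phi\otimes1)(\widetilde{\mathrm{coev}}_Z\otimes1_{X^\dagger})=(\mathrm{ev}_X\otimes1_{Z^\dagger})(1\otimes\phi\otimes1)(1_{X^\dagger}\otimes\mathrm{coev}_Z)$, and for all composable $X,Y$ the two maps $(Y\otimes X)^\dagger\to X^\dagger\otimes Y^\dagger$ obtained from $(\widetilde{\mathrm{coev}}_X,\widetilde{\mathrm{coev}}_Y,\widetilde{\mathrm{ev}}_{Y\otimes X})$ and from $(\mathrm{coev}_X,\mathrm{coev}_Y,\mathrm{ev}_{Y\otimes X})$ agree. Traces of $\Psi:X\to X$: $\mathrm{tr}_{\mathrm l}(\Psi)=\mathrm{ev}_X\circ(1_{X^\dagger}\otimes\Psi)\circ\widetilde{\mathrm{coev}}_X\in\mathrm{End}(I_a)$,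 $\mathrm{tr}_{\mathrm r}(\Psi)=\widetilde{\mathrm{ev}}_X\circ(\Psi\otimes1_{X^\dagger})\circ\mathrm{coev}_X\in\mathrm{End}(I_b)$. Algebras: an algebra in $\mathcal B(a,a)$ is $A$ with associative $\mu:A\otimes A\to A$ and unit $\eta:I_a\to A$; a coalgebra dually has $\Delta,\varepsilon$. $A$ with both is Frobenius if $(1_A\otimes\mu)(\Delta\otimes 1_A)=\Delta\mu=(\mu\otimes 1_A)(1_A\otimes\Delta)$; separable if $\mu\Delta=1_A$; symmetric if $(\varepsilon\mu\otimes1_{A^\dagger})(1_A\otimes\mathrm{coev}_A)=(1_{A^\dagger}\otimes\varepsilon\mu)(\widetilde{\mathrm{coev}}_A\otimes1_A)$ as maps $A\to A^\dagger$. Orbifold completion $\mathcal B_{\mathrm{orb}}$: objects are pairs $(a,A)$ with $A\in\mathcal B(a,a)$ a symmetric separable Frobenius algebra; 1-morphisms $(a,A)\to(b,B)$ are $B$-$A$-bimodules in $\mathcal B(a,b)$; 2-morphisms are bimodule maps; composition is the relative tensor product; the unit of $(a,A)$ is $A$. A pairing is nondegenerate if no nonzero element of either space pairs to zero with everything in the other. *)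

theory Defs
  imports Complex_Main
begin

section \<open>Bicategories\<close>

text \<open>
  Bicategories are weak. Composition of 1-morphisms and horizontal composition of 2-morphisms
  are written in the order \<open>Y \<odot> X\<close>, \<open>g \<otimes> f\<close> (first \<open>X\<close>, then \<open>Y\<close>). The associators
  \<open>\<a> Z Y X : (Z \<odot> Y) \<odot> X \<rightarrow> Z \<odot> (Y \<odot> X)\<close> and the unitors \<open>\<l> X : \<I> b \<odot> X \<rightarrow> X\<close>,
  \<open>\<r> X : X \<odot> \<I> a \<rightarrow> X\<close> are part of the data, together with their inverses.
  Hom-sets are not required to be pairwise disjoint.
\<close>

record ('o, 'x, 'f) bicategory_data =
  Obj :: "'o set"
  Hom1 :: "'o \<Rightarrow> 'o \<Rightarrow> 'x set"
  Hom2 :: "'x \<Rightarrow> 'x \<Rightarrow> 'f set"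
  comp1 :: "'x \<Rightarrow> 'x \<Rightarrow> 'x" (infixl "\<odot>\<index>" 70)
  unit1 :: "'o \<Rightarrow> 'x" ("\<I>\<index>")
  vcomp :: "'f \<Rightarrow> 'f \<Rightarrow> 'f" (infixl "\<cdot>\<index>" 65)
  id2 :: "'x \<Rightarrow> 'f" ("\<one>\<index>")
  hcomp :: "'f \<Rightarrow> 'f \<Rightarrow> 'f" (infixl "\<otimes>\<index>" 70)
  assoc :: "'x \<Rightarrow> 'x \<Rightarrow> 'x \<Rightarrow> 'f" ("\<a>\<index>")
  assoc_inv :: "'x \<Rightarrow> 'x \<Rightarrow> 'x \<Rightarrow> 'f" ("\<a>\<inverse>\<index>")
  lunit :: "'x \<Rightarrow> 'f" ("\<l>\<index>")
  lunit_inv :: "'x \<Rightarrow> 'f" ("\<l>\<inverse>\<index>")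
  runit :: "'x \<Rightarrow> 'f" ("\<r>\<index>")
  runit_inv :: "'x \<Rightarrow> 'f" ("\<r>\<inverse>\<index>")

locale bicategory =
  fixes \<B> :: "('o, 'x, 'f, 'z) bicategory_data_scheme" (structure)
  assumes unit1_closed: "a \<in> Obj \<B> \<Longrightarrow> \<I> a \<in> Hom1 \<B> a a"
    and comp1_closed:
      "\<lbrakk>a \<in> Obj \<B>; b \<in> Obj \<B>; c \<in> Obj \<B>; X \<in> Hom1 \<B> a b; Y \<in> Hom1 \<B> b c\<rbrakk>
        \<Longrightarrow> Y \<odot> X \<in> Hom1 \<B> a c"
    and id2_closed:
      "\<lbrakk>a \<in> Obj \<B>; b \<in> Obj \<B>; X \<in> Hom1 \<B> a b\<rbrakk> \<Longrightarrow> \<one> X \<in> Hom2 \<B> X X"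
    and vcomp_closed:
      "\<lbrakk>a \<in> Obj \<B>; b \<in> Obj \<B>; X \<in> Hom1 \<B> a b; Y \<in> Hom1 \<B> a b; Z \<in> Hom1 \<B> a b;
        f \<in> Hom2 \<B> X Y; g \<in> Hom2 \<B> Y Z\<rbrakk> \<Longrightarrow> g \<cdot> f \<in> Hom2 \<B> X Z"
    and vcomp_assoc:
      "\<lbrakk>a \<in> Obj \<B>; b \<in> Obj \<B>;
        W \<in> Hom1 \<B> a b; X \<in> Hom1 \<B> a b; Y \<in> Hom1 \<B> a b; Z \<in> Hom1 \<B> a b;
        f \<in> Hom2 \<B> W X; g \<in> Hom2 \<B> X Y; h \<in> Hom2 \<B> Y Z\<rbrakk>
        \<Longrightarrow> (h \<cdot> g) \<cdot> f = h \<cdot> (g \<cdot> f)"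
    and vcomp_id_left:
      "\<lbrakk>a \<in> Obj \<B>; b \<in> Obj \<B>; X \<in> Hom1 \<B> a b; Y \<in> Hom1 \<B> a b; f \<in> Hom2 \<B> X Y\<rbrakk>
        \<Longrightarrow> \<one> Y \<cdot> f = f"
    and vcomp_id_right:
      "\<lbrakk>a \<in> Obj \<B>; b \<in> Obj \<B>; X \<in> Hom1 \<B> a b; Y \<in> Hom1 \<B> a b; f \<in> Hom2 \<B> X Y\<rbrakk>
        \<Longrightarrow> f \<cdot> \<one> X = f"
    and hcomp_closed:
      "\<lbrakk>a \<in> Obj \<B>; b \<in> Obj \<B>; c \<in> Obj \<B>; X \<in> Hom1 \<B> a b; X' \<in> Hom1 \<B> a b;
        Y \<in> Hom1 \<B> b c; Y' \<in> Hom1 \<B> b c; f \<in> Hom2 \<B> X X'; g \<in> Hom2 \<B> Y Y'\<rbrakk>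
        \<Longrightarrow> g \<otimes> f \<in> Hom2 \<B> (Y \<odot> X) (Y' \<odot> X')"
    and hcomp_id:
      "\<lbrakk>a \<in> Obj \<B>; b \<in> Obj \<B>; c \<in> Obj \<B>; X \<in> Hom1 \<B> a b; Y \<in> Hom1 \<B> b c\<rbrakk>
        \<Longrightarrow> \<one> Y \<otimes> \<one> X = \<one> (Y \<odot> X)"
    and interchange:
      "\<lbrakk>a \<in> Obj \<B>; b \<in> Obj \<B>; c \<in> Obj \<B>;
        X \<in> Hom1 \<B> a b; X' \<in> Hom1 \<B> a b; X'' \<in> Hom1 \<B> a b;
        Y \<in> Hom1 \<B> b c; Y' \<in> Hom1 \<B> b c; Y'' \<in> Hom1 \<B> b c;
        f \<in> Hom2 \<B> X X'; f' \<in> Hom2 \<B> X' X''; g \<in> Hom2 \<B> Y Y'; g' \<in> Hom2 \<B> Y' Y''\<rbrakk>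
        \<Longrightarrow> (g' \<cdot> g) \<otimes> (f' \<cdot> f) = (g' \<otimes> f') \<cdot> (g \<otimes> f)"
    and assoc_closed:
      "\<lbrakk>a \<in> Obj \<B>; b \<in> Obj \<B>; c \<in> Obj \<B>; d \<in> Obj \<B>;
        X \<in> Hom1 \<B> a b; Y \<in> Hom1 \<B> b c; Z \<in> Hom1 \<B> c d\<rbrakk>
        \<Longrightarrow> \<a> Z Y X \<in> Hom2 \<B> ((Z \<odot> Y) \<odot> X) (Z \<odot> (Y \<odot> X))"
    and assoc_inv_closed:
      "\<lbrakk>a \<in> Obj \<B>; b \<in> Obj \<B>; c \<in> Obj \<B>; d \<in> Obj \<B>;
        X \<in> Hom1 \<B> a b; Y \<in> Hom1 \<B> b c; Z \<in> Hom1 \<B> c d\<rbrakk>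
        \<Longrightarrow> \<a>\<inverse> Z Y X \<in> Hom2 \<B> (Z \<odot> (Y \<odot> X)) ((Z \<odot> Y) \<odot> X)"
    and assoc_inverse:
      "\<lbrakk>a \<in> Obj \<B>; b \<in> Obj \<B>; c \<in> Obj \<B>; d \<in> Obj \<B>;
        X \<in> Hom1 \<B> a b; Y \<in> Hom1 \<B> b c; Z \<in> Hom1 \<B> c d\<rbrakk>
        \<Longrightarrow> \<a>\<inverse> Z Y X \<cdot> \<a> Z Y X = \<one> ((Z \<odot> Y) \<odot> X)
          \<and> \<a> Z Y X \<cdot> \<a>\<inverse> Z Y X = \<one> (Z \<odot> (Y \<odot> X))"
    and assoc_natural:
      "\<lbrakk>a \<in> Obj \<B>; b \<in> Obj \<B>; c \<in> Obj \<B>; d \<in> Obj \<B>;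
        X \<in> Hom1 \<B> a b; X' \<in> Hom1 \<B> a b; Y \<in> Hom1 \<B> b c; Y' \<in> Hom1 \<B> b c;
        Z \<in> Hom1 \<B> c d; Z' \<in> Hom1 \<B> c d;
        f \<in> Hom2 \<B> X X'; g \<in> Hom2 \<B> Y Y'; h \<in> Hom2 \<B> Z Z'\<rbrakk>
        \<Longrightarrow> \<a> Z' Y' X' \<cdot> ((h \<otimes> g) \<otimes> f) = (h \<otimes> (g \<otimes> f)) \<cdot> \<a> Z Y X"
    and lunit_closed:
      "\<lbrakk>a \<in> Obj \<B>; b \<in> Obj \<B>; X \<in> Hom1 \<B> a b\<rbrakk> \<Longrightarrow> \<l> X \<in> Hom2 \<B> (\<I> b \<odot> X) X"
    and lunit_inv_closed:
      "\<lbrakk>a \<in> Obj \<B>; b \<in> Obj \<B>; X \<in> Hom1 \<B> a b\<rbrakk> \<Longrightarrow> \<l>\<inverse> X \<in> Hom2 \<B> X (\<I> b \<odot> X)"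
    and lunit_inverse:
      "\<lbrakk>a \<in> Obj \<B>; b \<in> Obj \<B>; X \<in> Hom1 \<B> a b\<rbrakk>
        \<Longrightarrow> \<l>\<inverse> X \<cdot> \<l> X = \<one> (\<I> b \<odot> X) \<and> \<l> X \<cdot> \<l>\<inverse> X = \<one> X"
    and lunit_natural:
      "\<lbrakk>a \<in> Obj \<B>; b \<in> Obj \<B>; X \<in> Hom1 \<B> a b; X' \<in> Hom1 \<B> a b; f \<in> Hom2 \<B> X X'\<rbrakk>
        \<Longrightarrow> \<l> X' \<cdot> (\<one> (\<I> b) \<otimes> f) = f \<cdot> \<l> X"
    and runit_closed:
      "\<lbrakk>a \<in> Obj \<B>; b \<in> Obj \<B>; X \<in> Hom1 \<B> a b\<rbrakk> \<Longrightarrow> \<r> X \<in> Hom2 \<B> (X \<odot> \<I> a) X"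
    and runit_inv_closed:
      "\<lbrakk>a \<in> Obj \<B>; b \<in> Obj \<B>; X \<in> Hom1 \<B> a b\<rbrakk> \<Longrightarrow> \<r>\<inverse> X \<in> Hom2 \<B> X (X \<odot> \<I> a)"
    and runit_inverse:
      "\<lbrakk>a \<in> Obj \<B>; b \<in> Obj \<B>; X \<in> Hom1 \<B> a b\<rbrakk>
        \<Longrightarrow> \<r>\<inverse> X \<cdot> \<r> X = \<one> (X \<odot> \<I> a) \<and> \<r> X \<cdot> \<r>\<inverse> X = \<one> X"
    and runit_natural:
      "\<lbrakk>a \<in> Obj \<B>; b \<in> Obj \<B>; X \<in> Hom1 \<B> a b; X' \<in> Hom1 \<B> a b; f \<in> Hom2 \<B> X X'\<rbrakk>
        \<Longrightarrow> \<r> X' \<cdot> (f \<otimes> \<one> (\<I> a)) = f \<cdot> \<r> X"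
    and pentagon:
      "\<lbrakk>a \<in> Obj \<B>; b \<in> Obj \<B>; c \<in> Obj \<B>; d \<in> Obj \<B>; e \<in> Obj \<B>;
        W \<in> Hom1 \<B> a b; X \<in> Hom1 \<B> b c; Y \<in> Hom1 \<B> c d; Z \<in> Hom1 \<B> d e\<rbrakk>
        \<Longrightarrow> (\<one> Z \<otimes> \<a> Y X W) \<cdot> \<a> Z (Y \<odot> X) W \<cdot> (\<a> Z Y X \<otimes> \<one> W)
          = \<a> Z Y (X \<odot> W) \<cdot> \<a> (Z \<odot> Y) X W"
    and triangle:
      "\<lbrakk>a \<in> Obj \<B>; b \<in> Obj \<B>; c \<in> Obj \<B>; X \<in> Hom1 \<B> a b; Y \<in> Hom1 \<B> b c\<rbrakk>
        \<Longrightarrow> (\<one> Y \<otimes> \<l> X) \<cdot> \<a> Y (\<I> b) X = \<r> Y \<otimes> \<one> X"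


section \<open>Pivotal structure\<close>

text \<open>
  \<open>is_adjunction \<B> a b L R e n\<close>: the 1-morphism \<open>L : b \<rightarrow> a\<close> is left adjoint to \<open>R : a \<rightarrow> b\<close>
  with counit \<open>e : L \<odot> R \<rightarrow> \<I> a\<close> and unit \<open>n : \<I> b \<rightarrow> R \<odot> L\<close>.
\<close>

definition is_adjunction ::
    "('o, 'x, 'f, 'z) bicategory_data_scheme \<Rightarrow> 'o \<Rightarrow> 'o \<Rightarrow> 'x \<Rightarrow> 'x \<Rightarrow> 'f \<Rightarrow> 'f \<Rightarrow> bool"
  where "is_adjunction \<B> a b L R e n \<longleftrightarrow>
    L \<in> Hom1 \<B> b a \<and> R \<in> Hom1 \<B> a b \<and>
    e \<in> Hom2 \<B> (L \<odot> R) (\<I> a) \<and> n \<in> Hom2 \<B> (\<I> b) (R \<odot> L) \<and>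
    \<r> R \<cdot> (\<one> R \<otimes> e) \<cdot> \<a> R L R \<cdot> (n \<otimes> \<one> R) \<cdot> \<l>\<inverse> R = \<one> R \<and>
    \<l> L \<cdot> (e \<otimes> \<one> L) \<cdot> \<a>\<inverse> L R L \<cdot> (\<one> L \<otimes> n) \<cdot> \<r>\<inverse> L = \<one> L"
  for \<B> (structure)

text \<open>The fields \<open>tev\<close> and \<open>tcoev\<close> are the evaluation and coevaluation with a tilde.\<close>

record ('o, 'x, 'f) pivotal_data = "('o, 'x, 'f) bicategory_data" +
  dual :: "'x \<Rightarrow> 'x" ("_\<^sup>\<dagger>\<index>" [1000] 999)
  ev :: "'x \<Rightarrow> 'f"
  coev :: "'x \<Rightarrow> 'f"
  tev :: "'x \<Rightarrow> 'f"
  tcoev :: "'x \<Rightarrow> 'f"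

text \<open>
  In \<open>pivotal_tensor\<close> both sides are maps \<open>(Y \<odot> X)\<^sup>\<dagger> \<rightarrow> X\<^sup>\<dagger> \<odot> Y\<^sup>\<dagger>\<close>. Read from right to left,
  each side first creates the outer pair of 1-morphisms, then the inner pair (next to an inserted
  unit 1-morphism), and then evaluates \<open>Y \<odot> X\<close> against its dual; all other factors are coherence
  isomorphisms.
\<close>

locale pivotal_bicategory = bicategory \<B>
  for \<B> :: "('o, 'x, 'f, 'z) pivotal_data_scheme" (structure) +
  assumes dual_left_adjoint:
      "\<lbrakk>a \<in> Obj \<B>; b \<in> Obj \<B>; X \<in> Hom1 \<B> a b\<rbrakk>
        \<Longrightarrow> is_adjunction \<B> a b (X\<^sup>\<dagger>) X (ev \<B> X) (coev \<B> X)"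
    and dual_right_adjoint:
      "\<lbrakk>a \<in> Obj \<B>; b \<in> Obj \<B>; X \<in> Hom1 \<B> a b\<rbrakk>
        \<Longrightarrow> is_adjunction \<B> b a X (X\<^sup>\<dagger>) (tev \<B> X) (tcoev \<B> X)"
    and pivotal_map:
      "\<lbrakk>a \<in> Obj \<B>; b \<in> Obj \<B>; X \<in> Hom1 \<B> a b; Z \<in> Hom1 \<B> a b; \<phi> \<in> Hom2 \<B> Z X\<rbrakk>
        \<Longrightarrow> \<r> (Z\<^sup>\<dagger>) \<cdot> (\<one> (Z\<^sup>\<dagger>) \<otimes> tev \<B> X) \<cdot> (\<one> (Z\<^sup>\<dagger>) \<otimes> (\<phi> \<otimes> \<one> (X\<^sup>\<dagger>)))
              \<cdot> \<a> (Z\<^sup>\<dagger>) Z (X\<^sup>\<dagger>) \<cdot> (tcoev \<B> Z \<otimes> \<one> (X\<^sup>\<dagger>)) \<cdot> \<l>\<inverse> (X\<^sup>\<dagger>)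
          = \<l> (Z\<^sup>\<dagger>) \<cdot> (ev \<B> X \<otimes> \<one> (Z\<^sup>\<dagger>)) \<cdot> \<a>\<inverse> (X\<^sup>\<dagger>) X (Z\<^sup>\<dagger>)
              \<cdot> (\<one> (X\<^sup>\<dagger>) \<otimes> (\<phi> \<otimes> \<one> (Z\<^sup>\<dagger>))) \<cdot> (\<one> (X\<^sup>\<dagger>) \<otimes> coev \<B> Z) \<cdot> \<r>\<inverse> (X\<^sup>\<dagger>)"
    and pivotal_tensor:
      "\<lbrakk>a \<in> Obj \<B>; b \<in> Obj \<B>; c \<in> Obj \<B>; X \<in> Hom1 \<B> a b; Y \<in> Hom1 \<B> b c; W = Y \<odot> X\<rbrakk>
        \<Longrightarrow> (\<one> (X\<^sup>\<dagger>) \<otimes> \<r> (Y\<^sup>\<dagger>))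
              \<cdot> (\<one> (X\<^sup>\<dagger>) \<otimes> (\<one> (Y\<^sup>\<dagger>) \<otimes> tev \<B> W))
              \<cdot> (\<one> (X\<^sup>\<dagger>) \<otimes> (\<one> (Y\<^sup>\<dagger>) \<otimes> \<a>\<inverse> Y X (W\<^sup>\<dagger>)))
              \<cdot> (\<one> (X\<^sup>\<dagger>) \<otimes> \<a> (Y\<^sup>\<dagger>) Y (X \<odot> W\<^sup>\<dagger>))
              \<cdot> (\<one> (X\<^sup>\<dagger>) \<otimes> (tcoev \<B> Y \<otimes> \<one> (X \<odot> W\<^sup>\<dagger>)))
              \<cdot> (\<one> (X\<^sup>\<dagger>) \<otimes> \<l>\<inverse> (X \<odot> W\<^sup>\<dagger>))
              \<cdot> \<a> (X\<^sup>\<dagger>) X (W\<^sup>\<dagger>) \<cdot> (tcoev \<B> X \<otimes> \<one> (W\<^sup>\<dagger>)) \<cdot> \<l>\<inverse> (W\<^sup>\<dagger>)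
          = \<l> (X\<^sup>\<dagger> \<odot> Y\<^sup>\<dagger>)
              \<cdot> (ev \<B> W \<otimes> \<one> (X\<^sup>\<dagger> \<odot> Y\<^sup>\<dagger>))
              \<cdot> \<a>\<inverse> (W\<^sup>\<dagger>) W (X\<^sup>\<dagger> \<odot> Y\<^sup>\<dagger>)
              \<cdot> (\<one> (W\<^sup>\<dagger>) \<otimes> \<a>\<inverse> Y X (X\<^sup>\<dagger> \<odot> Y\<^sup>\<dagger>))
              \<cdot> (\<one> (W\<^sup>\<dagger>) \<otimes> (\<one> Y \<otimes> \<a> X (X\<^sup>\<dagger>) (Y\<^sup>\<dagger>)))
              \<cdot> (\<one> (W\<^sup>\<dagger>) \<otimes> (\<one> Y \<otimes> (coev \<B> X \<otimes> \<one> (Y\<^sup>\<dagger>))))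
              \<cdot> (\<one> (W\<^sup>\<dagger>) \<otimes> (\<one> Y \<otimes> \<l>\<inverse> (Y\<^sup>\<dagger>)))
              \<cdot> (\<one> (W\<^sup>\<dagger>) \<otimes> coev \<B> Y) \<cdot> \<r>\<inverse> (W\<^sup>\<dagger>)"

definition trace_left :: "('o, 'x, 'f, 'z) pivotal_data_scheme \<Rightarrow> 'x \<Rightarrow> 'f \<Rightarrow> 'f"
  where "trace_left \<B> X \<Psi> = ev \<B> X \<cdot> (\<one> (X\<^sup>\<dagger>) \<otimes> \<Psi>) \<cdot> tcoev \<B> X"
  for \<B> (structure)

definition trace_right :: "('o, 'x, 'f, 'z) pivotal_data_scheme \<Rightarrow> 'x \<Rightarrow> 'f \<Rightarrow> 'f"
  where "trace_right \<B> X \<Psi> = tev \<B> X \<cdot> (\<Psi> \<otimes> \<one> (X\<^sup>\<dagger>)) \<cdot> coev \<B> X"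
  for \<B> (structure)


section \<open>Linear and idempotent complete categories of 1-morphisms\<close>

record ('o, 'x, 'f) linear_pivotal_data = "('o, 'x, 'f) pivotal_data" +
  zero2 :: "'x \<Rightarrow> 'x \<Rightarrow> 'f"
  add2 :: "'f \<Rightarrow> 'f \<Rightarrow> 'f" (infixl "\<oplus>\<index>" 60)
  scale2 :: "complex \<Rightarrow> 'f \<Rightarrow> 'f" (infixr "\<odot>\<^sub>\<complex>\<index>" 75)

text \<open>
  Linearity concerns the categories of 1-morphisms only: vertical composition is bilinear, and
  nothing is required of horizontal composition.
\<close>

locale linear_pivotal_bicategory = pivotal_bicategory \<B>
  for \<B> :: "('o, 'x, 'f, 'z) linear_pivotal_data_scheme" (structure) +
  assumes zero_closed:
      "\<lbrakk>a \<in> Obj \<B>; b \<in> Obj \<B>; X \<in> Hom1 \<B> a b; Y \<in> Hom1 \<B> a b\<rbrakk>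
        \<Longrightarrow> zero2 \<B> X Y \<in> Hom2 \<B> X Y"
    and add_closed:
      "\<lbrakk>a \<in> Obj \<B>; b \<in> Obj \<B>; X \<in> Hom1 \<B> a b; Y \<in> Hom1 \<B> a b;
        f \<in> Hom2 \<B> X Y; g \<in> Hom2 \<B> X Y\<rbrakk> \<Longrightarrow> f \<oplus> g \<in> Hom2 \<B> X Y"
    and scale_closed:
      "\<lbrakk>a \<in> Obj \<B>; b \<in> Obj \<B>; X \<in> Hom1 \<B> a b; Y \<in> Hom1 \<B> a b; f \<in> Hom2 \<B> X Y\<rbrakk>
        \<Longrightarrow> r \<odot>\<^sub>\<complex> f \<in> Hom2 \<B> X Y"
    and add_assoc:
      "\<lbrakk>a \<in> Obj \<B>; b \<in> Obj \<B>; X \<in> Hom1 \<B> a b; Y \<in> Hom1 \<B> a b;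
        f \<in> Hom2 \<B> X Y; g \<in> Hom2 \<B> X Y; h \<in> Hom2 \<B> X Y\<rbrakk>
        \<Longrightarrow> (f \<oplus> g) \<oplus> h = f \<oplus> (g \<oplus> h)"
    and add_commute:
      "\<lbrakk>a \<in> Obj \<B>; b \<in> Obj \<B>; X \<in> Hom1 \<B> a b; Y \<in> Hom1 \<B> a b;
        f \<in> Hom2 \<B> X Y; g \<in> Hom2 \<B> X Y\<rbrakk> \<Longrightarrow> f \<oplus> g = g \<oplus> f"
    and add_zero:
      "\<lbrakk>a \<in> Obj \<B>; b \<in> Obj \<B>; X \<in> Hom1 \<B> a b; Y \<in> Hom1 \<B> a b; f \<in> Hom2 \<B> X Y\<rbrakk>
        \<Longrightarrow> zero2 \<B> X Y \<oplus> f = f"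
    and add_inverse:
      "\<lbrakk>a \<in> Obj \<B>; b \<in> Obj \<B>; X \<in> Hom1 \<B> a b; Y \<in> Hom1 \<B> a b; f \<in> Hom2 \<B> X Y\<rbrakk>
        \<Longrightarrow> \<exists>g\<in>Hom2 \<B> X Y. f \<oplus> g = zero2 \<B> X Y"
    and scale_one:
      "\<lbrakk>a \<in> Obj \<B>; b \<in> Obj \<B>; X \<in> Hom1 \<B> a b; Y \<in> Hom1 \<B> a b; f \<in> Hom2 \<B> X Y\<rbrakk>
        \<Longrightarrow> 1 \<odot>\<^sub>\<complex> f = f"
    and scale_scale:
      "\<lbrakk>a \<in> Obj \<B>; b \<in> Obj \<B>; X \<in> Hom1 \<B> a b; Y \<in> Hom1 \<B> a b; f \<in> Hom2 \<B> X Y\<rbrakk>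
        \<Longrightarrow> r \<odot>\<^sub>\<complex> (s \<odot>\<^sub>\<complex> f) = (r * s) \<odot>\<^sub>\<complex> f"
    and scale_add_left:
      "\<lbrakk>a \<in> Obj \<B>; b \<in> Obj \<B>; X \<in> Hom1 \<B> a b; Y \<in> Hom1 \<B> a b; f \<in> Hom2 \<B> X Y\<rbrakk>
        \<Longrightarrow> (r + s) \<odot>\<^sub>\<complex> f = (r \<odot>\<^sub>\<complex> f) \<oplus> (s \<odot>\<^sub>\<complex> f)"
    and scale_add_right:
      "\<lbrakk>a \<in> Obj \<B>; b \<in> Obj \<B>; X \<in> Hom1 \<B> a b; Y \<in> Hom1 \<B> a b;
        f \<in> Hom2 \<B> X Y; g \<in> Hom2 \<B> X Y\<rbrakk>
        \<Longrightarrow> r \<odot>\<^sub>\<complex> (f \<oplus> g) = (r \<odot>\<^sub>\<complex> f) \<oplus> (r \<odot>\<^sub>\<complex> g)"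
    and vcomp_add_left:
      "\<lbrakk>a \<in> Obj \<B>; b \<in> Obj \<B>; X \<in> Hom1 \<B> a b; Y \<in> Hom1 \<B> a b; Z \<in> Hom1 \<B> a b;
        f \<in> Hom2 \<B> X Y; g \<in> Hom2 \<B> Y Z; h \<in> Hom2 \<B> Y Z\<rbrakk>
        \<Longrightarrow> (g \<oplus> h) \<cdot> f = (g \<cdot> f) \<oplus> (h \<cdot> f)"
    and vcomp_add_right:
      "\<lbrakk>a \<in> Obj \<B>; b \<in> Obj \<B>; X \<in> Hom1 \<B> a b; Y \<in> Hom1 \<B> a b; Z \<in> Hom1 \<B> a b;
        f \<in> Hom2 \<B> X Y; g \<in> Hom2 \<B> X Y; h \<in> Hom2 \<B> Y Z\<rbrakk>
        \<Longrightarrow> h \<cdot> (f \<oplus> g) = (h \<cdot> f) \<oplus> (h \<cdot> g)"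
    and vcomp_scale:
      "\<lbrakk>a \<in> Obj \<B>; b \<in> Obj \<B>; X \<in> Hom1 \<B> a b; Y \<in> Hom1 \<B> a b; Z \<in> Hom1 \<B> a b;
        f \<in> Hom2 \<B> X Y; g \<in> Hom2 \<B> Y Z\<rbrakk>
        \<Longrightarrow> (r \<odot>\<^sub>\<complex> g) \<cdot> f = r \<odot>\<^sub>\<complex> (g \<cdot> f) \<and> g \<cdot> (r \<odot>\<^sub>\<complex> f) = r \<odot>\<^sub>\<complex> (g \<cdot> f)"

definition idempotent_complete_homs :: "('o, 'x, 'f, 'z) bicategory_data_scheme \<Rightarrow> bool"
  where "idempotent_complete_homs \<B> \<longleftrightarrow>
    (\<forall>a\<in>Obj \<B>. \<forall>b\<in>Obj \<B>. \<forall>X\<in>Hom1 \<B> a b. \<forall>e\<in>Hom2 \<B> X X. e \<cdot> e = e \<longrightarrow>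
      (\<exists>Z\<in>Hom1 \<B> a b. \<exists>p\<in>Hom2 \<B> X Z. \<exists>i\<in>Hom2 \<B> Z X. p \<cdot> i = \<one> Z \<and> i \<cdot> p = e))"
  for \<B> (structure)

definition linear_on_End_unit ::
    "('o, 'x, 'f, 'z) linear_pivotal_data_scheme \<Rightarrow> 'o \<Rightarrow> ('f \<Rightarrow> complex) \<Rightarrow> bool"
  where "linear_on_End_unit \<B> a t \<longleftrightarrow>
    (\<forall>f\<in>Hom2 \<B> (\<I> a) (\<I> a). \<forall>g\<in>Hom2 \<B> (\<I> a) (\<I> a). t (f \<oplus> g) = t f + t g) \<and>
    (\<forall>r. \<forall>f\<in>Hom2 \<B> (\<I> a) (\<I> a). t (r \<odot>\<^sub>\<complex> f) = r * t f)"
  for \<B> (structure)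


section \<open>Symmetric separable Frobenius algebras\<close>

record ('x, 'f) frobenius_data =
  carr :: 'x
  mul :: 'f
  unt :: 'f
  comul :: 'f
  counit :: 'f

definition is_algebra ::
    "('o, 'x, 'f, 'z) bicategory_data_scheme \<Rightarrow> 'o \<Rightarrow> 'x \<Rightarrow> 'f \<Rightarrow> 'f \<Rightarrow> bool"
  where "is_algebra \<B> a A \<mu> \<eta> \<longleftrightarrow>
    A \<in> Hom1 \<B> a a \<and> \<mu> \<in> Hom2 \<B> (A \<odot> A) A \<and> \<eta> \<in> Hom2 \<B> (\<I> a) A \<and>
    \<mu> \<cdot> (\<mu> \<otimes> \<one> A) = \<mu> \<cdot> (\<one> A \<otimes> \<mu>) \<cdot> \<a> A A A \<and>
    \<mu> \<cdot> (\<eta> \<otimes> \<one> A) = \<l> A \<and> \<mu> \<cdot> (\<one> A \<otimes> \<eta>) = \<r> A"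
  for \<B> (structure)

definition is_coalgebra ::
    "('o, 'x, 'f, 'z) bicategory_data_scheme \<Rightarrow> 'o \<Rightarrow> 'x \<Rightarrow> 'f \<Rightarrow> 'f \<Rightarrow> bool"
  where "is_coalgebra \<B> a A \<Delta> \<epsilon> \<longleftrightarrow>
    A \<in> Hom1 \<B> a a \<and> \<Delta> \<in> Hom2 \<B> A (A \<odot> A) \<and> \<epsilon> \<in> Hom2 \<B> A (\<I> a) \<and>
    \<a> A A A \<cdot> (\<Delta> \<otimes> \<one> A) \<cdot> \<Delta> = (\<one> A \<otimes> \<Delta>) \<cdot> \<Delta> \<and>
    (\<epsilon> \<otimes> \<one> A) \<cdot> \<Delta> = \<l>\<inverse> A \<and> (\<one> A \<otimes> \<epsilon>) \<cdot> \<Delta> = \<r>\<inverse> A"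
  for \<B> (structure)

definition is_frobenius_algebra ::
    "('o, 'x, 'f, 'z) bicategory_data_scheme \<Rightarrow> 'o \<Rightarrow> ('x, 'f) frobenius_data \<Rightarrow> bool"
  where "is_frobenius_algebra \<B> a F \<longleftrightarrow>
    (let A = carr F; \<mu> = mul F; \<Delta> = comul F in
      is_algebra \<B> a A \<mu> (unt F) \<and> is_coalgebra \<B> a A \<Delta> (counit F) \<and>
      (\<one> A \<otimes> \<mu>) \<cdot> \<a> A A A \<cdot> (\<Delta> \<otimes> \<one> A) = \<Delta> \<cdot> \<mu> \<and>
      (\<mu> \<otimes> \<one> A) \<cdot> \<a>\<inverse> A A A \<cdot> (\<one> A \<otimes> \<Delta>) = \<Delta> \<cdot> \<mu>)"
  for \<B> (structure)

definition is_separable ::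
    "('o, 'x, 'f, 'z) bicategory_data_scheme \<Rightarrow> ('x, 'f) frobenius_data \<Rightarrow> bool"
  where "is_separable \<B> F \<longleftrightarrow> mul F \<cdot> comul F = \<one> (carr F)"
  for \<B> (structure)

definition is_symmetric ::
    "('o, 'x, 'f, 'z) pivotal_data_scheme \<Rightarrow> ('x, 'f) frobenius_data \<Rightarrow> bool"
  where "is_symmetric \<B> F \<longleftrightarrow>
    (let A = carr F; \<kappa> = counit F \<cdot> mul F in
      \<l> (A\<^sup>\<dagger>) \<cdot> (\<kappa> \<otimes> \<one> (A\<^sup>\<dagger>)) \<cdot> \<a>\<inverse> A A (A\<^sup>\<dagger>) \<cdot> (\<one> A \<otimes> coev \<B> A) \<cdot> \<r>\<inverse> A
      = \<r> (A\<^sup>\<dagger>) \<cdot> (\<one> (A\<^sup>\<dagger>) \<otimes> \<kappa>) \<cdot> \<a> (A\<^sup>\<dagger>) A A \<cdot> (tcoev \<B> A \<otimes> \<one> A) \<cdot> \<l>\<inverse> A)"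
  for \<B> (structure)


section \<open>The orbifold completion\<close>

text \<open>
  Objects, 1-morphisms and 2-morphisms of the orbifold completion; vertical composition and zero
  maps of its 2-morphisms are those of \<open>\<B>\<close>. A bimodule record does not mention
  the objects of the orbifold completion between which it is a 1-morphism, so these are arguments
  of \<open>orb_Hom2\<close>.
\<close>

record ('x, 'f) bimodule_data =
  mcarr :: 'x
  lact :: 'f
  ract :: 'f

definition orb_Obj ::
    "('o, 'x, 'f, 'z) pivotal_data_scheme \<Rightarrow> ('o \<times> ('x, 'f) frobenius_data) set"
  where "orb_Obj \<B> = {(a, A). a \<in> Obj \<B> \<and>
    is_frobenius_algebra \<B> a A \<and> is_separable \<B> A \<and> is_symmetric \<B> A}"

definition orb_Hom1 ::
    "('o, 'x, 'f, 'z) bicategory_data_scheme \<Rightarrow> 'o \<times> ('x, 'f) frobenius_data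
      \<Rightarrow> 'o \<times> ('x, 'f) frobenius_data \<Rightarrow> ('x, 'f) bimodule_data set"
  where "orb_Hom1 \<B> P Q = {M.
    (let a = fst P; b = fst Q; A = carr (snd P); B = carr (snd Q);
         X = mcarr M; l = lact M; r = ract M in
      X \<in> Hom1 \<B> a b \<and> l \<in> Hom2 \<B> (B \<odot> X) X \<and> r \<in> Hom2 \<B> (X \<odot> A) X \<and>
      l \<cdot> (mul (snd Q) \<otimes> \<one> X) = l \<cdot> (\<one> B \<otimes> l) \<cdot> \<a> B B X \<and>
      l \<cdot> (unt (snd Q) \<otimes> \<one> X) = \<l> X \<and>
      r \<cdot> (r \<otimes> \<one> A) = r \<cdot> (\<one> X \<otimes> mul (snd P)) \<cdot> \<a> X A A \<and>
      r \<cdot> (\<one> X \<otimes> unt (snd P)) = \<r> X \<and>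
      r \<cdot> (l \<otimes> \<one> A) = l \<cdot> (\<one> B \<otimes> r) \<cdot> \<a> B X A)}"
  for \<B> (structure)

definition orb_Hom2 ::
    "('o, 'x, 'f, 'z) bicategory_data_scheme \<Rightarrow> 'o \<times> ('x, 'f) frobenius_data
      \<Rightarrow> 'o \<times> ('x, 'f) frobenius_data
      \<Rightarrow> ('x, 'f) bimodule_data \<Rightarrow> ('x, 'f) bimodule_data \<Rightarrow> 'f set"
  where "orb_Hom2 \<B> P Q M N = {\<phi> \<in> Hom2 \<B> (mcarr M) (mcarr N).
    \<phi> \<cdot> lact M = lact N \<cdot> (\<one> (carr (snd Q)) \<otimes> \<phi>) \<and>
    \<phi> \<cdot> ract M = ract N \<cdot> (\<phi> \<otimes> \<one> (carr (snd P)))}"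
  for \<B> (structure)


section \<open>Pairings\<close>

definition nondegenerate_pairing ::
    "'v set \<Rightarrow> 'v \<Rightarrow> 'w set \<Rightarrow> 'w \<Rightarrow> ('v \<Rightarrow> 'w \<Rightarrow> complex) \<Rightarrow> bool"
  where "nondegenerate_pairing V zV W zW p \<longleftrightarrow>
    (\<forall>v\<in>V. (\<forall>w\<in>W. p v w = 0) \<longrightarrow> v = zV) \<and>
    (\<forall>w\<in>W. (\<forall>v\<in>V. p v w = 0) \<longrightarrow> w = zW)"

definition trace_pairing ::
    "('o, 'x, 'f, 'z) pivotal_data_scheme \<Rightarrow> ('f \<Rightarrow> complex) \<Rightarrow> 'x \<Rightarrow> 'f \<Rightarrow> 'f \<Rightarrow> complex"
  where "trace_pairing \<B> t X \<Psi>\<^sub>1 \<Psi>\<^sub>2 = t (trace_left \<B> X (\<Psi>\<^sub>1 \<cdot> \<Psi>\<^sub>2))"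
  for \<B> (structure)

end

theory Submission
  imports Defs
begin

text \<open>
  The restricted pairing is nondegenerate because every 2-morphism can be averaged to a bimodule map
  without changing its pairing with bimodule maps. For a left module with action \<open>l\<close> over the Frobenius
  algebra \<open>B\<close>, the copairing \<open>\<Delta> \<circ> \<eta> : \<I> \<rightarrow> B \<odot> B\<close> turns the action into a coaction
  \<open>\<delta> : Y \<rightarrow> B \<odot> Y\<close>, and the average of \<open>\<psi> : Y \<rightarrow> X\<close> is \<open>l \<circ> (1 \<otimes> \<psi>) \<circ> \<delta>\<close>: a \<open>B\<close>-line leaves the strand
  below \<open>\<psi>\<close> and is absorbed above it. The Frobenius relations make it \<open>B\<close>-linear
  (\<open>left_average_linear\<close>), and forming it commutes with composition with \<open>B\<close>-linear maps on either side
  (\<open>left_average_comp\<close>). Averaging over \<open>A\<close> on the right and then over \<open>B\<close> on the left produces a bimodule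
  map. So if a bimodule map \<open>v\<close> pairs to zero with all bimodule maps, then for an arbitrary \<open>w\<close> the average
  of \<open>v \<circ> w\<close> is \<open>v\<close> composed with the average of \<open>w\<close>, and the linear form sends its trace to zero. Once
  averaging is known to preserve the values of traces, \<open>v\<close> pairs to zero with \<open>w\<close>, whence \<open>v = 0\<close>. The same argument
  applies to the second variable.

  It remains to see that averaging preserves these values. In the left trace of an endomorphism of
  \<open>X : a \<rightarrow> b\<close> the region \<open>b\<close> is enclosed by the \<open>X\<close>-loop, so the \<open>B\<close>-line of a left average runs inside
  the loop and can be slid along its empty arc, the strand of the dual of \<open>X\<close>. There it becomes the
  composite of a coaction and an action of \<open>B\<close> on the dual, which is the identity since
  \<open>\<mu> \<circ> \<Delta> \<circ> \<eta> = \<eta>\<close>. Rotating the action around the left end of the loop uses one pair of adjunctions, and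
  rotating the coaction around the right end uses the other; the pivotal axioms, together with the
  symmetry of \<open>B\<close>, are exactly what makes the two results fit together. This is the theorem \<open>bubble\<close>, and
  \<open>trace_left_average\<close> is its form in the bicategory. Exchanging left and right gives the same for
  averages over \<open>A\<close> and the right trace, where \<open>a\<close> is the region inside the loop; the hypothesis on \<open>X\<close>
  moves between the two traces.

  The sliding argument is an equation between 2-morphisms of a weak bicategory. It is carried out
  after a strictification: a 2-morphism \<open>\<phi> : X \<rightarrow> Y\<close> is replaced by the natural family of the
  \<open>\<phi> \<otimes> 1\<close> on \<open>X \<odot> P\<close> for all \<open>P\<close>, with the source and the target rebracketed to the right. Under this
  replacement associators and unitors become identities, horizontal composition becomes functor
  application, and the interchange law becomes naturality. Taking \<open>P\<close> to be a unit 1-morphism shows that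
  nothing is lost (\<open>strict_faithful\<close>).
\<close>

section \<open>Formal 1-morphisms and total 2-cells\<close>

text \<open>
  A 1-morphism of the bicategory does not determine its source, its target or the way it was composed.
  Formal composites of 1-morphisms record all three.
\<close>

datatype ('o, 'x) term1 =
    Unit1 'o | Gen1 'o 'o 'x | Prod1 "('o, 'x) term1" "('o, 'x) term1"

text \<open>
  The value \<open>Undef\<close> absorbs every ill-typed composite. It makes associativity and interchange hold without
  typing hypotheses, so that they can be used as unconditional rewrite rules.
\<close>

datatype ('o, 'x, 'f) cell2 = Undef | Cell2 "('o, 'x) term1" 'f "('o, 'x) term1"

primrec src :: "('o, 'x) term1 \<Rightarrow> 'o" where
  "src (Unit1 a) = a" | "src (Gen1 a b X) = a" | "src (Prod1 s t) = src t"

primrec tgt :: "('o, 'x) term1 \<Rightarrow> 'o" where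
  "tgt (Unit1 a) = a" | "tgt (Gen1 a b X) = b" | "tgt (Prod1 s t) = tgt s"

primrec Dom :: "('o, 'x, 'f) cell2 \<Rightarrow> ('o, 'x) term1" where
  "Dom (Cell2 s f t) = s"

primrec Cod :: "('o, 'x, 'f) cell2 \<Rightarrow> ('o, 'x) term1" where
  "Cod (Cell2 s f t) = t"

text \<open>
  \<open>app t P\<close> is the right-bracketed form of \<open>t\<close> followed by \<open>P\<close>, with the units in \<open>t\<close> removed: the functor
  that composes with \<open>t\<close>, evaluated at \<open>P\<close>. The functor of a composite is the composite of the functors on the
  nose, and this is why the associators disappear below.
\<close>

primrec app :: "('o, 'x) term1 \<Rightarrow> ('o, 'x) term1 \<Rightarrow> ('o, 'x) term1" where
  "app (Unit1 a) P = P" |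
  "app (Gen1 a b X) P = Prod1 (Gen1 a b X) P" |
  "app (Prod1 s t) P = app s (app t P)"

context bicategory
begin

primrec val :: "('o, 'x) term1 \<Rightarrow> 'x" where
  "val (Unit1 a) = \<I> a" | "val (Gen1 a b X) = X" | "val (Prod1 s t) = val s \<odot> val t"

primrec wf1 :: "('o, 'x) term1 \<Rightarrow> bool" where
  "wf1 (Unit1 a) \<longleftrightarrow> a \<in> Obj \<B>" |
  "wf1 (Gen1 a b X) \<longleftrightarrow> a \<in> Obj \<B> \<and> b \<in> Obj \<B> \<and> X \<in> Hom1 \<B> a b" |
  "wf1 (Prod1 s t) \<longleftrightarrow> wf1 s \<and> wf1 t \<and> src s = tgt t"

lemma wf1_Obj: "wf1 t \<Longrightarrow> src t \<in> Obj \<B> \<and> tgt t \<in> Obj \<B>"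
  by (induction t) auto

lemma src_Obj [simp]: "wf1 t \<Longrightarrow> src t \<in> Obj \<B>"
  and tgt_Obj [simp]: "wf1 t \<Longrightarrow> tgt t \<in> Obj \<B>"
  using wf1_Obj by blast+

lemma val_closed [simp]: "wf1 t \<Longrightarrow> val t \<in> Hom1 \<B> (src t) (tgt t)"
proof (induction t)
  case (Prod1 s t)
  then show ?case
    using comp1_closed[of "src t" "tgt t" "tgt s" "val t" "val s"] by simp
qed (auto intro: unit1_closed)

lemma val_closed' [simp]:
  "wf1 t \<Longrightarrow> src t = a \<Longrightarrow> tgt t = b \<Longrightarrow> val t \<in> Hom1 \<B> a b"
  by auto

definition typed :: "('o, 'x) term1 \<Rightarrow> 'f \<Rightarrow> ('o, 'x) term1 \<Rightarrow> bool" where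
  "typed s f t \<longleftrightarrow> wf1 s \<and> wf1 t \<and> src s = src t \<and> tgt s = tgt t \<and> f \<in> Hom2 \<B> (val s) (val t)"

primrec ok :: "('o, 'x, 'f) cell2 \<Rightarrow> bool" where
  "ok Undef \<longleftrightarrow> False" | "ok (Cell2 s f t) \<longleftrightarrow> typed s f t"

definition vc :: "('o, 'x, 'f) cell2 \<Rightarrow> ('o, 'x, 'f) cell2 \<Rightarrow> ('o, 'x, 'f) cell2" (infixr "\<bullet>" 60)
  where "g \<bullet> f = (case g of Undef \<Rightarrow> Undef | Cell2 t' g' u \<Rightarrow>
    (case f of Undef \<Rightarrow> Undef | Cell2 s f' t \<Rightarrow>
      if ok g \<and> ok f \<and> t' = t then Cell2 s (g' \<cdot> f') u else Undef))"

definition hc :: "('o, 'x, 'f) cell2 \<Rightarrow> ('o, 'x, 'f) cell2 \<Rightarrow> ('o, 'x, 'f) cell2" (infixr "\<star>" 65)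
  where "g \<star> f = (case g of Undef \<Rightarrow> Undef | Cell2 t g' t' \<Rightarrow>
    (case f of Undef \<Rightarrow> Undef | Cell2 s f' s' \<Rightarrow>
      if ok g \<and> ok f \<and> src t = tgt s then Cell2 (Prod1 t s) (g' \<otimes> f') (Prod1 t' s') else Undef))"

definition Id :: "('o, 'x) term1 \<Rightarrow> ('o, 'x, 'f) cell2" where
  "Id t = (if wf1 t then Cell2 t (\<one> (val t)) t else Undef)"

lemma typed_vcomp [intro]: "typed s f t \<Longrightarrow> typed t g u \<Longrightarrow> typed s (g \<cdot> f) u"
  using vcomp_closed[of "src s" "tgt s" "val s" "val t" "val u" f g]
  by (simp add: typed_def)

lemma typed_hcomp:
  "typed s f s' \<Longrightarrow> typed t g t' \<Longrightarrow> src t = tgt s \<Longrightarrow> typed (Prod1 t s) (g \<otimes> f) (Prod1 t' s')"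
  using hcomp_closed[of "src s" "tgt s" "tgt t" "val s" "val s'" "val t" "val t'" f g]
  by (simp add: typed_def)

lemma typed_id [simp]: "wf1 t \<Longrightarrow> typed t (\<one> (val t)) t"
  unfolding typed_def by (auto intro: id2_closed[of "src t" "tgt t"])

lemma ok_Id [simp]: "ok (Id t) \<longleftrightarrow> wf1 t"
  by (simp add: Id_def)

lemma Dom_Id [simp]: "wf1 t \<Longrightarrow> Dom (Id t) = t"
  and Cod_Id [simp]: "wf1 t \<Longrightarrow> Cod (Id t) = t"
  by (simp_all add: Id_def)

lemma ok_vc [simp]: "ok (g \<bullet> f) \<longleftrightarrow> ok g \<and> ok f \<and> Cod f = Dom g"
  by (cases g; cases f) (auto simp: vc_def)

lemma Dom_vc [simp]: "ok g \<Longrightarrow> ok f \<Longrightarrow> Cod f = Dom g \<Longrightarrow> Dom (g \<bullet> f) = Dom f"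
  and Cod_vc [simp]: "ok g \<Longrightarrow> ok f \<Longrightarrow> Cod f = Dom g \<Longrightarrow> Cod (g \<bullet> f) = Cod g"
  by (cases g; cases f; simp add: vc_def)+

lemma wf1_Dom [simp]: "ok f \<Longrightarrow> wf1 (Dom f)"
  and wf1_Cod [simp]: "ok f \<Longrightarrow> wf1 (Cod f)"
  and src_Cod [simp]: "ok f \<Longrightarrow> src (Cod f) = src (Dom f)"
  and tgt_Cod [simp]: "ok f \<Longrightarrow> tgt (Cod f) = tgt (Dom f)"
  by (cases f; simp add: typed_def)+

lemma ok_hc [simp]: "ok (g \<star> f) \<longleftrightarrow> ok g \<and> ok f \<and> src (Dom g) = tgt (Dom f)"
  by (cases g; cases f) (auto simp: hc_def typed_hcomp)

lemma Dom_hc [simp]: "ok g \<Longrightarrow> ok f \<Longrightarrow> src (Dom g) = tgt (Dom f) \<Longrightarrow> Dom (g \<star> f) = Prod1 (Dom g) (Dom f)"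
  and Cod_hc [simp]: "ok g \<Longrightarrow> ok f \<Longrightarrow> src (Dom g) = tgt (Dom f) \<Longrightarrow> Cod (g \<star> f) = Prod1 (Cod g) (Cod f)"
  by (cases g; cases f; simp add: hc_def)+

lemma vc_notok: "\<not> (ok g \<and> ok f \<and> Cod f = Dom g) \<Longrightarrow> g \<bullet> f = Undef"
  by (cases g; cases f) (auto simp: vc_def)

lemma hc_notok: "\<not> (ok g \<and> ok f \<and> src (Dom g) = tgt (Dom f)) \<Longrightarrow> g \<star> f = Undef"
  by (cases g; cases f) (auto simp: hc_def)

lemma vc_assoc: "(h \<bullet> g) \<bullet> f = h \<bullet> (g \<bullet> f)"
proof (cases "ok h \<and> ok g \<and> ok f \<and> Cod f = Dom g \<and> Cod g = Dom h")
  case True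
  then obtain s f' t g' u h' v where e: "f = Cell2 s f' t" "g = Cell2 t g' u" "h = Cell2 u h' v"
    by (cases f; cases g; cases h) auto
  have ty: "typed s f' t" "typed t g' u" "typed u h' v"
    using True e by auto
  have "(h' \<cdot> g') \<cdot> f' = h' \<cdot> (g' \<cdot> f')"
    using ty vcomp_assoc[of "src s" "tgt s" "val s" "val t" "val u" "val v" f' g' h']
    by (simp add: typed_def)
  then show ?thesis
    using ty by (auto simp: e vc_def)
next
  case False
  have "(h \<bullet> g) \<bullet> f = Undef"
    using False by (intro vc_notok) auto
  moreover have "h \<bullet> (g \<bullet> f) = Undef"
    using False by (intro vc_notok) auto
  ultimately show ?thesis by simp
qed

lemma Id_vc [simp]: "ok f \<Longrightarrow> Cod f = t \<Longrightarrow> Id t \<bullet> f = f"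
  using vcomp_id_left[of "src (Dom f)" "tgt (Dom f)" "val (Dom f)" "val (Cod f)"]
  by (cases f) (auto simp: Id_def vc_def typed_def id2_closed[of "src t" "tgt t"])

lemma vc_Id [simp]: "ok f \<Longrightarrow> Dom f = t \<Longrightarrow> f \<bullet> Id t = f"
  using vcomp_id_right[of "src (Dom f)" "tgt (Dom f)" "val (Dom f)" "val (Cod f)"]
  by (cases f) (auto simp: Id_def vc_def typed_def id2_closed[of "src t" "tgt t"])

lemma Id_hc_Id: "src s = tgt t \<Longrightarrow> Id s \<star> Id t = Id (Prod1 s t)"
proof (cases "wf1 s \<and> wf1 t")
  case True
  moreover assume "src s = tgt t"
  ultimately show ?thesis
    using hcomp_id[of "src t" "tgt t" "tgt s" "val t" "val s"] val_closed[of s]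
    by (simp add: Id_def hc_def)
next
  case False
  then show ?thesis by (auto simp: Id_def hc_def)
qed

lemma interchange2: "(g' \<bullet> g) \<star> (f' \<bullet> f) = (g' \<star> f') \<bullet> (g \<star> f)"
proof (cases "ok g' \<and> ok g \<and> ok f' \<and> ok f \<and> Cod f = Dom f' \<and> Cod g = Dom g' \<and> src (Dom g) = tgt (Dom f)")
  case True
  then obtain s f1 t f2 u s' g1 t' g2 u' where
    e: "f = Cell2 s f1 t" "f' = Cell2 t f2 u" "g = Cell2 s' g1 t'" "g' = Cell2 t' g2 u'"
    by (cases f; cases g; cases f'; cases g') auto
  have ty: "typed s f1 t" "typed t f2 u" "typed s' g1 t'" "typed t' g2 u'" "src s' = tgt s"
    using True e by auto
  have sr: "src t' = tgt t"
    using ty by (simp add: typed_def)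
  have "(g2 \<cdot> g1) \<otimes> (f2 \<cdot> f1) = (g2 \<otimes> f2) \<cdot> (g1 \<otimes> f1)"
    using ty interchange[of "src s" "tgt s" "tgt s'" "val s" "val t" "val u"
        "val s'" "val t'" "val u'" f1 f2 g1 g2]
    by (simp add: typed_def)
  then show ?thesis
    using ty sr typed_hcomp[OF ty(1,3,5)] typed_hcomp[OF ty(2,4) sr]
    by (auto simp: e vc_def hc_def)
next
  case False
  have "(g' \<bullet> g) \<star> (f' \<bullet> f) = Undef"
    using False by (intro hc_notok) auto
  moreover have "(g' \<star> f') \<bullet> (g \<star> f) = Undef"
    using False by (intro vc_notok) auto
  ultimately show ?thesis by simp
qed

section \<open>Coherence isomorphisms\<close>


definition AS :: "('o, 'x) term1 \<Rightarrow> ('o, 'x) term1 \<Rightarrow> ('o, 'x) term1 \<Rightarrow> ('o, 'x, 'f) cell2" where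
  "AS s t u = Cell2 (Prod1 (Prod1 s t) u) (\<a> (val s) (val t) (val u)) (Prod1 s (Prod1 t u))"

definition AI :: "('o, 'x) term1 \<Rightarrow> ('o, 'x) term1 \<Rightarrow> ('o, 'x) term1 \<Rightarrow> ('o, 'x, 'f) cell2" where
  "AI s t u = Cell2 (Prod1 s (Prod1 t u)) (\<a>\<inverse> (val s) (val t) (val u)) (Prod1 (Prod1 s t) u)"

definition LU :: "('o, 'x) term1 \<Rightarrow> ('o, 'x, 'f) cell2" where
  "LU t = Cell2 (Prod1 (Unit1 (tgt t)) t) (\<l> (val t)) t"

definition LI :: "('o, 'x) term1 \<Rightarrow> ('o, 'x, 'f) cell2" where
  "LI t = Cell2 t (\<l>\<inverse> (val t)) (Prod1 (Unit1 (tgt t)) t)"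

definition RU :: "('o, 'x) term1 \<Rightarrow> ('o, 'x, 'f) cell2" where
  "RU t = Cell2 (Prod1 t (Unit1 (src t))) (\<r> (val t)) t"

definition RI :: "('o, 'x) term1 \<Rightarrow> ('o, 'x, 'f) cell2" where
  "RI t = Cell2 t (\<r>\<inverse> (val t)) (Prod1 t (Unit1 (src t)))"

lemma ok_AS [simp]: "ok (AS s t u) \<longleftrightarrow> wf1 s \<and> wf1 t \<and> wf1 u \<and> src s = tgt t \<and> src t = tgt u"
  and ok_AI [simp]: "ok (AI s t u) \<longleftrightarrow> wf1 s \<and> wf1 t \<and> wf1 u \<and> src s = tgt t \<and> src t = tgt u"
  using assoc_closed[of "src u" "tgt u" "tgt t" "tgt s" "val u" "val t" "val s"]
    assoc_inv_closed[of "src u" "tgt u" "tgt t" "tgt s" "val u" "val t" "val s"]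
  by (auto simp: AS_def AI_def typed_def)

lemma ok_LU [simp]: "ok (LU t) \<longleftrightarrow> wf1 t"
  and ok_LI [simp]: "ok (LI t) \<longleftrightarrow> wf1 t"
  and ok_RU [simp]: "ok (RU t) \<longleftrightarrow> wf1 t"
  and ok_RI [simp]: "ok (RI t) \<longleftrightarrow> wf1 t"
  using lunit_closed[of "src t" "tgt t" "val t"] lunit_inv_closed[of "src t" "tgt t" "val t"]
    runit_closed[of "src t" "tgt t" "val t"] runit_inv_closed[of "src t" "tgt t" "val t"]
  by (auto simp: LU_def LI_def RU_def RI_def typed_def)

lemma Dom_Cod_struct [simp]:
  "Dom (AS s t u) = Prod1 (Prod1 s t) u" "Cod (AS s t u) = Prod1 s (Prod1 t u)"
  "Dom (AI s t u) = Prod1 s (Prod1 t u)" "Cod (AI s t u) = Prod1 (Prod1 s t) u"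
  "Dom (LU t) = Prod1 (Unit1 (tgt t)) t" "Cod (LU t) = t"
  "Dom (LI t) = t" "Cod (LI t) = Prod1 (Unit1 (tgt t)) t"
  "Dom (RU t) = Prod1 t (Unit1 (src t))" "Cod (RU t) = t"
  "Dom (RI t) = t" "Cod (RI t) = Prod1 t (Unit1 (src t))"
  by (simp_all add: AS_def AI_def LU_def LI_def RU_def RI_def)

text \<open>
  An equation of 2-morphisms is transferred to formal 2-cells by evaluating both sides with \<open>val2\<close>; the typing
  conditions are then settled by simplification.
\<close>

primrec val2 :: "('o, 'x, 'f) cell2 \<Rightarrow> 'f" where
  "val2 (Cell2 s f t) = f"

lemma cell2_eqI:
  "ok x \<Longrightarrow> ok y \<Longrightarrow> Dom x = Dom y \<Longrightarrow> Cod x = Cod y \<Longrightarrow> val2 x = val2 y \<Longrightarrow> x = y"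
  by (cases x; cases y) auto

lemma val2_vc [simp]: "ok (g \<bullet> f) \<Longrightarrow> val2 (g \<bullet> f) = val2 g \<cdot> val2 f"
  by (cases g; cases f) (auto simp: vc_def)

lemma val2_hc [simp]: "ok (g \<star> f) \<Longrightarrow> val2 (g \<star> f) = val2 g \<otimes> val2 f"
  by (cases g; cases f) (auto simp: hc_def)

lemma val2_Id [simp]: "wf1 t \<Longrightarrow> val2 (Id t) = \<one> (val t)"
  by (simp add: Id_def)

lemma val2_struct [simp]:
  "val2 (AS s t u) = \<a> (val s) (val t) (val u)" "val2 (AI s t u) = \<a>\<inverse> (val s) (val t) (val u)"
  "val2 (LU t) = \<l> (val t)" "val2 (LI t) = \<l>\<inverse> (val t)"
  "val2 (RU t) = \<r> (val t)" "val2 (RI t) = \<r>\<inverse> (val t)"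
  by (simp_all add: AS_def AI_def LU_def LI_def RU_def RI_def)

lemma val2_closed: "ok f \<Longrightarrow> val2 f \<in> Hom2 \<B> (val (Dom f)) (val (Cod f))"
  by (cases f) (auto simp: typed_def)

lemma AS_AI [simp]:
  assumes "wf1 s" "wf1 t" "wf1 u" "src s = tgt t" "src t = tgt u"
  shows "AS s t u \<bullet> AI s t u = Id (Prod1 s (Prod1 t u))"
    and "AI s t u \<bullet> AS s t u = Id (Prod1 (Prod1 s t) u)"
  using assms assoc_inverse[of "src u" "tgt u" "tgt t" "tgt s" "val u" "val t" "val s"]
  by (auto intro: cell2_eqI)

lemma unitor_inverse [simp]:
  assumes "wf1 t"
  shows "LU t \<bullet> LI t = Id t" "LI t \<bullet> LU t = Id (Prod1 (Unit1 (tgt t)) t)"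
    "RU t \<bullet> RI t = Id t" "RI t \<bullet> RU t = Id (Prod1 t (Unit1 (src t)))"
  using assms lunit_inverse[of "src t" "tgt t" "val t"] runit_inverse[of "src t" "tgt t" "val t"]
  by (auto intro: cell2_eqI)

lemma AS_natural:
  assumes "ok f" "ok g" "ok h" "src (Dom h) = tgt (Dom g)" "src (Dom g) = tgt (Dom f)"
  shows "AS (Cod h) (Cod g) (Cod f) \<bullet> ((h \<star> g) \<star> f) = (h \<star> (g \<star> f)) \<bullet> AS (Dom h) (Dom g) (Dom f)"
proof (rule cell2_eqI)
  show "val2 (AS (Cod h) (Cod g) (Cod f) \<bullet> ((h \<star> g) \<star> f))
      = val2 ((h \<star> (g \<star> f)) \<bullet> AS (Dom h) (Dom g) (Dom f))"
    using assms assoc_natural[of "src (Dom f)" "src (Dom g)" "src (Dom h)" "tgt (Dom h)"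
        "val (Dom f)" "val (Cod f)" "val (Dom g)" "val (Cod g)" "val (Dom h)" "val (Cod h)"
        "val2 f" "val2 g" "val2 h"]
    by (simp add: val2_closed)
qed (use assms in simp_all)

lemma LU_natural: "ok f \<Longrightarrow> LU (Cod f) \<bullet> (Id (Unit1 (tgt (Dom f))) \<star> f) = f \<bullet> LU (Dom f)"
  using lunit_natural[of "src (Dom f)" "tgt (Dom f)" "val (Dom f)" "val (Cod f)" "val2 f"]
  by (intro cell2_eqI) (simp_all add: val2_closed)

lemma RU_natural: "ok f \<Longrightarrow> RU (Cod f) \<bullet> (f \<star> Id (Unit1 (src (Dom f)))) = f \<bullet> RU (Dom f)"
  using runit_natural[of "src (Dom f)" "tgt (Dom f)" "val (Dom f)" "val (Cod f)" "val2 f"]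
  by (intro cell2_eqI) (simp_all add: val2_closed)

lemma pentagon':
  assumes "wf1 s" "wf1 t" "wf1 u" "wf1 v" "src s = tgt t" "src t = tgt u" "src u = tgt v"
  shows "(Id s \<star> AS t u v) \<bullet> AS s (Prod1 t u) v \<bullet> (AS s t u \<star> Id v)
    = AS s t (Prod1 u v) \<bullet> AS (Prod1 s t) u v"
  unfolding vc_assoc[symmetric]
  using assms pentagon[of "src v" "tgt v" "tgt u" "tgt t" "tgt s" "val v" "val u" "val t" "val s"]
  by (intro cell2_eqI) simp_all

lemma triangle':
  assumes "wf1 s" "wf1 t" "src s = tgt t"
  shows "(Id s \<star> LU t) \<bullet> AS s (Unit1 (tgt t)) t = RU s \<star> Id t"
  using assms triangle[of "src t" "tgt t" "tgt s" "val t" "val s"]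
  by (intro cell2_eqI) simp_all

lemma vc_cancel_right:
  assumes "f \<bullet> k = h \<bullet> k" "k \<bullet> k' = Id t" "ok f" "ok h" "Dom f = t" "Dom h = t"
  shows "f = h"
proof -
  have "f \<bullet> (k \<bullet> k') = h \<bullet> (k \<bullet> k')"
    using assms(1) by (simp flip: vc_assoc)
  then show ?thesis using assms by simp
qed

lemma whisker_vc:
  "wf1 t \<Longrightarrow> Id t \<star> (g \<bullet> f) = (Id t \<star> g) \<bullet> (Id t \<star> f)"
  "wf1 t \<Longrightarrow> (g \<bullet> f) \<star> Id t = (g \<star> Id t) \<bullet> (f \<star> Id t)"
  by (simp_all flip: interchange2)

lemma hc_split:
  "ok g \<Longrightarrow> ok f \<Longrightarrow> g \<star> f = (g \<star> Id (Cod f)) \<bullet> (Id (Dom g) \<star> f)"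
  "ok g \<Longrightarrow> ok f \<Longrightarrow> g \<star> f = (Id (Cod g) \<star> f) \<bullet> (g \<star> Id (Dom f))"
  by (simp_all flip: interchange2)

text \<open>
  Naturality of the unitors recovers a 2-morphism from its whiskering by a unit 1-morphism.
\<close>

lemma unit_whisker_cancel:
  assumes "ok f" "ok g" "Dom f = Dom g" "Cod f = Cod g"
    and "Id (Unit1 (tgt (Dom f))) \<star> f = Id (Unit1 (tgt (Dom f))) \<star> g"
  shows "f = g"
proof (rule vc_cancel_right)
  show "f \<bullet> LU (Dom f) = g \<bullet> LU (Dom f)"
    using LU_natural[of f] LU_natural[of g] assms by simp
  show "LU (Dom f) \<bullet> LI (Dom f) = Id (Dom f)"
    using assms by simp
qed (use assms in auto)

lemma unit_whisker_cancel_right: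
  assumes "ok f" "ok g" "Dom f = Dom g" "Cod f = Cod g"
    and "f \<star> Id (Unit1 (src (Dom f))) = g \<star> Id (Unit1 (src (Dom f)))"
  shows "f = g"
proof (rule vc_cancel_right)
  show "f \<bullet> RU (Dom f) = g \<bullet> RU (Dom f)"
    using RU_natural[of f] RU_natural[of g] assms by simp
  show "RU (Dom f) \<bullet> RI (Dom f) = Id (Dom f)"
    using assms by simp
qed (use assms in auto)

text \<open>
  Kelly's coherence law for the left unitor of a composite. After whiskering by a unit 1-morphism both sides
  can be compared by the pentagon for two adjacent units and the triangle.
\<close>

lemma LU_Prod1:
  assumes "wf1 s" "wf1 t" "src s = tgt t"
  shows "LU (Prod1 s t) \<bullet> AS (Unit1 (tgt s)) s t = LU s \<star> Id t"
proof -
  let ?i = "Unit1 (tgt s)"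
  let ?K = "AS ?i (Prod1 ?i s) t \<bullet> (AS ?i ?i s \<star> Id t)"
  let ?K' = "(AI ?i ?i s \<star> Id t) \<bullet> AI ?i (Prod1 ?i s) t"
  have K: "?K \<bullet> ?K' = Id (Prod1 ?i (Prod1 (Prod1 ?i s) t))"
  proof -
    have "?K \<bullet> ?K' = AS ?i (Prod1 ?i s) t \<bullet> ((AS ?i ?i s \<star> Id t) \<bullet> (AI ?i ?i s \<star> Id t))
        \<bullet> AI ?i (Prod1 ?i s) t"
      by (simp add: vc_assoc)
    then show ?thesis
      using assms by (simp flip: interchange2) (simp add: Id_hc_Id)
  qed
  have "(Id ?i \<star> (LU (Prod1 s t) \<bullet> AS ?i s t)) \<bullet> ?K
      = (Id ?i \<star> LU (Prod1 s t)) \<bullet> ((Id ?i \<star> AS ?i s t) \<bullet> ?K)"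
    using assms by (simp add: whisker_vc vc_assoc)
  also have "\<dots> = ((Id ?i \<star> LU (Prod1 s t)) \<bullet> AS ?i ?i (Prod1 s t)) \<bullet> AS (Prod1 ?i ?i) s t"
    using assms by (simp add: pentagon' vc_assoc)
  also have "\<dots> = (RU ?i \<star> Id (Prod1 s t)) \<bullet> AS (Prod1 ?i ?i) s t"
    using triangle'[of ?i "Prod1 s t"] assms by simp
  also have "\<dots> = AS ?i s t \<bullet> ((RU ?i \<star> Id s) \<star> Id t)"
    using AS_natural[of "Id t" "Id s" "RU ?i"] assms by (simp add: Id_hc_Id)
  also have "\<dots> = AS ?i s t \<bullet> (((Id ?i \<star> LU s) \<bullet> AS ?i ?i s) \<star> Id t)"
    using triangle'[of ?i s] assms by simp
  also have "\<dots> = (AS ?i s t \<bullet> ((Id ?i \<star> LU s) \<star> Id t)) \<bullet> (AS ?i ?i s \<star> Id t)"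
    using assms by (simp add: whisker_vc vc_assoc)
  also have "\<dots> = (Id ?i \<star> (LU s \<star> Id t)) \<bullet> ?K"
    using AS_natural[of "Id t" "LU s" "Id ?i"] assms by (simp add: vc_assoc)
  finally have *: "Id ?i \<star> (LU (Prod1 s t) \<bullet> AS ?i s t) = Id ?i \<star> (LU s \<star> Id t)"
    by (rule vc_cancel_right[OF _ K]) (use assms in simp_all)
  show ?thesis
    by (rule unit_whisker_cancel) (use assms * in simp_all)
qed

section \<open>Strictification\<close>


text \<open>
  The action of the functor \<open>app t\<close> on 2-cells.
\<close>

primrec apf :: "('o, 'x) term1 \<Rightarrow> ('o, 'x, 'f) cell2 \<Rightarrow> ('o, 'x, 'f) cell2" where
  "apf (Unit1 a) f = f" |
  "apf (Gen1 a b X) f = Id (Gen1 a b X) \<star> f" |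
  "apf (Prod1 s t) f = apf s (apf t f)"

text \<open>
  The canonical coherence isomorphism from \<open>Prod1 t P\<close> to \<open>app t P\<close>.
\<close>

primrec join :: "('o, 'x) term1 \<Rightarrow> ('o, 'x) term1 \<Rightarrow> ('o, 'x, 'f) cell2" where
  "join (Unit1 a) P = LU P" |
  "join (Gen1 a b X) P = Id (Prod1 (Gen1 a b X) P)" |
  "join (Prod1 s t) P = join s (app t P) \<bullet> (Id s \<star> join t P) \<bullet> AS s t P"

primrec unjoin :: "('o, 'x) term1 \<Rightarrow> ('o, 'x) term1 \<Rightarrow> ('o, 'x, 'f) cell2" where
  "unjoin (Unit1 a) P = LI P" |
  "unjoin (Gen1 a b X) P = Id (Prod1 (Gen1 a b X) P)" |
  "unjoin (Prod1 s t) P = AI s t P \<bullet> (Id s \<star> unjoin t P) \<bullet> unjoin s (app t P)"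

lemma app_wf1:
  "wf1 t \<Longrightarrow> wf1 P \<Longrightarrow> src t = tgt P
    \<Longrightarrow> wf1 (app t P) \<and> src (app t P) = src P \<and> tgt (app t P) = tgt t"
  by (induction t arbitrary: P) auto

lemma wf1_app [simp]: "wf1 t \<Longrightarrow> wf1 P \<Longrightarrow> src t = tgt P \<Longrightarrow> wf1 (app t P)"
  and src_app [simp]: "wf1 t \<Longrightarrow> wf1 P \<Longrightarrow> src t = tgt P \<Longrightarrow> src (app t P) = src P"
  and tgt_app [simp]: "wf1 t \<Longrightarrow> wf1 P \<Longrightarrow> src t = tgt P \<Longrightarrow> tgt (app t P) = tgt t"
  using app_wf1 by blast+

lemma apf_ok:
  "wf1 t \<Longrightarrow> ok f \<Longrightarrow> src t = tgt (Dom f)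
    \<Longrightarrow> ok (apf t f) \<and> Dom (apf t f) = app t (Dom f) \<and> Cod (apf t f) = app t (Cod f)"
  by (induction t arbitrary: f) auto

lemma ok_apf [simp]: "wf1 t \<Longrightarrow> ok f \<Longrightarrow> src t = tgt (Dom f) \<Longrightarrow> ok (apf t f)"
  and Dom_apf [simp]: "wf1 t \<Longrightarrow> ok f \<Longrightarrow> src t = tgt (Dom f) \<Longrightarrow> Dom (apf t f) = app t (Dom f)"
  and Cod_apf [simp]: "wf1 t \<Longrightarrow> ok f \<Longrightarrow> src t = tgt (Dom f) \<Longrightarrow> Cod (apf t f) = app t (Cod f)"
  using apf_ok by blast+

lemma join_ok:
  "wf1 t \<Longrightarrow> wf1 P \<Longrightarrow> src t = tgt P
    \<Longrightarrow> ok (join t P) \<and> Dom (join t P) = Prod1 t P \<and> Cod (join t P) = app t P"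
  by (induction t arbitrary: P) auto

lemma unjoin_ok:
  "wf1 t \<Longrightarrow> wf1 P \<Longrightarrow> src t = tgt P
    \<Longrightarrow> ok (unjoin t P) \<and> Dom (unjoin t P) = app t P \<and> Cod (unjoin t P) = Prod1 t P"
  by (induction t arbitrary: P) auto

lemma ok_join [simp]: "wf1 t \<Longrightarrow> wf1 P \<Longrightarrow> src t = tgt P \<Longrightarrow> ok (join t P)"
  and Dom_join [simp]: "wf1 t \<Longrightarrow> wf1 P \<Longrightarrow> src t = tgt P \<Longrightarrow> Dom (join t P) = Prod1 t P"
  and Cod_join [simp]: "wf1 t \<Longrightarrow> wf1 P \<Longrightarrow> src t = tgt P \<Longrightarrow> Cod (join t P) = app t P"
  and ok_unjoin [simp]: "wf1 t \<Longrightarrow> wf1 P \<Longrightarrow> src t = tgt P \<Longrightarrow> ok (unjoin t P)"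
  and Dom_unjoin [simp]: "wf1 t \<Longrightarrow> wf1 P \<Longrightarrow> src t = tgt P \<Longrightarrow> Dom (unjoin t P) = app t P"
  and Cod_unjoin [simp]: "wf1 t \<Longrightarrow> wf1 P \<Longrightarrow> src t = tgt P \<Longrightarrow> Cod (unjoin t P) = Prod1 t P"
  using join_ok unjoin_ok by blast+

text \<open>
  An equation between composites of two cells, in the form in which it rewrites inside a longer right-nested
  composite.
\<close>

lemma vc_left_cong: "g \<bullet> f = k \<Longrightarrow> g \<bullet> (f \<bullet> h) = k \<bullet> h"
  by (metis vc_assoc)

lemma join_unjoin [simp]:
  assumes "wf1 t" "wf1 P" "src t = tgt P"
  shows "join t P \<bullet> unjoin t P = Id (app t P)" "unjoin t P \<bullet> join t P = Id (Prod1 t P)"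
proof -
  have "join t P \<bullet> unjoin t P = Id (app t P) \<and> unjoin t P \<bullet> join t P = Id (Prod1 t P)"
    using assms
  proof (induction t arbitrary: P)
    case (Prod1 s t)
    have strict: "wf1 s" "wf1 t" "src s = tgt t" "src t = tgt P" "wf1 P"
      using Prod1.prems by auto
    have t: "(Id s \<star> join t P) \<bullet> (Id s \<star> unjoin t P) = Id (Prod1 s (app t P))"
      "(Id s \<star> unjoin t P) \<bullet> (Id s \<star> join t P) = Id (Prod1 s (Prod1 t P))"
      using Prod1.IH(2)[of P] strict by (simp_all flip: whisker_vc) (simp_all add: Id_hc_Id)
    have s: "join s (app t P) \<bullet> unjoin s (app t P) = Id (app s (app t P))"
      "unjoin s (app t P) \<bullet> join s (app t P) = Id (Prod1 s (app t P))"
      using Prod1.IH(1)[of "app t P"] strict by simp_all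
    show ?case
      using strict
      by (simp add: vc_assoc vc_left_cong[OF t(1)] vc_left_cong[OF t(2)]
          vc_left_cong[OF s(1)] vc_left_cong[OF s(2)] vc_left_cong[OF AS_AI(1)]
          vc_left_cong[OF AS_AI(2)] s)
  qed (auto simp: Id_hc_Id)
  then show "join t P \<bullet> unjoin t P = Id (app t P)" "unjoin t P \<bullet> join t P = Id (Prod1 t P)"
    by auto
qed

lemma join_natural:
  assumes "wf1 t" "ok f" "src t = tgt (Dom f)"
  shows "join t (Cod f) \<bullet> (Id t \<star> f) = apf t f \<bullet> join t (Dom f)"
  using assms
proof (induction t arbitrary: f)
  case (Unit1 a)
  then show ?case using LU_natural[of f] by simp
next
  case (Gen1 a b X)
  then show ?case by simp
next
  case (Prod1 s t)
  have strict: "wf1 s" "wf1 t" "src s = tgt t" "src t = tgt (Dom f)" "ok f"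
    using Prod1.prems by auto
  have "join (Prod1 s t) (Cod f) \<bullet> (Id (Prod1 s t) \<star> f)
      = join s (app t (Cod f)) \<bullet> (Id s \<star> join t (Cod f)) \<bullet> (AS s t (Cod f) \<bullet> ((Id s \<star> Id t) \<star> f))"
    using strict by (simp add: vc_assoc Id_hc_Id)
  also have "\<dots> = join s (app t (Cod f)) \<bullet> ((Id s \<star> join t (Cod f)) \<bullet> (Id s \<star> (Id t \<star> f)))
      \<bullet> AS s t (Dom f)"
    using strict AS_natural[of f "Id t" "Id s"] by (simp add: vc_assoc)
  also have "\<dots> = (join s (app t (Cod f)) \<bullet> (Id s \<star> apf t f)) \<bullet> (Id s \<star> join t (Dom f)) \<bullet> AS s t (Dom f)"
    using strict Prod1.IH(2)[of f] by (simp flip: whisker_vc) (simp add: whisker_vc vc_assoc)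
  also have "\<dots> = apf (Prod1 s t) f \<bullet> join (Prod1 s t) (Dom f)"
    using strict Prod1.IH(1)[of "apf t f"] by (simp add: vc_assoc)
  finally show ?case .
qed

lemma unjoin_natural:
  assumes "wf1 t" "ok f" "src t = tgt (Dom f)"
  shows "(Id t \<star> f) \<bullet> unjoin t (Dom f) = unjoin t (Cod f) \<bullet> apf t f"
proof -
  have "(Id t \<star> f) \<bullet> unjoin t (Dom f)
      = unjoin t (Cod f) \<bullet> (join t (Cod f) \<bullet> (Id t \<star> f)) \<bullet> unjoin t (Dom f)"
    using assms by (simp flip: vc_assoc)
  then show ?thesis
    using assms by (simp add: join_natural vc_assoc)
qed

text \<open>
  The component at \<open>P\<close> of the natural transformation given by \<open>\<phi>\<close>, between right-bracketed 1-morphisms.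
\<close>

definition strict :: "('o, 'x, 'f) cell2 \<Rightarrow> ('o, 'x) term1 \<Rightarrow> ('o, 'x, 'f) cell2" where
  "strict \<phi> P = join (Cod \<phi>) P \<bullet> (\<phi> \<star> Id P) \<bullet> unjoin (Dom \<phi>) P"

lemma ok_strict [simp]: "ok \<phi> \<Longrightarrow> wf1 P \<Longrightarrow> src (Dom \<phi>) = tgt P \<Longrightarrow> ok (strict \<phi> P)"
  and Dom_strict [simp]: "ok \<phi> \<Longrightarrow> wf1 P \<Longrightarrow> src (Dom \<phi>) = tgt P \<Longrightarrow> Dom (strict \<phi> P) = app (Dom \<phi>) P"
  and Cod_strict [simp]: "ok \<phi> \<Longrightarrow> wf1 P \<Longrightarrow> src (Dom \<phi>) = tgt P \<Longrightarrow> Cod (strict \<phi> P) = app (Cod \<phi>) P"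
  by (simp_all add: strict_def)

lemma strict_vc:
  assumes "ok g" "ok f" "Cod f = Dom g" "wf1 P" "src (Dom f) = tgt P"
  shows "strict (g \<bullet> f) P = strict g P \<bullet> strict f P"
proof -
  have "src (Dom g) = tgt P" using assms by (metis src_Cod)
  with assms show ?thesis
    by (simp add: strict_def vc_assoc whisker_vc vc_left_cong[OF join_unjoin(2)])
qed

lemma strict_Id: "wf1 t \<Longrightarrow> wf1 P \<Longrightarrow> src t = tgt P \<Longrightarrow> strict (Id t) P = Id (app t P)"
  by (simp add: strict_def Id_hc_Id)

lemma strict_natural:
  assumes "ok \<phi>" "ok f" "src (Dom \<phi>) = tgt (Dom f)"
  shows "strict \<phi> (Cod f) \<bullet> apf (Dom \<phi>) f = apf (Cod \<phi>) f \<bullet> strict \<phi> (Dom f)"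
proof -
  have "strict \<phi> (Cod f) \<bullet> apf (Dom \<phi>) f
      = join (Cod \<phi>) (Cod f) \<bullet> ((\<phi> \<star> Id (Cod f)) \<bullet> (Id (Dom \<phi>) \<star> f)) \<bullet> unjoin (Dom \<phi>) (Dom f)"
    using assms by (simp add: strict_def vc_assoc unjoin_natural)
  also have "\<dots> = join (Cod \<phi>) (Cod f) \<bullet> ((Id (Cod \<phi>) \<star> f) \<bullet> (\<phi> \<star> Id (Dom f))) \<bullet> unjoin (Dom \<phi>) (Dom f)"
    using assms hc_split[of \<phi> f] by simp
  also have "\<dots> = (join (Cod \<phi>) (Cod f) \<bullet> (Id (Cod \<phi>) \<star> f)) \<bullet> (\<phi> \<star> Id (Dom f)) \<bullet> unjoin (Dom \<phi>) (Dom f)"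
    by (simp add: vc_assoc)
  also have "\<dots> = apf (Cod \<phi>) f \<bullet> strict \<phi> (Dom f)"
    using assms by (simp add: join_natural) (simp add: strict_def vc_assoc)
  finally show ?thesis .
qed

text \<open>
  Horizontal composition becomes composition of natural transformations: apply the outer functor to the
  component of \<open>f\<close>, then take a component of \<open>g\<close>.
\<close>

lemma strict_hc:
  assumes "ok g" "ok f" "src (Dom g) = tgt (Dom f)" "wf1 P" "src (Dom f) = tgt P"
  shows "strict (g \<star> f) P = strict g (app (Cod f) P) \<bullet> apf (Dom g) (strict f P)"
proof -
  let ?jg = "join (Cod g) (app (Cod f) P)" and ?ug = "unjoin (Dom g) (app (Dom f) P)"
  let ?jf = "join (Cod f) P" and ?uf = "unjoin (Dom f) P"
  have "strict (g \<star> f) P = ?jg \<bullet> (Id (Cod g) \<star> ?jf) \<bullet> (AS (Cod g) (Cod f) P \<bullet> ((g \<star> f) \<star> Id P))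
      \<bullet> AI (Dom g) (Dom f) P \<bullet> (Id (Dom g) \<star> ?uf) \<bullet> ?ug"
    using assms by (simp add: strict_def vc_assoc)
  also have "\<dots> = ?jg \<bullet> (Id (Cod g) \<star> ?jf) \<bullet> (g \<star> (f \<star> Id P)) \<bullet> (Id (Dom g) \<star> ?uf) \<bullet> ?ug"
    using assms AS_natural[of "Id P" f g] by (simp add: vc_assoc vc_left_cong[OF AS_AI(1)])
  also have "\<dots> = ?jg \<bullet> ((Id (Cod g) \<star> ?jf) \<bullet> (g \<star> (f \<star> Id P)) \<bullet> (Id (Dom g) \<star> ?uf)) \<bullet> ?ug"
    by (simp add: vc_assoc)
  also have "(Id (Cod g) \<star> ?jf) \<bullet> (g \<star> (f \<star> Id P)) \<bullet> (Id (Dom g) \<star> ?uf) = g \<star> strict f P"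
    using assms by (simp add: strict_def flip: interchange2)
  also have "?jg \<bullet> (g \<star> strict f P) \<bullet> ?ug
      = ?jg \<bullet> (g \<star> Id (app (Cod f) P)) \<bullet> ((Id (Dom g) \<star> strict f P) \<bullet> ?ug)"
    using assms hc_split(1)[of g "strict f P"] by (simp add: vc_assoc)
  also have "\<dots> = strict g (app (Cod f) P) \<bullet> apf (Dom g) (strict f P)"
    using assms unjoin_natural[of "Dom g" "strict f P"] by (simp add: strict_def vc_assoc)
  finally show ?thesis .
qed

text \<open>
  The criterion by which each coherence isomorphism is recognised: it strictifies to an identity if it relates the
  rebracketings \<open>join\<close> of its source and target.
\<close>

lemma strict_eq_Id:
  assumes "ok \<phi>" "wf1 P" "src (Dom \<phi>) = tgt P"
    and "join (Cod \<phi>) P \<bullet> (\<phi> \<star> Id P) = join (Dom \<phi>) P"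
  shows "strict \<phi> P = Id (app (Dom \<phi>) P)"
  using assms by (simp add: strict_def flip: vc_assoc)

lemma strict_inverse_eq_Id:
  assumes "strict g P = Id Q" "g \<bullet> f = Id t" "wf1 P" "src t = tgt P"
    and "ok f" "ok g" "Cod f = Dom g" "app (Dom f) P = app (Cod f) P"
  shows "strict f P = Id (app (Dom f) P)"
proof -
  have Dt: "Dom f = t" "wf1 t"
    using assms(2,5-7) Dom_vc[of g f] ok_vc[of g f] by auto
  then have "Q = app (Dom g) P"
    using assms Dom_strict[of g P] ok_strict[of g P] by (metis Dom_Id ok_Id src_Cod)
  then show ?thesis
    using assms strict_vc[of g f P] Dt by (simp add: strict_Id)
qed

text \<open>
  This is the pentagon, combined with naturality of the associator along \<open>join u P\<close>.
\<close>

lemma strict_AS: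
  assumes "wf1 s" "wf1 t" "wf1 u" "wf1 P" "src s = tgt t" "src t = tgt u" "src u = tgt P"
  shows "strict (AS s t u) P = Id (app s (app t (app u P)))"
proof -
  let ?js = "join s (app t (app u P))" and ?jt = "join t (app u P)"
  have "join (Prod1 (Prod1 s t) u) P
      = ?js \<bullet> (Id s \<star> ?jt) \<bullet> (AS s t (app u P) \<bullet> ((Id s \<star> Id t) \<star> join u P)) \<bullet> AS (Prod1 s t) u P"
    using assms by (simp add: vc_assoc Id_hc_Id)
  also have "\<dots> = ?js \<bullet> (Id s \<star> ?jt) \<bullet> (Id s \<star> (Id t \<star> join u P)) \<bullet> AS s t (Prod1 u P) \<bullet> AS (Prod1 s t) u P"
    using assms AS_natural[of "join u P" "Id t" "Id s"] by (simp add: vc_assoc)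
  also have "\<dots> = ?js \<bullet> (Id s \<star> ?jt) \<bullet> (Id s \<star> (Id t \<star> join u P)) \<bullet>
      (Id s \<star> AS t u P) \<bullet> AS s (Prod1 t u) P \<bullet> (AS s t u \<star> Id P)"
    using assms by (simp add: pentagon')
  also have "\<dots> = join (Prod1 s (Prod1 t u)) P \<bullet> (AS s t u \<star> Id P)"
    using assms by (simp add: whisker_vc vc_assoc)
  finally show ?thesis
    using assms strict_eq_Id[of "AS s t u" P] by simp
qed

lemma strict_AI:
  assumes "wf1 s" "wf1 t" "wf1 u" "wf1 P" "src s = tgt t" "src t = tgt u" "src u = tgt P"
  shows "strict (AI s t u) P = Id (app s (app t (app u P)))"
  using strict_inverse_eq_Id[OF strict_AS[OF assms], of "AI s t u" "Prod1 s (Prod1 t u)"] assms by simp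

lemma strict_LU:
  assumes "wf1 t" "wf1 P" "src t = tgt P"
  shows "strict (LU t) P = Id (app t P)"
proof -
  have "join (Prod1 (Unit1 (tgt t)) t) P = LU (app t P) \<bullet> (Id (Unit1 (tgt t)) \<star> join t P)
      \<bullet> AS (Unit1 (tgt t)) t P"
    by simp
  also have "\<dots> = join t P \<bullet> (LU (Prod1 t P) \<bullet> AS (Unit1 (tgt t)) t P)"
    using assms LU_natural[of "join t P"] by (simp flip: vc_assoc)
  also have "\<dots> = join t P \<bullet> (LU t \<star> Id P)"
    using assms by (simp add: LU_Prod1)
  finally show ?thesis
    using assms strict_eq_Id[of "LU t" P] by simp
qed

lemma strict_RU:
  assumes "wf1 t" "wf1 P" "src t = tgt P"
  shows "strict (RU t) P = Id (app t P)"
  using assms strict_eq_Id[of "RU t" P] triangle'[of t P] by simp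

lemma strict_LI:
  assumes "wf1 t" "wf1 P" "src t = tgt P"
  shows "strict (LI t) P = Id (app t P)"
  using strict_inverse_eq_Id[OF strict_LU[OF assms], of "LI t" t] assms by simp

lemma strict_RI:
  assumes "wf1 t" "wf1 P" "src t = tgt P"
  shows "strict (RI t) P = Id (app t P)"
  using strict_inverse_eq_Id[OF strict_RU[OF assms], of "RI t" t] assms by simp

text \<open>
  At a unit 1-morphism the component of \<open>\<phi>\<close> is \<open>\<phi> \<otimes> 1\<close> up to isomorphism, and whiskering by a unit is faithful.
\<close>

lemma strict_faithful:
  assumes "ok \<phi>" "ok \<psi>" "Dom \<phi> = Dom \<psi>" "Cod \<phi> = Cod \<psi>"
    and "strict \<phi> (Unit1 (src (Dom \<phi>))) = strict \<psi> (Unit1 (src (Dom \<phi>)))"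
  shows "\<phi> = \<psi>"
proof -
  let ?i = "Unit1 (src (Dom \<phi>))"
  have "\<chi> \<star> Id ?i = unjoin (Cod \<phi>) ?i \<bullet> strict \<chi> ?i \<bullet> join (Dom \<phi>) ?i"
    if "ok \<chi>" "Dom \<chi> = Dom \<phi>" "Cod \<chi> = Cod \<phi>" for \<chi>
  proof -
    have "unjoin (Cod \<phi>) ?i \<bullet> strict \<chi> ?i \<bullet> join (Dom \<phi>) ?i
      = (unjoin (Cod \<phi>) ?i \<bullet> join (Cod \<phi>) ?i) \<bullet> (\<chi> \<star> Id ?i) \<bullet> (unjoin (Dom \<phi>) ?i \<bullet> join (Dom \<phi>) ?i)"
      using that by (simp add: strict_def vc_assoc)
    then show ?thesis
      using that assms(1) by simp
  qed
  then have *: "\<phi> \<star> Id ?i = \<psi> \<star> Id ?i"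
    using assms by simp
  show ?thesis
    by (rule unit_whisker_cancel_right) (use assms * in simp_all)
qed

lemma apf_Id: "wf1 t \<Longrightarrow> wf1 P \<Longrightarrow> src t = tgt P \<Longrightarrow> apf t (Id P) = Id (app t P)"
  by (induction t arbitrary: P) (auto simp: Id_hc_Id)

section \<open>Cancelling a loop of an algebra acting inside a trace\<close>


abbreviation whisker :: "('o, 'x) term1 \<Rightarrow> ('o, 'x, 'f) cell2 \<Rightarrow> ('o, 'x, 'f) cell2" (infixr "\<rhd>" 66)
  where "x \<rhd> f \<equiv> Id x \<star> f"

text \<open>
  Generators are handled through the predicate so that they stay opaque in the computations below, where only the
  rules in \<open>generatorD\<close> are needed.
\<close>

definition generator :: "('o, 'x) term1 \<Rightarrow> 'o \<Rightarrow> 'o \<Rightarrow> bool" where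
  "generator x a b \<longleftrightarrow> wf1 x \<and> (\<exists>X. x = Gen1 a b X)"

lemma generatorD:
  assumes "generator x a b"
  shows "wf1 x" "src x = a" "tgt x = b" "app x P = Prod1 x P" "apf x f = x \<rhd> f"
  using assms by (auto simp: generator_def)

definition has_type :: "('o, 'x, 'f) cell2 \<Rightarrow> ('o, 'x) term1 \<Rightarrow> ('o, 'x) term1 \<Rightarrow> bool" where
  "has_type \<phi> s t \<longleftrightarrow> ok \<phi> \<and> Dom \<phi> = s \<and> Cod \<phi> = t"

lemma has_typeD:
  assumes "has_type \<phi> s t"
  shows "ok \<phi>" "Dom \<phi> = s" "Cod \<phi> = t"
  using assms by (auto simp: has_type_def)

end

text \<open>
  The strict data for sliding the line of an algebra \<open>m\<close> around a loop of a left module \<open>x\<close> from \<open>a\<close> to \<open>b\<close>.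
  The duals are \<open>x'\<close> and \<open>m'\<close>; the letters \<open>t\<close> in \<open>te\<close>, \<open>tc\<close> and \<open>tcm\<close> mark evaluations and coevaluations with a
  tilde. The cell \<open>ga\<close> is the copairing \<open>\<Delta> \<circ> \<eta>\<close> and \<open>ka\<close> the pairing \<open>\<epsilon> \<circ> \<mu>\<close>. The assumption \<open>pivotal\<close> says that the
  dual of the action \<open>la\<close>, a map from \<open>x'\<close> to \<open>x' m'\<close>, does not depend on the choice of the adjunctions by which it
  is formed.
\<close>

locale module_diagram = bicategory \<B> for \<B> :: "('o, 'x, 'f, 'z) bicategory_data_scheme" (structure) +
  fixes a b :: 'o and x x' m m' :: "('o, 'x) term1"
    and ev co te tc evm com tcm la mu et ga ka :: "('o, 'x, 'f) cell2"
  assumes gen_x: "generator x a b" and gen_x': "generator x' b a"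
    and gen_m: "generator m b b" and gen_m': "generator m' b b"
    and ev: "has_type ev (Prod1 x' x) (Unit1 a)" and co: "has_type co (Unit1 b) (Prod1 x x')"
    and te: "has_type te (Prod1 x x') (Unit1 b)" and tc: "has_type tc (Unit1 a) (Prod1 x' x)"
    and evm: "has_type evm (Prod1 m' m) (Unit1 b)" and com: "has_type com (Unit1 b) (Prod1 m m')"
    and tcm: "has_type tcm (Unit1 b) (Prod1 m' m)"
    and la: "has_type la (Prod1 m x) x" and mu: "has_type mu (Prod1 m m) m"
    and et: "has_type et (Unit1 b) m" and ga: "has_type ga (Unit1 b) (Prod1 m m)"
    and ka: "has_type ka (Prod1 m m) (Unit1 b)"
    and zigzag_x: "\<lbrakk>wf1 P; tgt P = a\<rbrakk> \<Longrightarrow> (x \<rhd> strict ev P) \<bullet> strict co (Prod1 x P) = Id (Prod1 x P)"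
    and zigzag_x': "\<lbrakk>wf1 P; tgt P = b\<rbrakk> \<Longrightarrow> strict ev (Prod1 x' P) \<bullet> (x' \<rhd> strict co P) = Id (Prod1 x' P)"
    and tzigzag_x: "\<lbrakk>wf1 P; tgt P = a\<rbrakk> \<Longrightarrow> strict te (Prod1 x P) \<bullet> (x \<rhd> strict tc P) = Id (Prod1 x P)"
    and zigzag_m: "\<lbrakk>wf1 P; tgt P = b\<rbrakk> \<Longrightarrow> (m \<rhd> strict evm P) \<bullet> strict com (Prod1 m P) = Id (Prod1 m P)"
    and act_assoc: "\<lbrakk>wf1 P; tgt P = a\<rbrakk> \<Longrightarrow> strict la P \<bullet> (m \<rhd> strict la P) = strict la P \<bullet> strict mu (Prod1 x P)"
    and act_unit: "\<lbrakk>wf1 P; tgt P = a\<rbrakk> \<Longrightarrow> strict la P \<bullet> strict et (Prod1 x P) = Id (Prod1 x P)"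
    and separable: "\<lbrakk>wf1 P; tgt P = b\<rbrakk> \<Longrightarrow> strict mu P \<bullet> strict ga P = strict et P"
    and zigzag_form: "\<lbrakk>wf1 P; tgt P = b\<rbrakk> \<Longrightarrow> strict ka (Prod1 m P) \<bullet> (m \<rhd> strict ga P) = Id (Prod1 m P)"
    and symmetric: "\<lbrakk>wf1 P; tgt P = b\<rbrakk> \<Longrightarrow>
      strict ka (Prod1 m' P) \<bullet> (m \<rhd> strict com P) = (m' \<rhd> strict ka P) \<bullet> strict tcm (Prod1 m P)"
    and pivotal: "\<lbrakk>wf1 P; tgt P = b\<rbrakk> \<Longrightarrow>
      (x' \<rhd> m' \<rhd> strict te P) \<bullet> (x' \<rhd> m' \<rhd> strict la (Prod1 x' P))
        \<bullet> (x' \<rhd> strict tcm (Prod1 x (Prod1 x' P))) \<bullet> strict tc (Prod1 x' P)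
      = strict ev (Prod1 x' (Prod1 m' P)) \<bullet> (x' \<rhd> strict la (Prod1 x' (Prod1 m' P)))
        \<bullet> (x' \<rhd> m \<rhd> strict co (Prod1 m' P)) \<bullet> (x' \<rhd> strict com P)"
begin

lemmas gens [simp] = generatorD[OF gen_x] generatorD[OF gen_x'] generatorD[OF gen_m] generatorD[OF gen_m']

lemmas types [simp] = has_typeD[OF ev] has_typeD[OF co] has_typeD[OF te] has_typeD[OF tc]
  has_typeD[OF evm] has_typeD[OF com] has_typeD[OF tcm] has_typeD[OF la] has_typeD[OF mu]
  has_typeD[OF et] has_typeD[OF ga] has_typeD[OF ka]

abbreviation "good P c \<equiv> wf1 P \<and> tgt P = c"

lemma natural:
  assumes "ok f"
  shows "tgt (Dom f) = a \<Longrightarrow> strict ev (Cod f) \<bullet> (x' \<rhd> x \<rhd> f) = f \<bullet> strict ev (Dom f)"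
    "tgt (Dom f) = b \<Longrightarrow> strict co (Cod f) \<bullet> f = (x \<rhd> x' \<rhd> f) \<bullet> strict co (Dom f)"
    "tgt (Dom f) = b \<Longrightarrow> strict te (Cod f) \<bullet> (x \<rhd> x' \<rhd> f) = f \<bullet> strict te (Dom f)"
    "tgt (Dom f) = a \<Longrightarrow> strict tc (Cod f) \<bullet> f = (x' \<rhd> x \<rhd> f) \<bullet> strict tc (Dom f)"
    "tgt (Dom f) = b \<Longrightarrow> strict evm (Cod f) \<bullet> (m' \<rhd> m \<rhd> f) = f \<bullet> strict evm (Dom f)"
    "tgt (Dom f) = b \<Longrightarrow> strict com (Cod f) \<bullet> f = (m \<rhd> m' \<rhd> f) \<bullet> strict com (Dom f)"
    "tgt (Dom f) = b \<Longrightarrow> strict tcm (Cod f) \<bullet> f = (m' \<rhd> m \<rhd> f) \<bullet> strict tcm (Dom f)"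
    "tgt (Dom f) = a \<Longrightarrow> strict la (Cod f) \<bullet> (m \<rhd> x \<rhd> f) = (x \<rhd> f) \<bullet> strict la (Dom f)"
    "tgt (Dom f) = b \<Longrightarrow> strict mu (Cod f) \<bullet> (m \<rhd> m \<rhd> f) = (m \<rhd> f) \<bullet> strict mu (Dom f)"
    "tgt (Dom f) = b \<Longrightarrow> strict et (Cod f) \<bullet> f = (m \<rhd> f) \<bullet> strict et (Dom f)"
    "tgt (Dom f) = b \<Longrightarrow> strict ga (Cod f) \<bullet> f = (m \<rhd> m \<rhd> f) \<bullet> strict ga (Dom f)"
    "tgt (Dom f) = b \<Longrightarrow> strict ka (Cod f) \<bullet> (m \<rhd> m \<rhd> f) = f \<bullet> strict ka (Dom f)"
  using assms strict_natural[of ev f] strict_natural[of co f] strict_natural[of te f] strict_natural[of tc f]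
    strict_natural[of evm f] strict_natural[of com f] strict_natural[of tcm f] strict_natural[of la f]
    strict_natural[of mu f] strict_natural[of et f] strict_natural[of ga f] strict_natural[of ka f]
  by simp_all

definition coact :: "('o, 'x) term1 \<Rightarrow> ('o, 'x, 'f) cell2" where
  "coact P = (m \<rhd> strict la P) \<bullet> strict ga (Prod1 x P)"

text \<open>
  The right action of \<open>m\<close> on \<open>x'\<close> that is the mate of \<open>la\<close> under the adjunction without a tilde.
\<close>

definition dact :: "('o, 'x) term1 \<Rightarrow> ('o, 'x, 'f) cell2" where
  "dact P = strict ev (Prod1 x' P) \<bullet> (x' \<rhd> strict la (Prod1 x' P)) \<bullet> (x' \<rhd> m \<rhd> strict co P)"

text \<open>
  The right coaction of \<open>m\<close> on \<open>x'\<close> that is the mate of \<open>coact\<close> under the adjunction with a tilde. That it is formed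
  with the other adjunction than \<open>dact\<close> is forced by the two ends of the loop, and is what makes
  \<open>dcoact_eq\<close> a statement about pivotality.
\<close>

definition dcoact :: "('o, 'x) term1 \<Rightarrow> ('o, 'x, 'f) cell2" where
  "dcoact P = (x' \<rhd> m \<rhd> strict te P) \<bullet> (x' \<rhd> coact (Prod1 x' P)) \<bullet> strict tc (Prod1 x' P)"

text \<open>
  The inverse of the isomorphism from \<open>m\<close> to its dual given by the pairing; see \<open>flip_dual_inverse\<close>.
\<close>

definition flip_dual :: "('o, 'x) term1 \<Rightarrow> ('o, 'x, 'f) cell2" where
  "flip_dual P = strict evm (Prod1 m P) \<bullet> (m' \<rhd> strict ga P)"

lemma type_composites [simp]:
  "good P a \<Longrightarrow> ok (coact P)" "good P a \<Longrightarrow> Dom (coact P) = Prod1 x P"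
  "good P a \<Longrightarrow> Cod (coact P) = Prod1 m (Prod1 x P)"
  "good P b \<Longrightarrow> ok (dact P)" "good P b \<Longrightarrow> Dom (dact P) = Prod1 x' (Prod1 m P)"
  "good P b \<Longrightarrow> Cod (dact P) = Prod1 x' P"
  "good P b \<Longrightarrow> ok (dcoact P)" "good P b \<Longrightarrow> Dom (dcoact P) = Prod1 x' P"
  "good P b \<Longrightarrow> Cod (dcoact P) = Prod1 x' (Prod1 m P)"
  "good P b \<Longrightarrow> ok (flip_dual P)" "good P b \<Longrightarrow> Dom (flip_dual P) = Prod1 m' P"
  "good P b \<Longrightarrow> Cod (flip_dual P) = Prod1 m P"
  by (simp_all add: coact_def dact_def dcoact_def flip_dual_def)

lemma coact_natural:
  assumes "ok f" "tgt (Dom f) = a"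
  shows "coact (Cod f) \<bullet> (x \<rhd> f) = (m \<rhd> x \<rhd> f) \<bullet> coact (Dom f)"
proof -
  have "coact (Cod f) \<bullet> (x \<rhd> f) = (m \<rhd> (strict la (Cod f) \<bullet> (m \<rhd> x \<rhd> f))) \<bullet> strict ga (Prod1 x (Dom f))"
    using assms natural(11)[of "x \<rhd> f"] by (simp add: coact_def vc_assoc whisker_vc)
  then show ?thesis
    using assms natural(8)[of f] by (simp add: coact_def vc_assoc whisker_vc)
qed

lemma dact_natural:
  assumes "ok f" "tgt (Dom f) = b"
  shows "dact (Cod f) \<bullet> (x' \<rhd> m \<rhd> f) = (x' \<rhd> f) \<bullet> dact (Dom f)"
proof -
  have "dact (Cod f) \<bullet> (x' \<rhd> m \<rhd> f) = strict ev (Prod1 x' (Cod f)) \<bullet>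
      (x' \<rhd> (strict la (Prod1 x' (Cod f)) \<bullet> (m \<rhd> (strict co (Cod f) \<bullet> f))))"
    using assms by (simp add: dact_def vc_assoc whisker_vc)
  also have "\<dots> = strict ev (Prod1 x' (Cod f)) \<bullet>
      (x' \<rhd> (strict la (Prod1 x' (Cod f)) \<bullet> (m \<rhd> x \<rhd> x' \<rhd> f) \<bullet> (m \<rhd> strict co (Dom f))))"
    using assms by (simp add: natural(2) whisker_vc)
  also have "\<dots> = (strict ev (Prod1 x' (Cod f)) \<bullet> (x' \<rhd> x \<rhd> x' \<rhd> f)) \<bullet>
      (x' \<rhd> strict la (Prod1 x' (Dom f))) \<bullet> (x' \<rhd> m \<rhd> strict co (Dom f))"
    using assms vc_left_cong[OF natural(8)[of "x' \<rhd> f"]] by (simp add: vc_assoc whisker_vc)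
  also have "\<dots> = (x' \<rhd> f) \<bullet> dact (Dom f)"
    using assms natural(1)[of "x' \<rhd> f"] by (simp add: dact_def vc_assoc)
  finally show ?thesis .
qed

lemma flip_dual_natural:
  assumes "ok f" "tgt (Dom f) = b"
  shows "flip_dual (Cod f) \<bullet> (m' \<rhd> f) = (m \<rhd> f) \<bullet> flip_dual (Dom f)"
proof -
  have "flip_dual (Cod f) \<bullet> (m' \<rhd> f) = (strict evm (Prod1 m (Cod f)) \<bullet> (m' \<rhd> m \<rhd> m \<rhd> f)) \<bullet> (m' \<rhd> strict ga (Dom f))"
    using assms natural(11)[of f] by (simp add: flip_dual_def vc_assoc flip: whisker_vc)
  then show ?thesis
    using assms vc_left_cong[OF natural(5)[of "m \<rhd> f"]] by (simp add: flip_dual_def vc_assoc)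
qed

text \<open>
  Sliding the action around the left end of the loop.
\<close>

lemma ev_dact:
  assumes "good P a"
  shows "strict ev P \<bullet> dact (Prod1 x P) = strict ev P \<bullet> (x' \<rhd> strict la P)"
proof -
  have "(x \<rhd> strict ev P) \<bullet> strict la (Prod1 x' (Prod1 x P)) \<bullet> (m \<rhd> strict co (Prod1 x P))
      = strict la P \<bullet> (m \<rhd> ((x \<rhd> strict ev P) \<bullet> strict co (Prod1 x P)))"
    using assms vc_left_cong[OF natural(8)[of "strict ev P", symmetric]] by (simp add: whisker_vc vc_assoc)
  also have "\<dots> = strict la P"
    using assms by (simp add: zigzag_x Id_hc_Id)
  finally have *: "(x \<rhd> strict ev P) \<bullet> strict la (Prod1 x' (Prod1 x P)) \<bullet> (m \<rhd> strict co (Prod1 x P)) = strict la P" .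
  have "strict ev P \<bullet> dact (Prod1 x P) = strict ev P \<bullet>
     (x' \<rhd> ((x \<rhd> strict ev P) \<bullet> strict la (Prod1 x' (Prod1 x P)) \<bullet> (m \<rhd> strict co (Prod1 x P))))"
    using assms vc_left_cong[OF natural(1)[of "strict ev P"]] by (simp add: dact_def whisker_vc vc_assoc)
  then show ?thesis
    by (simp only: *)
qed

text \<open>
  Sliding the coaction around the right end of the loop.
\<close>

lemma dcoact_tc:
  assumes "good P a"
  shows "dcoact (Prod1 x P) \<bullet> strict tc P = (x' \<rhd> coact P) \<bullet> strict tc P"
proof -
  have "dcoact (Prod1 x P) \<bullet> strict tc P = (x' \<rhd> ((m \<rhd> strict te (Prod1 x P)) \<bullet>
      (coact (Prod1 x' (Prod1 x P)) \<bullet> (x \<rhd> strict tc P)))) \<bullet> strict tc P"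
    using assms natural(4)[of "strict tc P"] by (simp add: dcoact_def whisker_vc vc_assoc)
  also have "\<dots> = (x' \<rhd> ((m \<rhd> (strict te (Prod1 x P) \<bullet> (x \<rhd> strict tc P))) \<bullet> coact P)) \<bullet> strict tc P"
    using assms coact_natural[of "strict tc P"] by (simp add: whisker_vc vc_assoc)
  finally show ?thesis
    using assms by (simp add: tzigzag_x Id_hc_Id)
qed

lemma flip_dual_com:
  assumes "good P b"
  shows "(m \<rhd> flip_dual P) \<bullet> strict com P = strict ga P"
proof -
  have "(m \<rhd> flip_dual P) \<bullet> strict com P = ((m \<rhd> strict evm (Prod1 m P)) \<bullet> strict com (Prod1 m (Prod1 m P))) \<bullet> strict ga P"
    using assms natural(6)[of "strict ga P"] by (simp add: flip_dual_def whisker_vc vc_assoc)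
  then show ?thesis
    using assms by (simp add: zigzag_m)
qed

lemma flip_dual_inverse:
  assumes "good P b"
  shows "flip_dual P \<bullet> strict ka (Prod1 m' P) \<bullet> (m \<rhd> strict com P) = Id (Prod1 m P)"
proof -
  have "flip_dual P \<bullet> strict ka (Prod1 m' P) \<bullet> (m \<rhd> strict com P)
      = strict ka (Prod1 m P) \<bullet> (m \<rhd> ((m \<rhd> flip_dual P) \<bullet> strict com P))"
    using assms vc_left_cong[OF natural(12)[of "flip_dual P", symmetric]] by (simp add: whisker_vc vc_assoc)
  then show ?thesis
    using assms by (simp add: flip_dual_com zigzag_form)
qed

text \<open>
  \<open>flip_dual\<close> is formed with the evaluation without a tilde, yet it also turns the coevaluation with a tilde into
  the copairing. This is the symmetry of the algebra: the isomorphism from \<open>m\<close> to \<open>m'\<close> built from \<open>tcm\<close> is the one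
  built from \<open>com\<close>, and \<open>flip_dual\<close> inverts the latter.
\<close>

lemma flip_dual_tcm:
  assumes "good P b"
  shows "flip_dual (Prod1 m P) \<bullet> strict tcm P = strict ga P"
proof -
  have "strict tcm P = (m' \<rhd> (strict ka (Prod1 m P) \<bullet> (m \<rhd> strict ga P))) \<bullet> strict tcm P"
    using assms by (simp add: zigzag_form Id_hc_Id)
  also have "\<dots> = ((m' \<rhd> strict ka (Prod1 m P)) \<bullet> strict tcm (Prod1 m (Prod1 m P))) \<bullet> strict ga P"
    using assms natural(7)[of "strict ga P"] by (simp add: whisker_vc vc_assoc)
  also have "\<dots> = strict ka (Prod1 m' (Prod1 m P)) \<bullet> (m \<rhd> strict com (Prod1 m P)) \<bullet> strict ga P"
    using assms vc_left_cong[OF symmetric[of "Prod1 m P"]] by (simp add: vc_assoc)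
  finally have *: "strict tcm P = strict ka (Prod1 m' (Prod1 m P)) \<bullet> (m \<rhd> strict com (Prod1 m P)) \<bullet> strict ga P" .
  have "flip_dual (Prod1 m P) \<bullet> strict tcm P
    = (flip_dual (Prod1 m P) \<bullet> strict ka (Prod1 m' (Prod1 m P)) \<bullet> (m \<rhd> strict com (Prod1 m P))) \<bullet> strict ga P"
    by (simp only: * vc_assoc)
  then show ?thesis
    using assms flip_dual_inverse[of "Prod1 m P"] by simp
qed

text \<open>
  The coaction on the dual is the one that the copairing induces from the action on the dual. Both sides are the
  dual of \<open>la\<close> followed by the identification of \<open>m'\<close> with \<open>m\<close>: with the adjunctions that carry a tilde this
  composite is \<open>dcoact\<close>, with the others it is the right-hand side.
\<close>

lemma dcoact_eq:
  assumes "good P b"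
  shows "dcoact P = dact (Prod1 m P) \<bullet> (x' \<rhd> strict ga P)"
proof -
  let ?P = "Prod1 x' P"
  \<comment> \<open>Identifying \<open>m'\<close> with \<open>m\<close> in the dual of the action turns the action into the coaction.\<close>
  have 1: "flip_dual P \<bullet> (m' \<rhd> strict te P) \<bullet> (m' \<rhd> strict la ?P) \<bullet> strict tcm (Prod1 x ?P)
      = (m \<rhd> strict te P) \<bullet> coact ?P"
  proof -
    have "flip_dual P \<bullet> (m' \<rhd> strict te P) \<bullet> (m' \<rhd> strict la ?P) \<bullet> strict tcm (Prod1 x ?P)
      = (m \<rhd> strict te P) \<bullet> (flip_dual (Prod1 x ?P) \<bullet> (m' \<rhd> strict la ?P)) \<bullet> strict tcm (Prod1 x ?P)"
      using assms vc_left_cong[OF flip_dual_natural[of "strict te P"]] by (simp add: vc_assoc)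
    also have "\<dots> = (m \<rhd> strict te P) \<bullet> (m \<rhd> strict la ?P) \<bullet> flip_dual (Prod1 m (Prod1 x ?P)) \<bullet> strict tcm (Prod1 x ?P)"
      using assms flip_dual_natural[of "strict la ?P"] by (simp add: vc_assoc)
    finally show ?thesis
      using assms by (simp add: flip_dual_tcm coact_def)
  qed
  have "dcoact P = (x' \<rhd> (flip_dual P \<bullet> (m' \<rhd> strict te P) \<bullet> (m' \<rhd> strict la ?P) \<bullet> strict tcm (Prod1 x ?P))) \<bullet> strict tc ?P"
    unfolding 1 using assms by (simp add: dcoact_def whisker_vc vc_assoc)
  also have "\<dots> = (x' \<rhd> flip_dual P) \<bullet> (x' \<rhd> m' \<rhd> strict te P) \<bullet> (x' \<rhd> m' \<rhd> strict la ?P)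
      \<bullet> (x' \<rhd> strict tcm (Prod1 x ?P)) \<bullet> strict tc ?P"
    using assms by (simp add: whisker_vc vc_assoc)
  also have "\<dots> = ((x' \<rhd> flip_dual P) \<bullet> dact (Prod1 m' P)) \<bullet> (x' \<rhd> strict com P)"
    using assms pivotal[of P] by (simp add: dact_def vc_assoc)
  also have "\<dots> = dact (Prod1 m P) \<bullet> (x' \<rhd> ((m \<rhd> flip_dual P) \<bullet> strict com P))"
    using assms vc_left_cong[OF dact_natural[of "flip_dual P"]] by (simp add: whisker_vc vc_assoc)
  finally show ?thesis
    using assms by (simp add: flip_dual_com)
qed

lemma dact_assoc:
  assumes "good P b"
  shows "dact P \<bullet> dact (Prod1 m P) = dact P \<bullet> (x' \<rhd> strict mu P)"
proof -
  let ?P = "Prod1 x' P"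
  have "dact P \<bullet> dact (Prod1 m P)
      = strict ev ?P \<bullet> (x' \<rhd> strict la ?P) \<bullet> ((x' \<rhd> m \<rhd> strict co P) \<bullet> dact (Prod1 m P))"
    using assms by (simp add: dact_def[of P] vc_assoc)
  also have "\<dots> = strict ev ?P \<bullet> ((x' \<rhd> strict la ?P) \<bullet> dact (Prod1 m (Prod1 x ?P))) \<bullet> (x' \<rhd> m \<rhd> m \<rhd> strict co P)"
    using assms dact_natural[of "m \<rhd> strict co P"] by (simp add: vc_assoc)
  also have "\<dots> = (strict ev ?P \<bullet> dact (Prod1 x ?P)) \<bullet> (x' \<rhd> m \<rhd> strict la ?P) \<bullet> (x' \<rhd> m \<rhd> m \<rhd> strict co P)"
    using assms vc_left_cong[OF dact_natural[of "strict la ?P"]] by (simp add: vc_assoc)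
  also have "\<dots> = strict ev ?P \<bullet> (x' \<rhd> ((strict la ?P \<bullet> (m \<rhd> strict la ?P)) \<bullet> (m \<rhd> m \<rhd> strict co P)))"
    using assms by (simp add: ev_dact whisker_vc vc_assoc)
  also have "\<dots> = strict ev ?P \<bullet> (x' \<rhd> (strict la ?P \<bullet> strict mu (Prod1 x ?P) \<bullet> (m \<rhd> m \<rhd> strict co P)))"
    using assms by (simp add: act_assoc vc_assoc)
  also have "\<dots> = strict ev ?P \<bullet> (x' \<rhd> (strict la ?P \<bullet> (m \<rhd> strict co P) \<bullet> strict mu P))"
    using assms natural(9)[of "strict co P"] by simp
  finally show ?thesis
    using assms by (simp add: dact_def whisker_vc vc_assoc)
qed

lemma dact_unit:
  assumes "good P b"
  shows "dact P \<bullet> (x' \<rhd> strict et P) = Id (Prod1 x' P)"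
proof -
  let ?P = "Prod1 x' P"
  have "dact P \<bullet> (x' \<rhd> strict et P) = strict ev ?P \<bullet> (x' \<rhd> (strict la ?P \<bullet> (m \<rhd> strict co P) \<bullet> strict et P))"
    using assms by (simp add: dact_def whisker_vc vc_assoc)
  also have "(m \<rhd> strict co P) \<bullet> strict et P = strict et (Prod1 x ?P) \<bullet> strict co P"
    using assms natural(10)[of "strict co P"] by simp
  also have "strict la ?P \<bullet> strict et (Prod1 x ?P) \<bullet> strict co P = strict co P"
    using assms vc_left_cong[OF act_unit[of ?P]] by simp
  finally show ?thesis
    using assms by (simp add: zigzag_x')
qed

text \<open>
  Since \<open>dcoact\<close> is induced by the copairing, the composite is the action of \<open>\<mu> \<circ> \<Delta> \<circ> \<eta> = \<eta>\<close>.
\<close>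

lemma dact_dcoact:
  assumes "good P b"
  shows "dact P \<bullet> dcoact P = Id (Prod1 x' P)"
proof -
  have "dact P \<bullet> dcoact P = (dact P \<bullet> dact (Prod1 m P)) \<bullet> (x' \<rhd> strict ga P)"
    using assms by (simp add: dcoact_eq vc_assoc)
  also have "\<dots> = dact P \<bullet> (x' \<rhd> (strict mu P \<bullet> strict ga P))"
    using assms by (simp add: dact_assoc whisker_vc vc_assoc)
  finally show ?thesis
    using assms by (simp add: separable dact_unit)
qed

text \<open>
  The line of \<open>m\<close> that runs past \<open>th\<close> inside the loop is moved to the strand \<open>x'\<close>. There \<open>dact\<close> slides past \<open>th\<close>,
  which lies on a different strand, meets \<open>dcoact\<close> and cancels.
\<close>

theorem bubble:
  assumes P: "good P a" and th: "has_type th x x"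
  shows "strict ev P \<bullet> (x' \<rhd> (strict la P \<bullet> (m \<rhd> strict th P) \<bullet> coact P)) \<bullet> strict tc P
    = strict ev P \<bullet> (x' \<rhd> strict th P) \<bullet> strict tc P"
proof -
  note has_typeD[OF th, simp]
  let ?P = "Prod1 x P"
  have "strict ev P \<bullet> (x' \<rhd> (strict la P \<bullet> (m \<rhd> strict th P) \<bullet> coact P)) \<bullet> strict tc P
      = (strict ev P \<bullet> (x' \<rhd> strict la P)) \<bullet> (x' \<rhd> m \<rhd> strict th P) \<bullet> ((x' \<rhd> coact P) \<bullet> strict tc P)"
    using P by (simp add: whisker_vc vc_assoc)
  also have "\<dots> = (strict ev P \<bullet> dact ?P) \<bullet> (x' \<rhd> m \<rhd> strict th P) \<bullet> (dcoact ?P \<bullet> strict tc P)"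
    using P by (simp add: ev_dact dcoact_tc)
  also have "\<dots> = strict ev P \<bullet> (dact ?P \<bullet> (x' \<rhd> m \<rhd> strict th P)) \<bullet> dcoact ?P \<bullet> strict tc P"
    by (simp add: vc_assoc)
  also have "\<dots> = strict ev P \<bullet> (x' \<rhd> strict th P) \<bullet> (dact ?P \<bullet> dcoact ?P) \<bullet> strict tc P"
    using P dact_natural[of "strict th P"] by (simp add: vc_assoc)
  finally show ?thesis
    using P by (simp add: dact_dcoact)
qed

end

section \<open>Strict forms of adjunctions and Frobenius algebras\<close>

context bicategory
begin

lemmas strictify = strict_vc strict_hc strict_Id strict_AS strict_AI strict_LU strict_LI strict_RU strict_RI apf_Id Id_hc_Id vc_assoc

lemma has_type_Cell2: "has_type (Cell2 s f t) s t \<longleftrightarrow> typed s f t"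
  by (simp add: has_type_def)

lemma natural_strict:
  assumes "has_type \<phi> s t" "ok f" "Dom f = P" "Cod f = Q" "src s = tgt P"
  shows "strict \<phi> Q \<bullet> apf s f = apf t f \<bullet> strict \<phi> P"
  using assms strict_natural[of \<phi> f] by (simp add: has_type_def)

text \<open>
  The left and right adjoints may be composite, as is the case for the composite of an algebra with a module.
\<close>

lemma strict_adjunction:
  fixes l r :: "('o, 'x) term1"
  assumes adj: "is_adjunction \<B> (src r) (tgt r) (val l) (val r) e n"
    and wf: "wf1 l" "wf1 r" "src l = tgt r" "tgt l = src r"
  defines "ef \<equiv> Cell2 (Prod1 l r) e (Unit1 (src r))" and "nf \<equiv> Cell2 (Unit1 (tgt r)) n (Prod1 r l)"
  shows "has_type ef (Prod1 l r) (Unit1 (src r))" "has_type nf (Unit1 (tgt r)) (Prod1 r l)"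
    and "\<lbrakk>wf1 P; tgt P = src r\<rbrakk> \<Longrightarrow> apf r (strict ef P) \<bullet> strict nf (app r P) = Id (app r P)"
    and "\<lbrakk>wf1 P; tgt P = tgt r\<rbrakk> \<Longrightarrow> strict ef (app l P) \<bullet> apf l (strict nf P) = Id (app l P)"
proof -
  show te: "has_type ef (Prod1 l r) (Unit1 (src r))" and tn: "has_type nf (Unit1 (tgt r)) (Prod1 r l)"
    using assms by (simp_all add: has_type_Cell2 typed_def is_adjunction_def)
  note t [simp] = has_typeD[OF te] has_typeD[OF tn]
  have v [simp]: "val2 ef = e" "val2 nf = n"
    by (simp_all add: ef_def nf_def)
  have 1: "RU r \<bullet> (Id r \<star> ef) \<bullet> AS r l r \<bullet> (nf \<star> Id r) \<bullet> LI r = Id r"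
    unfolding vc_assoc[symmetric]
    using adj wf by (intro cell2_eqI) (simp_all add: is_adjunction_def)
  have 2: "LU l \<bullet> (ef \<star> Id l) \<bullet> AI l r l \<bullet> (Id l \<star> nf) \<bullet> RI l = Id l"
    unfolding vc_assoc[symmetric]
    using adj wf by (intro cell2_eqI) (simp_all add: is_adjunction_def)
  show "apf r (strict ef P) \<bullet> strict nf (app r P) = Id (app r P)" if "wf1 P" "tgt P = src r"
    using arg_cong[OF 1, of "\<lambda>\<phi>. strict \<phi> P"] that wf by (simp add: strictify)
  show "strict ef (app l P) \<bullet> apf l (strict nf P) = Id (app l P)" if "wf1 P" "tgt P = tgt r"
    using arg_cong[OF 2, of "\<lambda>\<phi>. strict \<phi> P"] that wf by (simp add: strictify)
qed

end

locale frobenius_diagram = bicategory \<B> for \<B> :: "('o, 'x, 'f, 'z) bicategory_data_scheme" (structure) +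
  fixes b :: 'o and F :: "('x, 'f) frobenius_data"
  assumes b: "b \<in> Obj \<B>" and frobenius: "is_frobenius_algebra \<B> b F"
begin

abbreviation "m \<equiv> Gen1 b b (carr F)"

definition "mu = Cell2 (Prod1 m m) (mul F) m"
definition "et = Cell2 (Unit1 b) (unt F) m"
definition "de = Cell2 m (comul F) (Prod1 m m)"
definition "ep = Cell2 m (counit F) (Unit1 b)"

lemmas frob = frobenius[unfolded is_frobenius_algebra_def Let_def is_algebra_def is_coalgebra_def]

lemma carr_closed [simp]: "carr F \<in> Hom1 \<B> b b"
  using frob by blast

lemma types:
  "has_type mu (Prod1 m m) m" "has_type et (Unit1 b) m"
  "has_type de m (Prod1 m m)" "has_type ep m (Unit1 b)"
  using frob b by (simp_all add: mu_def et_def de_def ep_def has_type_Cell2 typed_def)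

lemmas types' [simp] = has_typeD[OF types(1)] has_typeD[OF types(2)] has_typeD[OF types(3)]
  has_typeD[OF types(4)]

lemma vals [simp]:
  "val2 mu = mul F" "val2 et = unt F" "val2 de = comul F" "val2 ep = counit F"
  by (simp_all add: mu_def et_def de_def ep_def)

lemma strict_frobenius:
  assumes P: "wf1 P" "tgt P = b"
  shows "strict mu P \<bullet> strict mu (Prod1 m P) = strict mu P \<bullet> (m \<rhd> strict mu P)"
    and "strict mu P \<bullet> strict et (Prod1 m P) = Id (Prod1 m P)"
    and "strict mu P \<bullet> (m \<rhd> strict et P) = Id (Prod1 m P)"
    and "strict ep (Prod1 m P) \<bullet> strict de P = Id (Prod1 m P)"
    and "(m \<rhd> strict ep P) \<bullet> strict de P = Id (Prod1 m P)"
    and "(m \<rhd> strict mu P) \<bullet> strict de (Prod1 m P) = strict de P \<bullet> strict mu P"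
    and "strict mu (Prod1 m P) \<bullet> (m \<rhd> strict de P) = strict de P \<bullet> strict mu P"
proof -
  have *: "mu \<bullet> (mu \<star> Id m) = mu \<bullet> (Id m \<star> mu) \<bullet> AS m m m"
    "mu \<bullet> (et \<star> Id m) = LU m" "mu \<bullet> (Id m \<star> et) = RU m"
    "(ep \<star> Id m) \<bullet> de = LI m" "(Id m \<star> ep) \<bullet> de = RI m"
    "(Id m \<star> mu) \<bullet> AS m m m \<bullet> (de \<star> Id m) = de \<bullet> mu"
    "(mu \<star> Id m) \<bullet> AI m m m \<bullet> (Id m \<star> de) = de \<bullet> mu"
    unfolding vc_assoc[symmetric]
    using frob b by (intro cell2_eqI; simp)+
  show "strict mu P \<bullet> strict mu (Prod1 m P) = strict mu P \<bullet> (m \<rhd> strict mu P)"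
    "strict mu P \<bullet> strict et (Prod1 m P) = Id (Prod1 m P)"
    "strict mu P \<bullet> (m \<rhd> strict et P) = Id (Prod1 m P)"
    "strict ep (Prod1 m P) \<bullet> strict de P = Id (Prod1 m P)"
    "(m \<rhd> strict ep P) \<bullet> strict de P = Id (Prod1 m P)"
    "(m \<rhd> strict mu P) \<bullet> strict de (Prod1 m P) = strict de P \<bullet> strict mu P"
    "strict mu (Prod1 m P) \<bullet> (m \<rhd> strict de P) = strict de P \<bullet> strict mu P"
    using *[THEN arg_cong, of "\<lambda>\<phi>. strict \<phi> P"] P b by (simp_all add: strictify)
qed

text \<open>
  A Frobenius relation moves \<open>\<Delta>\<close> past \<open>\<mu>\<close>; what remains is a unit law and a counit law.
\<close>

lemma zigzag_form:
  assumes P: "wf1 P" "tgt P = b"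
  shows "strict (ep \<bullet> mu) (Prod1 m P) \<bullet> (m \<rhd> strict (de \<bullet> et) P) = Id (Prod1 m P)"
proof -
  have "strict (ep \<bullet> mu) (Prod1 m P) \<bullet> (m \<rhd> strict (de \<bullet> et) P)
      = strict ep (Prod1 m P) \<bullet> (strict mu (Prod1 m P) \<bullet> (m \<rhd> strict de P)) \<bullet> (m \<rhd> strict et P)"
    using P b by (simp add: strict_vc whisker_vc vc_assoc)
  also have "\<dots> = (strict ep (Prod1 m P) \<bullet> strict de P) \<bullet> (strict mu P \<bullet> (m \<rhd> strict et P))"
    using P b by (simp add: strict_frobenius vc_assoc)
  finally show ?thesis
    using P b by (simp add: strict_frobenius)
qed

end

section \<open>Averages under the left trace\<close>

text \<open>
  The coaction that makes a module over a Frobenius algebra a comodule over its coalgebra.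
\<close>

definition left_coaction ::
    "('o, 'x, 'f, 'z) bicategory_data_scheme \<Rightarrow> ('x, 'f) frobenius_data \<Rightarrow> 'x \<Rightarrow> 'f \<Rightarrow> 'f"
  where "left_coaction \<B> F X l = (\<one> (carr F) \<otimes> l) \<cdot> \<a> (carr F) (carr F) X
    \<cdot> ((comul F \<cdot> unt F) \<otimes> \<one> X) \<cdot> \<l>\<inverse> X"
  for \<B> (structure)

definition left_average ::
    "('o, 'x, 'f, 'z) bicategory_data_scheme \<Rightarrow> ('x, 'f) frobenius_data \<Rightarrow> 'x \<Rightarrow> 'f \<Rightarrow> 'f \<Rightarrow> 'f \<Rightarrow> 'f"
  where "left_average \<B> F X l l' \<psi> = l' \<cdot> (\<one> (carr F) \<otimes> \<psi>) \<cdot> left_coaction \<B> F X l"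
  for \<B> (structure)

definition is_left_module ::
    "('o, 'x, 'f, 'z) bicategory_data_scheme \<Rightarrow> ('x, 'f) frobenius_data \<Rightarrow> 'x \<Rightarrow> 'f \<Rightarrow> bool"
  where "is_left_module \<B> F X l \<longleftrightarrow> l \<in> Hom2 \<B> (carr F \<odot> X) X \<and>
    l \<cdot> (mul F \<otimes> \<one> X) = l \<cdot> (\<one> (carr F) \<otimes> l) \<cdot> \<a> (carr F) (carr F) X \<and>
    l \<cdot> (unt F \<otimes> \<one> X) = \<l> X"
  for \<B> (structure)

locale left_module_diagram = frobenius_diagram \<B> b F
  for \<B> :: "('o, 'x, 'f, 'z) bicategory_data_scheme" (structure) and b F +
  fixes a :: 'o and X :: 'x and l :: 'f
  assumes a: "a \<in> Obj \<B>" and X [simp]: "X \<in> Hom1 \<B> a b" and module: "is_left_module \<B> F X l"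
begin

abbreviation "x \<equiv> Gen1 a b X"
definition "la = Cell2 (Prod1 m x) l x"

lemma type_la: "has_type la (Prod1 m x) x"
  using module a b by (simp add: la_def has_type_Cell2 typed_def is_left_module_def)

lemmas type_la' [simp] = has_typeD[OF type_la]

lemma val_la [simp]: "val2 la = l"
  by (simp add: la_def)

lemma strict_module:
  assumes P: "wf1 P" "tgt P = a"
  shows "strict la P \<bullet> (m \<rhd> strict la P) = strict la P \<bullet> strict mu (Prod1 x P)"
    and "strict la P \<bullet> strict et (Prod1 x P) = Id (Prod1 x P)"
proof -
  have *: "la \<bullet> (mu \<star> Id x) = la \<bullet> (Id m \<star> la) \<bullet> AS m m x" "la \<bullet> (et \<star> Id x) = LU x"
    unfolding vc_assoc[symmetric]
    using module a b by (intro cell2_eqI; simp add: is_left_module_def)+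
  show "strict la P \<bullet> (m \<rhd> strict la P) = strict la P \<bullet> strict mu (Prod1 x P)"
    "strict la P \<bullet> strict et (Prod1 x P) = Id (Prod1 x P)"
    using *[THEN arg_cong, of "\<lambda>\<phi>. strict \<phi> P"] P a b by (simp_all add: strictify)
qed

definition "formal_coaction = (Id m \<star> la) \<bullet> AS m m x \<bullet> ((de \<bullet> et) \<star> Id x) \<bullet> LI x"

lemma formal_coaction [simp]: "ok formal_coaction" "Dom formal_coaction = x" "Cod formal_coaction = Prod1 m x"
    "val2 formal_coaction = left_coaction \<B> F X l"
proof -
  have eq: "formal_coaction = (((Id m \<star> la) \<bullet> AS m m x) \<bullet> ((de \<bullet> et) \<star> Id x)) \<bullet> LI x"
    by (simp add: formal_coaction_def vc_assoc)
  show "ok formal_coaction" "Dom formal_coaction = x" "Cod formal_coaction = Prod1 m x"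
    "val2 formal_coaction = left_coaction \<B> F X l"
    using a b by (simp_all add: eq left_coaction_def)
qed

lemma strict_formal_coaction:
  "wf1 P \<Longrightarrow> tgt P = a \<Longrightarrow> strict formal_coaction P = (m \<rhd> strict la P) \<bullet> strict (de \<bullet> et) (Prod1 x P)"
  using a b by (simp add: formal_coaction_def strictify)

end

context pivotal_bicategory
begin

lemma dual_closed: "a \<in> Obj \<B> \<Longrightarrow> b \<in> Obj \<B> \<Longrightarrow> X \<in> Hom1 \<B> a b \<Longrightarrow> X\<^sup>\<dagger> \<in> Hom1 \<B> b a"
  using dual_left_adjoint[of a b X] by (simp add: is_adjunction_def)

text \<open>
  Both sides are the dual of the action \<open>l\<close>, as a map from the dual of \<open>X\<close> to the composite of the duals. On each side
  it factors through the dual of \<open>B \<odot> X\<close>, and the two pivotal axioms compare the two factors separately: \<open>M\<close> for the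
  dual of the morphism \<open>l\<close>, \<open>T\<close> for the dual of the composite \<open>B \<odot> X\<close>. In both factorisations the dual of
  \<open>B \<odot> X\<close> is then removed by a zigzag.
\<close>

lemma strict_pivotal:
  assumes obj: "a \<in> Obj \<B>" "b \<in> Obj \<B>" and X: "X \<in> Hom1 \<B> a b" and B: "B \<in> Hom1 \<B> b b"
    and l: "l \<in> Hom2 \<B> (B \<odot> X) X"
    and P: "wf1 P" "tgt P = b"
  defines "x \<equiv> Gen1 a b X" and "x' \<equiv> Gen1 b a (X\<^sup>\<dagger>)" and "m \<equiv> Gen1 b b B" and "m' \<equiv> Gen1 b b (B\<^sup>\<dagger>)"
  defines "ev' \<equiv> Cell2 (Prod1 x' x) (ev \<B> X) (Unit1 a)" and "co \<equiv> Cell2 (Unit1 b) (coev \<B> X) (Prod1 x x')"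
    and "te \<equiv> Cell2 (Prod1 x x') (tev \<B> X) (Unit1 b)" and "tc \<equiv> Cell2 (Unit1 a) (tcoev \<B> X) (Prod1 x' x)"
    and "com \<equiv> Cell2 (Unit1 b) (coev \<B> B) (Prod1 m m')"
    and "tcm \<equiv> Cell2 (Unit1 b) (tcoev \<B> B) (Prod1 m' m)"
    and "la \<equiv> Cell2 (Prod1 m x) l x"
  shows "(x' \<rhd> m' \<rhd> strict te P) \<bullet> (x' \<rhd> m' \<rhd> strict la (Prod1 x' P))
        \<bullet> (x' \<rhd> strict tcm (Prod1 x (Prod1 x' P))) \<bullet> strict tc (Prod1 x' P)
      = strict ev' (Prod1 x' (Prod1 m' P)) \<bullet> (x' \<rhd> strict la (Prod1 x' (Prod1 m' P)))
        \<bullet> (x' \<rhd> m \<rhd> strict co (Prod1 m' P)) \<bullet> (x' \<rhd> strict com P)"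
proof -
  define w where "w = Gen1 b a ((B \<odot> X)\<^sup>\<dagger>)"
  let ?z = "Prod1 m x"
  define evw where "evw = Cell2 (Prod1 w ?z) (ev \<B> (B \<odot> X)) (Unit1 a)"
  define cow where "cow = Cell2 (Unit1 b) (coev \<B> (B \<odot> X)) (Prod1 ?z w)"
  define tew where "tew = Cell2 (Prod1 ?z w) (tev \<B> (B \<odot> X)) (Unit1 b)"
  define tcw where "tcw = Cell2 (Unit1 a) (tcoev \<B> (B \<odot> X)) (Prod1 w ?z)"
  have BX: "B \<odot> X \<in> Hom1 \<B> a b"
    using obj X B by (blast intro: comp1_closed)
  note gens = x_def x'_def m_def m'_def w_def
  have wf [simp]: "wf1 x" "wf1 x'" "wf1 m" "wf1 m'" "wf1 w"
    using obj X B BX by (simp_all add: gens dual_closed)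
  have strict [simp]: "src x = a" "tgt x = b" "src x' = b" "tgt x' = a" "src m = b" "tgt m = b"
    "src m' = b" "tgt m' = b" "src w = b" "tgt w = a" 
    by (simp_all add: gens)
  have vals [simp]: "val x = X" "val x' = X\<^sup>\<dagger>" "val m = B" "val m' = B\<^sup>\<dagger>" "val w = (B \<odot> X)\<^sup>\<dagger>"
    by (simp_all add: gens)
  have app [simp]: "app x Q = Prod1 x Q" "app x' Q = Prod1 x' Q" "app m Q = Prod1 m Q"
    "app m' Q = Prod1 m' Q" "app w Q = Prod1 w Q" for Q
    by (simp_all add: gens)
  have apf [simp]: "apf x f = x \<rhd> f" "apf x' f = x' \<rhd> f" "apf m f = m \<rhd> f"
    "apf m' f = m' \<rhd> f" "apf w f = w \<rhd> f" for f
    by (simp_all add: gens)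
  note [simp] = obj P
  note adjX = strict_adjunction[where l = x' and r = x and e = "ev \<B> X" and n = "coev \<B> X", simplified, folded ev'_def co_def]
  note adjX' = strict_adjunction[where l = x and r = x' and e = "tev \<B> X" and n = "tcoev \<B> X", simplified, folded te_def tc_def]
  note adjB = strict_adjunction[where l = m' and r = m and e = "ev \<B> B" and n = "coev \<B> B", simplified, folded com_def]
  note adjB' = strict_adjunction[where l = m and r = m' and e = "tev \<B> B" and n = "tcoev \<B> B", simplified, folded tcm_def]
  note adjW = strict_adjunction[where l = w and r = "?z" and e = "ev \<B> (B \<odot> X)" and n = "coev \<B> (B \<odot> X)", simplified, folded evw_def cow_def]
  note adjW' = strict_adjunction[where l = "?z" and r = w and e = "tev \<B> (B \<odot> X)" and n = "tcoev \<B> (B \<odot> X)", simplified, folded tew_def tcw_def]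
  note left = dual_left_adjoint[OF obj X] dual_left_adjoint[OF obj(2,2) B] dual_left_adjoint[OF obj BX]
  note right = dual_right_adjoint[OF obj X] dual_right_adjoint[OF obj(2,2) B] dual_right_adjoint[OF obj BX]
  note types = adjX(1,2)[OF left(1)] adjX'(1,2)[OF right(1)] adjB(2)[OF left(2)] adjB'(2)[OF right(2)]
    adjW(1,2)[OF left(3)] adjW'(1,2)[OF right(3)]
  have type_la: "has_type la ?z x"
    using obj X B BX l by (simp add: la_def has_type_Cell2 typed_def)
  note ok [simp] = types[THEN has_typeD(1)] types[THEN has_typeD(2)] types[THEN has_typeD(3)]
    has_typeD[OF type_la]
  have val2 [simp]: "val2 ev' = ev \<B> X" "val2 co = coev \<B> X" "val2 te = tev \<B> X" "val2 tc = tcoev \<B> X"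
    "val2 com = coev \<B> B" "val2 tcm = tcoev \<B> B" "val2 evw = ev \<B> (B \<odot> X)" "val2 cow = coev \<B> (B \<odot> X)"
    "val2 tew = tev \<B> (B \<odot> X)" "val2 tcw = tcoev \<B> (B \<odot> X)" "val2 la = l"
    by (simp_all add: ev'_def co_def te_def tc_def com_def tcm_def evw_def cow_def tew_def tcw_def la_def)
  let ?P = "Prod1 x' P"
  have M: "(w \<rhd> strict te P) \<bullet> (w \<rhd> strict la ?P) \<bullet> strict tcw ?P
      = strict ev' (Prod1 w P) \<bullet> (x' \<rhd> strict la (Prod1 w P)) \<bullet> (x' \<rhd> strict cow P)"
  proof -
    have "RU w \<bullet> (Id w \<star> te) \<bullet> (Id w \<star> (la \<star> Id x')) \<bullet> AS w ?z x' \<bullet> (tcw \<star> Id x') \<bullet> LI x'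
      = LU w \<bullet> (ev' \<star> Id w) \<bullet> AI x' x w \<bullet> (Id x' \<star> (la \<star> Id w)) \<bullet> (Id x' \<star> cow) \<bullet> RI x'"
      unfolding vc_assoc[symmetric]
      using pivotal_map[OF obj X BX l] by (intro cell2_eqI) simp_all
    from arg_cong[OF this, of "\<lambda>\<phi>. strict \<phi> P"] show ?thesis
      by (simp add: strictify)
  qed
  have T: "(x' \<rhd> m' \<rhd> strict tew P) \<bullet> (x' \<rhd> strict tcm (Prod1 x (Prod1 w P))) \<bullet> strict tc (Prod1 w P)
      = strict evw (Prod1 x' (Prod1 m' P)) \<bullet> (w \<rhd> m \<rhd> strict co (Prod1 m' P)) \<bullet> (w \<rhd> strict com P)"
  proof -
    have "(Id x' \<star> RU m') \<bullet> (Id x' \<star> (Id m' \<star> tew)) \<bullet> (Id x' \<star> (Id m' \<star> AI m x w))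
        \<bullet> (Id x' \<star> AS m' m (Prod1 x w)) \<bullet> (Id x' \<star> (tcm \<star> Id (Prod1 x w)))
        \<bullet> (Id x' \<star> LI (Prod1 x w)) \<bullet> AS x' x w \<bullet> (tc \<star> Id w) \<bullet> LI w
      = LU (Prod1 x' m') \<bullet> (evw \<star> Id (Prod1 x' m')) \<bullet> AI w ?z (Prod1 x' m')
        \<bullet> (Id w \<star> AI m x (Prod1 x' m')) \<bullet> (Id w \<star> (Id m \<star> AS x x' m'))
        \<bullet> (Id w \<star> (Id m \<star> (co \<star> Id m'))) \<bullet> (Id w \<star> (Id m \<star> LI m')) \<bullet> (Id w \<star> com) \<bullet> RI w"
      unfolding vc_assoc[symmetric]
      using pivotal_tensor[OF obj(1,2,2) X B refl] by (intro cell2_eqI) simp_all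
    from arg_cong[OF this, of "\<lambda>\<phi>. strict \<phi> P"] show ?thesis
      by (simp add: strictify)
  qed
  define M where "M = (w \<rhd> strict te P) \<bullet> (w \<rhd> strict la ?P) \<bullet> strict tcw ?P"
  have typeM [simp]: "ok M" "Dom M = ?P" "Cod M = Prod1 w P"
    by (simp_all add: M_def)
  let ?Q = "Prod1 x' (Prod1 m' P)"
  define k where "k = (m \<rhd> strict co (Prod1 m' P)) \<bullet> strict com P"
  have typek [simp]: "ok k" "Dom k = P" "Cod k = Prod1 m (Prod1 x ?Q)"
    by (simp_all add: k_def)
  have "strict tew P \<bullet> (m \<rhd> x \<rhd> M) = strict te P \<bullet> strict la ?P"
  proof -
    have "strict tew P \<bullet> (m \<rhd> x \<rhd> M) = (strict tew P \<bullet> (m \<rhd> x \<rhd> w \<rhd> (strict te P \<bullet> strict la ?P)))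
        \<bullet> (m \<rhd> x \<rhd> strict tcw ?P)"
      by (simp add: M_def whisker_vc vc_assoc)
    also have "\<dots> = (strict te P \<bullet> strict la ?P) \<bullet> (strict tew (Prod1 m (Prod1 x ?P)) \<bullet> (m \<rhd> x \<rhd> strict tcw ?P))"
      using natural_strict[OF types(9), of "strict te P \<bullet> strict la ?P" "Prod1 m (Prod1 x ?P)" P]
      by (simp add: vc_assoc)
    finally show ?thesis
      using adjW'(4)[OF right(3), of ?P] by (simp add: vc_assoc)
  qed
  note tewM = this
  have "(x' \<rhd> m' \<rhd> strict tew P) \<bullet> (x' \<rhd> strict tcm (Prod1 x (Prod1 w P))) \<bullet> (strict tc (Prod1 w P) \<bullet> M)
      = (x' \<rhd> m' \<rhd> strict tew P) \<bullet> (x' \<rhd> (strict tcm (Prod1 x (Prod1 w P)) \<bullet> (x \<rhd> M))) \<bullet> strict tc ?P"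
    using natural_strict[OF types(4), of M ?P "Prod1 w P"] by (simp add: whisker_vc vc_assoc)
  also have "\<dots> = (x' \<rhd> m' \<rhd> (strict tew P \<bullet> (m \<rhd> x \<rhd> M))) \<bullet> (x' \<rhd> strict tcm (Prod1 x ?P)) \<bullet> strict tc ?P"
    using natural_strict[OF types(6), of "x \<rhd> M" "Prod1 x ?P" "Prod1 x (Prod1 w P)"]
    by (simp add: whisker_vc vc_assoc)
  finally have TM: "((x' \<rhd> m' \<rhd> strict tew P) \<bullet> (x' \<rhd> strict tcm (Prod1 x (Prod1 w P))) \<bullet> strict tc (Prod1 w P)) \<bullet> M
      = (x' \<rhd> m' \<rhd> strict te P) \<bullet> (x' \<rhd> m' \<rhd> strict la ?P) \<bullet> (x' \<rhd> strict tcm (Prod1 x ?P)) \<bullet> strict tc ?P"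
    unfolding tewM by (simp add: whisker_vc vc_assoc)
  let ?mxQ = "Prod1 m (Prod1 x ?Q)"
  have *: "(x \<rhd> strict evw ?Q) \<bullet> (x \<rhd> w \<rhd> k) \<bullet> strict la (Prod1 w P) \<bullet> strict cow P = strict la ?Q \<bullet> k"
  proof -
    have "(x \<rhd> strict evw ?Q) \<bullet> (x \<rhd> w \<rhd> k) \<bullet> strict la (Prod1 w P) \<bullet> strict cow P
        = (x \<rhd> strict evw ?Q) \<bullet> strict la (Prod1 w ?mxQ) \<bullet> (m \<rhd> x \<rhd> w \<rhd> k) \<bullet> strict cow P"
      using vc_left_cong[OF natural_strict[OF type_la, of "w \<rhd> k" "Prod1 w P" "Prod1 w ?mxQ", symmetric]]
      by (simp add: vc_assoc)
    also have "\<dots> = (x \<rhd> strict evw ?Q) \<bullet> strict la (Prod1 w ?mxQ) \<bullet> strict cow ?mxQ \<bullet> k"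
      using natural_strict[OF types(8), of k P ?mxQ] by simp
    also have "\<dots> = strict la ?Q \<bullet> ((m \<rhd> x \<rhd> strict evw ?Q) \<bullet> strict cow ?mxQ) \<bullet> k"
      using vc_left_cong[OF natural_strict[OF type_la, of "strict evw ?Q" "Prod1 w ?mxQ" ?Q]] by (simp add: vc_assoc)
    finally show ?thesis
      using adjW(3)[OF left(3), of ?Q] by simp
  qed
  have "(strict evw ?Q \<bullet> (w \<rhd> k)) \<bullet> strict ev' (Prod1 w P) \<bullet> (x' \<rhd> strict la (Prod1 w P)) \<bullet> (x' \<rhd> strict cow P)
      = strict evw ?Q \<bullet> ((w \<rhd> k) \<bullet> strict ev' (Prod1 w P)) \<bullet> (x' \<rhd> strict la (Prod1 w P)) \<bullet> (x' \<rhd> strict cow P)"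
    by (simp add: vc_assoc)
  also have "\<dots> = (strict evw ?Q \<bullet> strict ev' (Prod1 w ?mxQ)) \<bullet> (x' \<rhd> x \<rhd> w \<rhd> k) \<bullet> (x' \<rhd> strict la (Prod1 w P)) \<bullet> (x' \<rhd> strict cow P)"
    using vc_left_cong[OF natural_strict[OF types(1), of "w \<rhd> k" "Prod1 w P" "Prod1 w ?mxQ"]]
    by (simp add: vc_assoc)
  also have "\<dots> = strict ev' ?Q \<bullet> (x' \<rhd> ((x \<rhd> strict evw ?Q) \<bullet> (x \<rhd> w \<rhd> k) \<bullet> strict la (Prod1 w P) \<bullet> strict cow P))"
    using vc_left_cong[OF natural_strict[OF types(1), of "strict evw ?Q" "Prod1 w ?mxQ" ?Q]]
    by (simp add: whisker_vc vc_assoc)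
  finally have TM': "(strict evw ?Q \<bullet> (w \<rhd> k)) \<bullet> strict ev' (Prod1 w P) \<bullet> (x' \<rhd> strict la (Prod1 w P)) \<bullet> (x' \<rhd> strict cow P)
      = strict ev' ?Q \<bullet> (x' \<rhd> strict la ?Q) \<bullet> (x' \<rhd> m \<rhd> strict co (Prod1 m' P)) \<bullet> (x' \<rhd> strict com P)"
    unfolding * by (simp add: k_def whisker_vc)
  have "strict evw ?Q \<bullet> (w \<rhd> k) = (x' \<rhd> m' \<rhd> strict tew P) \<bullet> (x' \<rhd> strict tcm (Prod1 x (Prod1 w P))) \<bullet> strict tc (Prod1 w P)"
    using T by (simp add: k_def whisker_vc)
  then show ?thesis
    using TM TM' M by (simp flip: M_def)
qed

text \<open>
  The equation \<open>bubble\<close> at a unit 1-morphism, translated back by faithfulness of the strictification.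
\<close>

theorem trace_left_average:
  assumes obj: "a \<in> Obj \<B>" "b \<in> Obj \<B>" and X: "X \<in> Hom1 \<B> a b"
    and F: "is_frobenius_algebra \<B> b F" and sep: "is_separable \<B> F" and sym: "is_symmetric \<B> F"
    and l: "is_left_module \<B> F X l" and th: "\<psi> \<in> Hom2 \<B> X X"
  shows "trace_left \<B> X (left_average \<B> F X l l \<psi>) = trace_left \<B> X \<psi>"
proof -
  interpret left_module_diagram \<B> b F a X l
    by unfold_locales (use assms in auto)
  let ?B = "carr F"
  let ?x' = "Gen1 b a (X\<^sup>\<dagger>)" and ?m' = "Gen1 b b (?B\<^sup>\<dagger>)"
  define ev' where "ev' = Cell2 (Prod1 ?x' x) (ev \<B> X) (Unit1 a)"
  define co where "co = Cell2 (Unit1 b) (coev \<B> X) (Prod1 x ?x')"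
  define te where "te = Cell2 (Prod1 x ?x') (tev \<B> X) (Unit1 b)"
  define tc where "tc = Cell2 (Unit1 a) (tcoev \<B> X) (Prod1 ?x' x)"
  define evm where "evm = Cell2 (Prod1 ?m' m) (ev \<B> ?B) (Unit1 b)"
  define com where "com = Cell2 (Unit1 b) (coev \<B> ?B) (Prod1 m ?m')"
  define tem where "tem = Cell2 (Prod1 m ?m') (tev \<B> ?B) (Unit1 b)"
  define tcm where "tcm = Cell2 (Unit1 b) (tcoev \<B> ?B) (Prod1 ?m' m)"
  define thf where "thf = Cell2 x \<psi> x"
  note [simp] = obj dual_closed[OF obj X] dual_closed[OF obj(2,2) carr_closed]
  note adjX = strict_adjunction[where l = ?x' and r = x and e = "ev \<B> X" and n = "coev \<B> X", simplified, folded ev'_def co_def]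
  note adjX' = strict_adjunction[where l = x and r = ?x' and e = "tev \<B> X" and n = "tcoev \<B> X", simplified, folded te_def tc_def]
  note adjB = strict_adjunction[where l = ?m' and r = m and e = "ev \<B> ?B" and n = "coev \<B> ?B", simplified, folded evm_def com_def]
  note adjB' = strict_adjunction[where l = m and r = ?m' and e = "tev \<B> ?B" and n = "tcoev \<B> ?B", simplified, folded tem_def tcm_def]
  note left = dual_left_adjoint[OF obj X] dual_left_adjoint[OF obj(2,2) carr_closed]
  note right = dual_right_adjoint[OF obj X] dual_right_adjoint[OF obj(2,2) carr_closed]
  note duals = adjX(1,2)[OF left(1)] adjX'(1,2)[OF right(1)] adjB(1,2)[OF left(2)] adjB'(1,2)[OF right(2)]
  note duals' [simp] = duals[THEN has_typeD(1)] duals[THEN has_typeD(2)] duals[THEN has_typeD(3)]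
  have dvals [simp]: "val2 ev' = ev \<B> X" "val2 tc = tcoev \<B> X" "val2 com = coev \<B> ?B"
    "val2 tcm = tcoev \<B> ?B" "val2 thf = \<psi>"
    by (simp_all add: ev'_def tc_def com_def tcm_def thf_def)
  have symmetric: "strict (ep \<bullet> mu) (Prod1 ?m' P) \<bullet> (m \<rhd> strict com P)
      = (?m' \<rhd> strict (ep \<bullet> mu) P) \<bullet> strict tcm (Prod1 m P)" if P: "wf1 P" "tgt P = b" for P
  proof -
    have "(((LU ?m' \<bullet> ((ep \<bullet> mu) \<star> Id ?m')) \<bullet> AI m m ?m') \<bullet> (Id m \<star> com)) \<bullet> RI m
      = (((RU ?m' \<bullet> (Id ?m' \<star> (ep \<bullet> mu))) \<bullet> AS ?m' m m) \<bullet> (tcm \<star> Id m)) \<bullet> LI m"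
      using sym[unfolded is_symmetric_def Let_def] by (intro cell2_eqI) simp_all
    from arg_cong[OF this, of "\<lambda>\<phi>. strict \<phi> P"] P show ?thesis
      by (simp add: strictify)
  qed
  have separable: "strict mu P \<bullet> strict (de \<bullet> et) P = strict et P" if P: "wf1 P" "tgt P = b" for P
  proof -
    have "mu \<bullet> de = Id m"
      using sep by (intro cell2_eqI) (simp_all add: is_separable_def)
    from arg_cong[OF this, of "\<lambda>\<phi>. strict \<phi> P"] P have "strict mu P \<bullet> strict de P = Id (Prod1 m P)"
      by (simp add: strictify)
    from vc_left_cong[OF this, of "strict et P"] P show ?thesis
      by (simp add: strict_vc)
  qed
  interpret dg: module_diagram \<B> a b x ?x' m ?m' ev' co te tc evm com tcm la mu et "de \<bullet> et" "ep \<bullet> mu"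
  proof unfold_locales
    fix P :: "('o, 'x) term1" assume P: "wf1 P" "tgt P = b"
    show "?x' \<rhd> ?m' \<rhd> strict te P \<bullet> ?x' \<rhd> ?m' \<rhd> strict la (Prod1 ?x' P) \<bullet> ?x' \<rhd> strict tcm (Prod1 x (Prod1 ?x' P)) \<bullet> strict tc (Prod1 ?x' P)
      = strict ev' (Prod1 ?x' (Prod1 ?m' P)) \<bullet> ?x' \<rhd> strict la (Prod1 ?x' (Prod1 ?m' P)) \<bullet>
        ?x' \<rhd> m \<rhd> strict co (Prod1 ?m' P) \<bullet> ?x' \<rhd> strict com P"
      using strict_pivotal[OF obj X carr_closed _ P, of l] l
      by (simp add: is_left_module_def la_def te_def tcm_def tc_def ev'_def co_def com_def)
  qed (use duals types type_la adjX(3,4)[OF left(1)] adjX'(4)[OF right(1)] adjB(3)[OF left(2)]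
      strict_module symmetric separable zigzag_form in \<open>simp_all add: generator_def has_type_def\<close>)
  have th: "has_type thf x x"
    using assms by (simp add: thf_def has_type_Cell2 typed_def)
  note [simp] = has_typeD[OF th]
  let ?av = "la \<bullet> (Id m \<star> thf) \<bullet> formal_coaction"
  have av: "ok ?av" "Dom ?av = x" "Cod ?av = x" "val2 ?av = left_average \<B> F X l l \<psi>"
  proof -
    show "ok ?av" "Dom ?av = x" "Cod ?av = x" by simp_all
    have "?av = (la \<bullet> (Id m \<star> thf)) \<bullet> formal_coaction" by (simp add: vc_assoc)
    then show "val2 ?av = left_average \<B> F X l l \<psi>" by (simp add: left_average_def)
  qed
  let ?tr = "\<lambda>\<phi>. (ev' \<bullet> (Id ?x' \<star> \<phi>)) \<bullet> tc"
  have "?tr ?av = ?tr thf"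
  proof (rule strict_faithful)
    have "strict (?tr ?av) (Unit1 a) = strict (?tr thf) (Unit1 a)"
      using dg.bubble[OF _ th, of "Unit1 a"] av
      by (simp add: strictify dg.coact_def strict_formal_coaction whisker_vc)
    then show "strict (?tr ?av) (Unit1 (src (Dom (?tr ?av)))) = strict (?tr thf) (Unit1 (src (Dom (?tr ?av))))"
      using av by simp
  qed (use av in simp_all)
  from arg_cong[OF this, of val2] show ?thesis
    using av by (simp add: trace_left_def)
qed

end

section \<open>Reversing 1-morphisms\<close>

text \<open>
  The bicategory with reversed 1-morphisms. It has the same dual 1-morphisms, but the two families of
  adjunctions trade places. Statements on right actions and right traces are those on left actions and left
  traces in the mirror.
\<close>

definition mirror :: "('o, 'x, 'f, 'z) pivotal_data_scheme \<Rightarrow> ('o, 'x, 'f) pivotal_data" where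
  "mirror \<B> = \<lparr>Obj = Obj \<B>, Hom1 = (\<lambda>a b. Hom1 \<B> b a), Hom2 = Hom2 \<B>,
    comp1 = (\<lambda>Y X. comp1 \<B> X Y), unit1 = unit1 \<B>, vcomp = vcomp \<B>, id2 = id2 \<B>,
    hcomp = (\<lambda>g f. hcomp \<B> f g),
    assoc = (\<lambda>Z Y X. assoc_inv \<B> X Y Z), assoc_inv = (\<lambda>Z Y X. assoc \<B> X Y Z),
    lunit = runit \<B>, lunit_inv = runit_inv \<B>, runit = lunit \<B>, runit_inv = lunit_inv \<B>,
    dual = dual \<B>, ev = tev \<B>, coev = tcoev \<B>, tev = ev \<B>, tcoev = coev \<B>\<rparr>"

lemma mirror_simps [simp]:
  "Obj (mirror \<B>) = Obj \<B>" "Hom1 (mirror \<B>) a b = Hom1 \<B> b a" "Hom2 (mirror \<B>) = Hom2 \<B>"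
  "comp1 (mirror \<B>) Y X = comp1 \<B> X Y" "unit1 (mirror \<B>) = unit1 \<B>"
  "vcomp (mirror \<B>) = vcomp \<B>" "id2 (mirror \<B>) = id2 \<B>" "hcomp (mirror \<B>) g f = hcomp \<B> f g"
  "assoc (mirror \<B>) Z Y X = assoc_inv \<B> X Y Z" "assoc_inv (mirror \<B>) Z Y X = assoc \<B> X Y Z"
  "lunit (mirror \<B>) = runit \<B>" "lunit_inv (mirror \<B>) = runit_inv \<B>"
  "runit (mirror \<B>) = lunit \<B>" "runit_inv (mirror \<B>) = lunit_inv \<B>"
  "dual (mirror \<B>) = dual \<B>" "ev (mirror \<B>) = tev \<B>" "coev (mirror \<B>) = tcoev \<B>"
  "tev (mirror \<B>) = ev \<B>" "tcoev (mirror \<B>) = coev \<B>"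
  by (simp_all add: mirror_def)

context bicategory
begin

lemma AI_natural:
  assumes "ok f" "ok g" "ok h" "src (Dom h) = tgt (Dom g)" "src (Dom g) = tgt (Dom f)"
  shows "AI (Cod h) (Cod g) (Cod f) \<bullet> (h \<star> (g \<star> f)) = ((h \<star> g) \<star> f) \<bullet> AI (Dom h) (Dom g) (Dom f)"
proof -
  let ?D = "AI (Dom h) (Dom g) (Dom f)" and ?C = "AI (Cod h) (Cod g) (Cod f)"
  have "?C \<bullet> (h \<star> (g \<star> f)) = ?C \<bullet> ((h \<star> (g \<star> f)) \<bullet> AS (Dom h) (Dom g) (Dom f)) \<bullet> ?D"
    using assms by (simp add: vc_assoc)
  also have "\<dots> = (?C \<bullet> AS (Cod h) (Cod g) (Cod f)) \<bullet> ((h \<star> g) \<star> f) \<bullet> ?D"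
    using assms by (simp add: vc_assoc vc_left_cong[OF AS_AI(2)] flip: AS_natural)
  finally show ?thesis
    using assms by simp
qed

lemma assoc_inv_natural:
  assumes obj: "a \<in> Obj \<B>" "b \<in> Obj \<B>" "c \<in> Obj \<B>" "d \<in> Obj \<B>"
    and "X \<in> Hom1 \<B> a b" "X' \<in> Hom1 \<B> a b" "Y \<in> Hom1 \<B> b c" "Y' \<in> Hom1 \<B> b c"
    "Z \<in> Hom1 \<B> c d" "Z' \<in> Hom1 \<B> c d"
    and "f \<in> Hom2 \<B> X X'" "g \<in> Hom2 \<B> Y Y'" "h \<in> Hom2 \<B> Z Z'"
  shows "\<a>\<inverse> Z' Y' X' \<cdot> (h \<otimes> (g \<otimes> f)) = ((h \<otimes> g) \<otimes> f) \<cdot> \<a>\<inverse> Z Y X"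
proof -
  let ?x = "Gen1 a b X" and ?x' = "Gen1 a b X'" and ?y = "Gen1 b c Y" and ?y' = "Gen1 b c Y'"
    and ?z = "Gen1 c d Z" and ?z' = "Gen1 c d Z'"
  let ?f = "Cell2 ?x f ?x'" and ?g = "Cell2 ?y g ?y'" and ?h = "Cell2 ?z h ?z'"
  have [simp]: "ok ?f" "ok ?g" "ok ?h"
    using assms by (simp_all add: typed_def)
  have "AI ?z' ?y' ?x' \<bullet> (?h \<star> (?g \<star> ?f)) = ((?h \<star> ?g) \<star> ?f) \<bullet> AI ?z ?y ?x"
    using assms AI_natural[of ?f ?g ?h] by (simp del: ok.simps)
  from arg_cong[OF this, of val2] show ?thesis
    using assms by (simp add: typed_def)
qed

lemma pentagon_inverse:
  assumes "a \<in> Obj \<B>" "b \<in> Obj \<B>" "c \<in> Obj \<B>" "d \<in> Obj \<B>" "e \<in> Obj \<B>"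
    "W \<in> Hom1 \<B> a b" "X \<in> Hom1 \<B> b c" "Y \<in> Hom1 \<B> c d" "Z \<in> Hom1 \<B> d e"
  shows "(\<a>\<inverse> Z Y X \<otimes> \<one> W) \<cdot> \<a>\<inverse> Z (Y \<odot> X) W \<cdot> (\<one> Z \<otimes> \<a>\<inverse> Y X W)
    = \<a>\<inverse> (Z \<odot> Y) X W \<cdot> \<a>\<inverse> Z Y (X \<odot> W)"
proof -
  let ?w = "Gen1 a b W" and ?x = "Gen1 b c X" and ?y = "Gen1 c d Y" and ?z = "Gen1 d e Z"
  have "((AI ?z ?y ?x \<star> Id ?w) \<bullet> AI ?z (Prod1 ?y ?x) ?w) \<bullet> (Id ?z \<star> AI ?y ?x ?w)
      = AI (Prod1 ?z ?y) ?x ?w \<bullet> AI ?z ?y (Prod1 ?x ?w)"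
    by (rule strict_faithful) (use assms in \<open>simp_all add: strictify\<close>)
  from arg_cong[OF this, of val2] show ?thesis
    using assms by simp
qed

lemma triangle_inverse:
  assumes "a \<in> Obj \<B>" "b \<in> Obj \<B>" "c \<in> Obj \<B>" "X \<in> Hom1 \<B> a b" "Y \<in> Hom1 \<B> b c"
  shows "(\<r> Y \<otimes> \<one> X) \<cdot> \<a>\<inverse> Y (\<I> b) X = \<one> Y \<otimes> \<l> X"
proof -
  let ?x = "Gen1 a b X" and ?y = "Gen1 b c Y"
  have "(RU ?y \<star> Id ?x) \<bullet> AI ?y (Unit1 b) ?x = Id ?y \<star> LU ?x"
    by (rule strict_faithful) (use assms in \<open>simp_all add: strictify\<close>)
  from arg_cong[OF this, of val2] show ?thesis
    using assms by simp
qed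

end

context pivotal_bicategory
begin

lemma bicategory_mirror: "bicategory (mirror \<B>)"
proof (unfold_locales, goal_cases)
  case (8 a b c X X' Y Y' f g) then show ?case
    using hcomp_closed[of c b a Y Y' X X' g f] by simp
next
  case (9 a b c X Y) then show ?case by (simp add: hcomp_id)
next
  case (10 a b c X X' X'' Y Y' Y'' f f' g g') then show ?case
    using interchange[of c b a Y Y' Y'' X X' X'' g g' f f'] by simp
next
  case (13 a b c d X Y Z) then show ?case using assoc_inverse[of d c b a Z Y X] by simp
next
  case (14 a b c d X X' Y Y' Z Z' f g h) then show ?case
    using assoc_inv_natural[of d c b a Z Z' Y Y' X X' h g f] by simp
next
  case (23 a b c d e W X Y Z) then show ?case
    using pentagon_inverse[of e d c b a Z Y X W] by simp
next
  case (24 a b c X Y) then show ?case using triangle_inverse[of c b a Y X] by simp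
qed (auto intro: unit1_closed comp1_closed id2_closed vcomp_closed vcomp_assoc vcomp_id_left
    vcomp_id_right hcomp_closed assoc_closed assoc_inv_closed
    lunit_closed lunit_inv_closed runit_closed runit_inv_closed
    simp: lunit_inverse runit_inverse lunit_natural runit_natural)

text \<open>
  In the mirror the two sides of the pivotal axiom for composites change places and all bracketings are reflected.
  Both bracketings of a side have the same strictification, so the equation follows from the axiom.
\<close>

lemma pivotal_tensor_mirror:
  assumes obj: "a \<in> Obj \<B>" "b \<in> Obj \<B>" "c \<in> Obj \<B>" and X: "X \<in> Hom1 \<B> b a" and Y: "Y \<in> Hom1 \<B> c b"
    and W: "W = X \<odot> Y"
  shows "(\<l> (Y\<^sup>\<dagger>) \<otimes> \<one> (X\<^sup>\<dagger>)) \<cdot> ((ev \<B> W \<otimes> \<one> (Y\<^sup>\<dagger>)) \<otimes> \<one> (X\<^sup>\<dagger>))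
      \<cdot> ((\<a> (W\<^sup>\<dagger>) X Y \<otimes> \<one> (Y\<^sup>\<dagger>)) \<otimes> \<one> (X\<^sup>\<dagger>)) \<cdot> (\<a>\<inverse> (W\<^sup>\<dagger> \<odot> X) Y (Y\<^sup>\<dagger>) \<otimes> \<one> (X\<^sup>\<dagger>))
      \<cdot> ((\<one> (W\<^sup>\<dagger> \<odot> X) \<otimes> coev \<B> Y) \<otimes> \<one> (X\<^sup>\<dagger>)) \<cdot> (\<r>\<inverse> (W\<^sup>\<dagger> \<odot> X) \<otimes> \<one> (X\<^sup>\<dagger>))
      \<cdot> \<a>\<inverse> (W\<^sup>\<dagger>) X (X\<^sup>\<dagger>) \<cdot> (\<one> (W\<^sup>\<dagger>) \<otimes> coev \<B> X) \<cdot> \<r>\<inverse> (W\<^sup>\<dagger>)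
    = \<r> (Y\<^sup>\<dagger> \<odot> X\<^sup>\<dagger>) \<cdot> (\<one> (Y\<^sup>\<dagger> \<odot> X\<^sup>\<dagger>) \<otimes> tev \<B> W) \<cdot> \<a> (Y\<^sup>\<dagger> \<odot> X\<^sup>\<dagger>) W (W\<^sup>\<dagger>)
      \<cdot> (\<a> (Y\<^sup>\<dagger> \<odot> X\<^sup>\<dagger>) X Y \<otimes> \<one> (W\<^sup>\<dagger>)) \<cdot> ((\<a>\<inverse> (Y\<^sup>\<dagger>) (X\<^sup>\<dagger>) X \<otimes> \<one> Y) \<otimes> \<one> (W\<^sup>\<dagger>))
      \<cdot> (((\<one> (Y\<^sup>\<dagger>) \<otimes> tcoev \<B> X) \<otimes> \<one> Y) \<otimes> \<one> (W\<^sup>\<dagger>)) \<cdot> ((\<r>\<inverse> (Y\<^sup>\<dagger>) \<otimes> \<one> Y) \<otimes> \<one> (W\<^sup>\<dagger>))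
      \<cdot> (tcoev \<B> Y \<otimes> \<one> (W\<^sup>\<dagger>)) \<cdot> \<l>\<inverse> (W\<^sup>\<dagger>)"
    (is "?L = ?R")
proof -
  have W1: "W \<in> Hom1 \<B> c a" using assms by (blast intro: comp1_closed)
  let ?x = "Gen1 b a X" and ?y = "Gen1 c b Y" and ?x' = "Gen1 a b (X\<^sup>\<dagger>)" and ?y' = "Gen1 b c (Y\<^sup>\<dagger>)"
    and ?w' = "Gen1 a c (W\<^sup>\<dagger>)"
  let ?w = "Prod1 ?x ?y"
  note [simp] = W[symmetric] obj X Y dual_closed[OF obj(2,1) X] dual_closed[OF obj(3,2) Y] dual_closed[OF obj(3,1) W1]
  note adj = dual_left_adjoint[OF obj(2,1) X] dual_left_adjoint[OF obj(3,2) Y] dual_left_adjoint[OF obj(3,1) W1]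
    dual_right_adjoint[OF obj(2,1) X] dual_right_adjoint[OF obj(3,2) Y] dual_right_adjoint[OF obj(3,1) W1]
  define evw where "evw = Cell2 (Prod1 ?w' ?w) (ev \<B> W) (Unit1 c)"
  define tew where "tew = Cell2 (Prod1 ?w ?w') (tev \<B> W) (Unit1 a)"
  define cox where "cox = Cell2 (Unit1 a) (coev \<B> X) (Prod1 ?x ?x')"
  define coy where "coy = Cell2 (Unit1 b) (coev \<B> Y) (Prod1 ?y ?y')"
  define tcx where "tcx = Cell2 (Unit1 b) (tcoev \<B> X) (Prod1 ?x' ?x)"
  define tcy where "tcy = Cell2 (Unit1 c) (tcoev \<B> Y) (Prod1 ?y' ?y)"
  have types: "has_type evw (Prod1 ?w' ?w) (Unit1 c)" "has_type tew (Prod1 ?w ?w') (Unit1 a)"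
    "has_type cox (Unit1 a) (Prod1 ?x ?x')" "has_type coy (Unit1 b) (Prod1 ?y ?y')"
    "has_type tcx (Unit1 b) (Prod1 ?x' ?x)" "has_type tcy (Unit1 c) (Prod1 ?y' ?y)"
    using adj by (simp_all add: evw_def tew_def cox_def coy_def tcx_def tcy_def has_type_Cell2
        typed_def is_adjunction_def)
  note [simp] = types[THEN has_typeD(1)] types[THEN has_typeD(2)] types[THEN has_typeD(3)]
  have vals [simp]: "val2 evw = ev \<B> W" "val2 tew = tev \<B> W" "val2 cox = coev \<B> X" "val2 coy = coev \<B> Y"
    "val2 tcx = tcoev \<B> X" "val2 tcy = tcoev \<B> Y"
    by (simp_all add: evw_def tew_def cox_def coy_def tcx_def tcy_def)
  define L where "L = ((((((((LU ?y' \<star> Id ?x') \<bullet> ((evw \<star> Id ?y') \<star> Id ?x'))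
      \<bullet> ((AS ?w' ?x ?y \<star> Id ?y') \<star> Id ?x')) \<bullet> (AI (Prod1 ?w' ?x) ?y ?y' \<star> Id ?x'))
      \<bullet> ((Id (Prod1 ?w' ?x) \<star> coy) \<star> Id ?x')) \<bullet> (RI (Prod1 ?w' ?x) \<star> Id ?x'))
      \<bullet> AI ?w' ?x ?x') \<bullet> (Id ?w' \<star> cox)) \<bullet> RI ?w'"
  define R where "R = ((((((((RU (Prod1 ?y' ?x') \<bullet> (Id (Prod1 ?y' ?x') \<star> tew)) \<bullet> AS (Prod1 ?y' ?x') ?w ?w')
      \<bullet> (AS (Prod1 ?y' ?x') ?x ?y \<star> Id ?w')) \<bullet> ((AI ?y' ?x' ?x \<star> Id ?y) \<star> Id ?w'))
      \<bullet> (((Id ?y' \<star> tcx) \<star> Id ?y) \<star> Id ?w')) \<bullet> ((RI ?y' \<star> Id ?y) \<star> Id ?w'))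
      \<bullet> (tcy \<star> Id ?w')) \<bullet> LI ?w')"
  define L0 where "L0 = ((((((((Id ?y' \<star> RU ?x') \<bullet> (Id ?y' \<star> (Id ?x' \<star> tew))) \<bullet> (Id ?y' \<star> (Id ?x' \<star> AI ?x ?y ?w')))
        \<bullet> (Id ?y' \<star> AS ?x' ?x (Prod1 ?y ?w'))) \<bullet> (Id ?y' \<star> (tcx \<star> Id (Prod1 ?y ?w'))))
        \<bullet> (Id ?y' \<star> LI (Prod1 ?y ?w'))) \<bullet> AS ?y' ?y ?w') \<bullet> (tcy \<star> Id ?w')) \<bullet> LI ?w'"
  define R0 where "R0 = (((((((LU (Prod1 ?y' ?x') \<bullet> (evw \<star> Id (Prod1 ?y' ?x'))) \<bullet> AI ?w' ?w (Prod1 ?y' ?x'))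
        \<bullet> (Id ?w' \<star> AI ?x ?y (Prod1 ?y' ?x'))) \<bullet> (Id ?w' \<star> (Id ?x \<star> AS ?y ?y' ?x')))
        \<bullet> (Id ?w' \<star> (Id ?x \<star> (coy \<star> Id ?x')))) \<bullet> (Id ?w' \<star> (Id ?x \<star> LI ?x'))) \<bullet> (Id ?w' \<star> cox)) \<bullet> RI ?w'"
  note defs = L_def R_def L0_def R0_def
  have eq0: "L0 = R0"
    using pivotal_tensor[OF obj(3,2,1) Y X W]
    by (intro cell2_eqI) (simp_all add: defs)
  have okL: "ok L" "Dom L = ?w'" "Cod L = Prod1 ?y' ?x'" "val2 L = ?L"
    and okR: "ok R" "Dom R = ?w'" "Cod R = Prod1 ?y' ?x'" "val2 R = ?R"
    by (simp_all add: defs)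
  have okL0: "ok L0" "Dom L0 = ?w'" "Cod L0 = Prod1 ?y' ?x'"
    and okR0: "ok R0" "Dom R0 = ?w'" "Cod R0 = Prod1 ?y' ?x'"
    by (simp_all add: defs)
  have "L = R0"
    by (rule strict_faithful) (simp_all add: okL(1-3) okR0, simp add: defs strictify)
  moreover have "R = L0"
    by (rule strict_faithful) (simp_all add: okR(1-3) okL0, simp add: defs strictify)
  ultimately have "L = R"
    using eq0 by simp
  then have "val2 L = val2 R"
    by (rule arg_cong)
  then show ?thesis
    unfolding okL(4) okR(4) .
qed

text \<open>
  In the mirror the two sides of the pivotal axiom for maps change places, and \<open>\<phi>\<close> is bracketed with its other
  neighbour, which naturality of the associator corrects.
\<close>

lemma pivotal_map_mirror:
  assumes obj: "a \<in> Obj \<B>" "b \<in> Obj \<B>"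
    and hom: "X \<in> Hom1 \<B> b a" "Z \<in> Hom1 \<B> b a" "\<phi> \<in> Hom2 \<B> Z X"
  shows "\<l> (Z\<^sup>\<dagger>) \<cdot> (ev \<B> X \<otimes> \<one> (Z\<^sup>\<dagger>)) \<cdot> ((\<one> (X\<^sup>\<dagger>) \<otimes> \<phi>) \<otimes> \<one> (Z\<^sup>\<dagger>))
      \<cdot> \<a>\<inverse> (X\<^sup>\<dagger>) Z (Z\<^sup>\<dagger>) \<cdot> (\<one> (X\<^sup>\<dagger>) \<otimes> coev \<B> Z) \<cdot> \<r>\<inverse> (X\<^sup>\<dagger>)
    = \<r> (Z\<^sup>\<dagger>) \<cdot> (\<one> (Z\<^sup>\<dagger>) \<otimes> tev \<B> X) \<cdot> \<a> (Z\<^sup>\<dagger>) X (X\<^sup>\<dagger>)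
      \<cdot> ((\<one> (Z\<^sup>\<dagger>) \<otimes> \<phi>) \<otimes> \<one> (X\<^sup>\<dagger>)) \<cdot> (tcoev \<B> Z \<otimes> \<one> (X\<^sup>\<dagger>)) \<cdot> \<l>\<inverse> (X\<^sup>\<dagger>)"
proof -
  let ?x = "Gen1 b a X" and ?x' = "Gen1 a b (X\<^sup>\<dagger>)" and ?z = "Gen1 b a Z" and ?z' = "Gen1 a b (Z\<^sup>\<dagger>)"
  note [simp] = obj hom dual_closed[OF obj(2,1) hom(1)] dual_closed[OF obj(2,1) hom(2)]
  note adj = dual_left_adjoint[OF obj(2,1) hom(1)] dual_right_adjoint[OF obj(2,1) hom(1)]
    dual_left_adjoint[OF obj(2,1) hom(2)] dual_right_adjoint[OF obj(2,1) hom(2)]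
  define evx where "evx = Cell2 (Prod1 ?x' ?x) (ev \<B> X) (Unit1 b)"
  define tex where "tex = Cell2 (Prod1 ?x ?x') (tev \<B> X) (Unit1 a)"
  define coz where "coz = Cell2 (Unit1 a) (coev \<B> Z) (Prod1 ?z ?z')"
  define tcz where "tcz = Cell2 (Unit1 b) (tcoev \<B> Z) (Prod1 ?z' ?z)"
  define p where "p = Cell2 ?z \<phi> ?x"
  have types: "has_type evx (Prod1 ?x' ?x) (Unit1 b)" "has_type tex (Prod1 ?x ?x') (Unit1 a)"
    "has_type coz (Unit1 a) (Prod1 ?z ?z')" "has_type tcz (Unit1 b) (Prod1 ?z' ?z)" "has_type p ?z ?x"
    using adj by (simp_all add: evx_def tex_def coz_def tcz_def p_def has_type_Cell2
        typed_def is_adjunction_def)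
  note [simp] = types[THEN has_typeD(1)] types[THEN has_typeD(2)] types[THEN has_typeD(3)]
  have vals [simp]: "val2 evx = ev \<B> X" "val2 tex = tev \<B> X" "val2 coz = coev \<B> Z"
    "val2 tcz = tcoev \<B> Z" "val2 p = \<phi>"
    by (simp_all add: evx_def tex_def coz_def tcz_def p_def)
  have E1: "((((LU ?z' \<bullet> (evx \<star> Id ?z')) \<bullet> ((Id ?x' \<star> p) \<star> Id ?z')) \<bullet> AI ?x' ?z ?z') \<bullet> (Id ?x' \<star> coz)) \<bullet> RI ?x'
    = ((((LU ?z' \<bullet> (evx \<star> Id ?z')) \<bullet> AI ?x' ?x ?z') \<bullet> (Id ?x' \<star> (p \<star> Id ?z'))) \<bullet> (Id ?x' \<star> coz)) \<bullet> RI ?x'"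
    by (rule strict_faithful) (simp_all add: strictify)
  have E2: "((((RU ?z' \<bullet> (Id ?z' \<star> tex)) \<bullet> (Id ?z' \<star> (p \<star> Id ?x'))) \<bullet> AS ?z' ?z ?x') \<bullet> (tcz \<star> Id ?x')) \<bullet> LI ?x'
    = ((((RU ?z' \<bullet> (Id ?z' \<star> tex)) \<bullet> AS ?z' ?x ?x') \<bullet> ((Id ?z' \<star> p) \<star> Id ?x')) \<bullet> (tcz \<star> Id ?x')) \<bullet> LI ?x'"
    by (rule strict_faithful) (simp_all add: strictify)
  show ?thesis
    using pivotal_map[OF obj(2,1) hom(1,2,3)] arg_cong[OF E1, of val2] arg_cong[OF E2, of val2]
    by simp
qed

theorem pivotal_mirror: "pivotal_bicategory (mirror \<B>)"
proof -
  interpret m: bicategory "mirror \<B>"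
    by (rule bicategory_mirror)
  show ?thesis
  proof (unfold_locales, goal_cases)
    case (1 a b X)
    then show ?case
      using dual_right_adjoint[of b a X] by (simp add: is_adjunction_def)
  next
    case (2 a b X)
    then show ?case
      using dual_left_adjoint[of b a X] by (simp add: is_adjunction_def)
  next
    case (3 a b X Z \<phi>)
    then show ?case
      using pivotal_map_mirror[of a b X Z \<phi>] by simp
  next
    case (4 a b c X Y W)
    then show ?case
      using pivotal_tensor_mirror[of a b c X Y W] by simp
  qed
qed

end

section \<open>Averages and linear maps\<close>

context frobenius_diagram
begin

text \<open>
  The coproduct is determined by the copairing, from either side. In this form the Frobenius relations are used for modules.
\<close>

lemma copairing:
  assumes P: "wf1 P" "tgt P = b"
  shows "(m \<rhd> strict mu P) \<bullet> strict (de \<bullet> et) (Prod1 m P) = strict de P"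
    and "strict mu (Prod1 m P) \<bullet> (m \<rhd> strict (de \<bullet> et) P) = strict de P"
proof -
  note s = strict_frobenius[OF P]
  show "(m \<rhd> strict mu P) \<bullet> strict (de \<bullet> et) (Prod1 m P) = strict de P"
    using P b vc_left_cong[OF s(6)] by (simp add: strict_vc vc_assoc s(2))
  show "strict mu (Prod1 m P) \<bullet> (m \<rhd> strict (de \<bullet> et) P) = strict de P"
    using P b vc_left_cong[OF s(7)] by (simp add: strict_vc whisker_vc vc_assoc s(3))
qed

end

context left_module_diagram
begin

text \<open>
  These are used together: since both composites have the same value, a line that meets the line of an average
  from above can be moved to the strand of the module below it.
\<close>

lemma coaction_action:
  assumes P: "wf1 P" "tgt P = a"
  shows "strict formal_coaction P \<bullet> strict la P = (m \<rhd> strict la P) \<bullet> strict de (Prod1 x P)"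
    and "strict mu (Prod1 x P) \<bullet> (m \<rhd> strict formal_coaction P) = (m \<rhd> strict la P) \<bullet> strict de (Prod1 x P)"
proof -
  note [simp] = P a b
  have ga: "has_type (de \<bullet> et) (Unit1 b) (Prod1 m m)"
    by (simp add: has_type_def)
  have "strict formal_coaction P \<bullet> strict la P = (m \<rhd> strict la P) \<bullet> (strict (de \<bullet> et) (Prod1 x P) \<bullet> strict la P)"
    by (simp add: strict_formal_coaction vc_assoc)
  also have "\<dots> = (m \<rhd> (strict la P \<bullet> (m \<rhd> strict la P))) \<bullet> strict (de \<bullet> et) (Prod1 m (Prod1 x P))"
    using natural_strict[OF ga, of "strict la P" "Prod1 m (Prod1 x P)" "Prod1 x P"]
    by (simp add: whisker_vc vc_assoc)
  also have "\<dots> = (m \<rhd> strict la P) \<bullet> ((m \<rhd> strict mu (Prod1 x P)) \<bullet> strict (de \<bullet> et) (Prod1 m (Prod1 x P)))"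
    by (simp add: strict_module whisker_vc vc_assoc)
  finally show "strict formal_coaction P \<bullet> strict la P = (m \<rhd> strict la P) \<bullet> strict de (Prod1 x P)"
    by (simp add: copairing)
  have "strict mu (Prod1 x P) \<bullet> (m \<rhd> strict formal_coaction P)
      = (strict mu (Prod1 x P) \<bullet> (m \<rhd> m \<rhd> strict la P)) \<bullet> (m \<rhd> strict (de \<bullet> et) (Prod1 x P))"
    by (simp add: strict_formal_coaction whisker_vc vc_assoc)
  also have "\<dots> = (m \<rhd> strict la P) \<bullet> (strict mu (Prod1 m (Prod1 x P)) \<bullet> (m \<rhd> strict (de \<bullet> et) (Prod1 x P)))"
    using natural_strict[OF types(1), of "strict la P" "Prod1 m (Prod1 x P)" "Prod1 x P"]
    by (simp add: vc_assoc)
  finally show "strict mu (Prod1 x P) \<bullet> (m \<rhd> strict formal_coaction P) = (m \<rhd> strict la P) \<bullet> strict de (Prod1 x P)"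
    by (simp add: copairing)
qed

end

locale two_left_modules = frobenius_diagram \<B> b F + Y: left_module_diagram \<B> b F a Y k + X: left_module_diagram \<B> b F a X l
  for \<B> :: "('o, 'x, 'f, 'z) bicategory_data_scheme" (structure) and b F a Y k X l
begin

abbreviation "equivariant \<psi> \<equiv> \<psi> \<in> Hom2 \<B> Y X \<and> \<psi> \<cdot> k = l \<cdot> (\<one> (carr F) \<otimes> \<psi>)"

abbreviation "formal_map \<psi> \<equiv> Cell2 Y.x \<psi> X.x"

definition "formal_average \<psi> = (X.la \<bullet> (Id m \<star> formal_map \<psi>)) \<bullet> Y.formal_coaction"

lemma ok_formal_map [simp]: "typed Y.x \<psi> X.x \<longleftrightarrow> \<psi> \<in> Hom2 \<B> Y X"
  using Y.a b by (simp add: typed_def)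

lemma formal_average [simp]:
  assumes "\<psi> \<in> Hom2 \<B> Y X"
  shows "ok (formal_average \<psi>)" "Dom (formal_average \<psi>) = Y.x" "Cod (formal_average \<psi>) = X.x"
    "val2 (formal_average \<psi>) = left_average \<B> F Y k l \<psi>"
  using assms Y.a b by (simp_all add: formal_average_def left_average_def)

lemma left_average_closed:
  "\<psi> \<in> Hom2 \<B> Y X \<Longrightarrow> left_average \<B> F Y k l \<psi> \<in> Hom2 \<B> Y X"
  using val2_closed[of "formal_average \<psi>"] by simp

lemma strict_formal_average:
  assumes "\<psi> \<in> Hom2 \<B> Y X" "wf1 P" "tgt P = a"
  shows "strict (formal_average \<psi>) P = strict X.la P \<bullet> (m \<rhd> strict (formal_map \<psi>) P) \<bullet> strict Y.formal_coaction P"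
  using assms Y.a b by (simp add: formal_average_def strictify)

text \<open>
  By associativity of the module, a further line that acts on the average is absorbed by the line of the average;
  \<open>coaction_action\<close> releases it below \<open>\<psi>\<close>.
\<close>

lemma left_average_linear:
  assumes "\<psi> \<in> Hom2 \<B> Y X"
  shows "equivariant (left_average \<B> F Y k l \<psi>)"
proof -
  note [simp] = Y.a b assms
  let ?P = "Unit1 a"
  have "strict X.la ?P \<bullet> (m \<rhd> strict (formal_average \<psi>) ?P)
      = (strict X.la ?P \<bullet> (m \<rhd> strict X.la ?P)) \<bullet> (m \<rhd> m \<rhd> strict (formal_map \<psi>) ?P) \<bullet> (m \<rhd> strict Y.formal_coaction ?P)"
    by (simp add: strict_formal_average whisker_vc vc_assoc)
  also have "\<dots> = strict X.la ?P \<bullet> (strict mu (Prod1 X.x ?P) \<bullet> (m \<rhd> m \<rhd> strict (formal_map \<psi>) ?P)) \<bullet> (m \<rhd> strict Y.formal_coaction ?P)"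
    by (simp add: X.strict_module vc_assoc)
  also have "\<dots> = strict X.la ?P \<bullet> (m \<rhd> strict (formal_map \<psi>) ?P) \<bullet> (strict mu (Prod1 Y.x ?P) \<bullet> (m \<rhd> strict Y.formal_coaction ?P))"
    using natural_strict[OF types(1), of "strict (formal_map \<psi>) ?P" "Prod1 Y.x ?P" "Prod1 X.x ?P"]
    by (simp add: vc_assoc)
  also have "\<dots> = strict X.la ?P \<bullet> (m \<rhd> strict (formal_map \<psi>) ?P) \<bullet> (strict Y.formal_coaction ?P \<bullet> strict Y.la ?P)"
    by (simp add: Y.coaction_action)
  also have "\<dots> = strict (formal_average \<psi>) ?P \<bullet> strict Y.la ?P"
    by (simp add: strict_formal_average vc_assoc)
  finally have *: "strict X.la ?P \<bullet> (m \<rhd> strict (formal_average \<psi>) ?P) = strict (formal_average \<psi>) ?P \<bullet> strict Y.la ?P" .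
  have "formal_average \<psi> \<bullet> Y.la = X.la \<bullet> (Id m \<star> formal_average \<psi>)"
    by (rule strict_faithful) (use * in \<open>simp_all add: strictify\<close>)
  from arg_cong[OF this, of val2] show ?thesis
    by (simp add: left_average_closed)
qed

text \<open>
  The coaction is built from the action, so maps that respect actions respect coactions.
\<close>

lemma coaction_natural:
  assumes "equivariant \<psi>"
  shows "left_coaction \<B> F X l \<cdot> \<psi> = (\<one> (carr F) \<otimes> \<psi>) \<cdot> left_coaction \<B> F Y k"
proof -
  note [simp] = Y.a b
  let ?P = "Unit1 a"
  have [simp]: "\<psi> \<in> Hom2 \<B> Y X" using assms by simp
  have lin: "formal_map \<psi> \<bullet> Y.la = X.la \<bullet> (Id m \<star> formal_map \<psi>)"
    using assms by (intro cell2_eqI) simp_all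
  from arg_cong[OF this, of "\<lambda>\<phi>. strict \<phi> ?P"]
  have slin: "strict (formal_map \<psi>) ?P \<bullet> strict Y.la ?P = strict X.la ?P \<bullet> (m \<rhd> strict (formal_map \<psi>) ?P)"
    by (simp add: strictify)
  have ga: "has_type (de \<bullet> et) (Unit1 b) (Prod1 m m)"
    by (simp add: has_type_def)
  have "strict X.formal_coaction ?P \<bullet> strict (formal_map \<psi>) ?P
      = (m \<rhd> (strict X.la ?P \<bullet> (m \<rhd> strict (formal_map \<psi>) ?P))) \<bullet> strict (de \<bullet> et) (Prod1 Y.x ?P)"
    using natural_strict[OF ga, of "strict (formal_map \<psi>) ?P" "Prod1 Y.x ?P" "Prod1 X.x ?P"]
    by (simp add: X.strict_formal_coaction whisker_vc vc_assoc)
  also have "\<dots> = (m \<rhd> strict (formal_map \<psi>) ?P) \<bullet> strict Y.formal_coaction ?P"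
    by (simp add: Y.strict_formal_coaction vc_assoc flip: slin) (simp add: whisker_vc vc_assoc)
  finally have *: "strict X.formal_coaction ?P \<bullet> strict (formal_map \<psi>) ?P = (m \<rhd> strict (formal_map \<psi>) ?P) \<bullet> strict Y.formal_coaction ?P" .
  have "X.formal_coaction \<bullet> formal_map \<psi> = (Id m \<star> formal_map \<psi>) \<bullet> Y.formal_coaction"
    by (rule strict_faithful) (use * in \<open>simp_all add: strict_vc strict_hc strict_Id Id_hc_Id\<close>)
  from arg_cong[OF this, of val2] show ?thesis
    by simp
qed

text \<open>
  A right action on a bimodule commutes with the left action and hence with the coaction, so it passes through all
  three factors of the average.
\<close>

lemma left_average_right_linear:
  assumes A: "A \<in> Hom1 \<B> a a" and r: "r \<in> Hom2 \<B> (X \<odot> A) X" and q: "q \<in> Hom2 \<B> (Y \<odot> A) Y"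
    and bim: "r \<cdot> (l \<otimes> \<one> A) = l \<cdot> (\<one> (carr F) \<otimes> r) \<cdot> \<a> (carr F) X A"
      "q \<cdot> (k \<otimes> \<one> A) = k \<cdot> (\<one> (carr F) \<otimes> q) \<cdot> \<a> (carr F) Y A"
    and \<psi>: "\<psi> \<in> Hom2 \<B> Y X" "\<psi> \<cdot> q = r \<cdot> (\<psi> \<otimes> \<one> A)"
  shows "left_average \<B> F Y k l \<psi> \<cdot> q = r \<cdot> (left_average \<B> F Y k l \<psi> \<otimes> \<one> A)"
proof -
  note [simp] = Y.a b A \<psi>(1)
  let ?s = "Gen1 a a A" and ?P = "Unit1 a"
  define rf where "rf = Cell2 (Prod1 X.x ?s) r X.x"
  define qf where "qf = Cell2 (Prod1 Y.x ?s) q Y.x"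
  have types_rq: "has_type rf (Prod1 X.x ?s) X.x" "has_type qf (Prod1 Y.x ?s) Y.x"
    using r q by (simp_all add: rf_def qf_def has_type_Cell2 typed_def comp1_closed[where b = a])
  note [simp] = types_rq[THEN has_typeD(1)] types_rq[THEN has_typeD(2)] types_rq[THEN has_typeD(3)]
  have [simp]: "val2 rf = r" "val2 qf = q" by (simp_all add: rf_def qf_def)
  have eqs: "rf \<bullet> (X.la \<star> Id ?s) = (X.la \<bullet> (Id m \<star> rf)) \<bullet> AS m X.x ?s"
    "qf \<bullet> (Y.la \<star> Id ?s) = (Y.la \<bullet> (Id m \<star> qf)) \<bullet> AS m Y.x ?s"
    "formal_map \<psi> \<bullet> qf = rf \<bullet> (formal_map \<psi> \<star> Id ?s)"
    using bim \<psi> by (intro cell2_eqI; simp)+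
  let ?Q = "Prod1 ?s ?P"
  from eqs[THEN arg_cong, of "\<lambda>\<phi>. strict \<phi> ?P"]
  have s: "strict rf ?P \<bullet> strict X.la ?Q = strict X.la ?P \<bullet> (m \<rhd> strict rf ?P)"
    "strict qf ?P \<bullet> strict Y.la ?Q = strict Y.la ?P \<bullet> (m \<rhd> strict qf ?P)"
    "strict (formal_map \<psi>) ?P \<bullet> strict qf ?P = strict rf ?P \<bullet> strict (formal_map \<psi>) ?Q"
    by (simp_all add: strictify)
  have ga: "has_type (de \<bullet> et) (Unit1 b) (Prod1 m m)"
    by (simp add: has_type_def)
  have "strict (formal_average \<psi>) ?P \<bullet> strict qf ?P = strict X.la ?P \<bullet> (m \<rhd> strict (formal_map \<psi>) ?P) \<bullet>
      (m \<rhd> (strict Y.la ?P \<bullet> (m \<rhd> strict qf ?P))) \<bullet> strict (de \<bullet> et) (Prod1 Y.x ?Q)"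
    using natural_strict[OF ga, of "strict qf ?P" "Prod1 Y.x ?Q" "Prod1 Y.x ?P"]
    by (simp add: strict_formal_average Y.strict_formal_coaction whisker_vc vc_assoc)
  also have "\<dots> = strict X.la ?P \<bullet> (m \<rhd> (strict (formal_map \<psi>) ?P \<bullet> strict qf ?P)) \<bullet> strict Y.formal_coaction ?Q"
    by (simp add: Y.strict_formal_coaction vc_assoc flip: s(2)) (simp add: whisker_vc vc_assoc)
  also have "\<dots> = (strict X.la ?P \<bullet> (m \<rhd> strict rf ?P)) \<bullet> (m \<rhd> strict (formal_map \<psi>) ?Q) \<bullet> strict Y.formal_coaction ?Q"
    by (simp add: s(3)) (simp add: whisker_vc vc_assoc)
  also have "\<dots> = strict rf ?P \<bullet> strict (formal_average \<psi>) ?Q"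
    by (simp add: strict_formal_average vc_assoc flip: s(1))
  finally have *: "strict (formal_average \<psi>) ?P \<bullet> strict qf ?P = strict rf ?P \<bullet> strict (formal_average \<psi>) ?Q" .
  have "formal_average \<psi> \<bullet> qf = rf \<bullet> (formal_average \<psi> \<star> Id ?s)"
    by (rule strict_faithful) (use * in \<open>simp_all add: strictify\<close>)
  from arg_cong[OF this, of val2] show ?thesis
    by simp
qed

end

section \<open>Averaging to bimodule maps\<close>

context frobenius_diagram
begin

lemma left_average_comp:
  assumes a: "a \<in> Obj \<B>" and hom: "W \<in> Hom1 \<B> a b" "Y \<in> Hom1 \<B> a b" "X \<in> Hom1 \<B> a b"
    and modules: "is_left_module \<B> F W j" "is_left_module \<B> F Y k" "is_left_module \<B> F X l"
    and v: "v \<in> Hom2 \<B> Y X" and w: "w \<in> Hom2 \<B> W Y"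
  shows "v \<cdot> k = l \<cdot> (\<one> (carr F) \<otimes> v) \<Longrightarrow>
      v \<cdot> left_average \<B> F W j k w = left_average \<B> F W j l (v \<cdot> w)"
    and "w \<cdot> j = k \<cdot> (\<one> (carr F) \<otimes> w) \<Longrightarrow>
      left_average \<B> F Y k l v \<cdot> w = left_average \<B> F W j l (v \<cdot> w)"
proof -
  interpret WY: two_left_modules \<B> b F a W j Y k
    by unfold_locales (use assms in auto)
  interpret YX: two_left_modules \<B> b F a Y k X l
    by unfold_locales (use assms in auto)
  interpret WX: two_left_modules \<B> b F a W j X l
    by unfold_locales (use assms in auto)
  note [simp] = a b hom v w
  have vw: "v \<cdot> w \<in> Hom2 \<B> W X"
    using vcomp_closed[of a b W Y X w v] by simp
  have formal_map: "YX.formal_map v \<bullet> WY.formal_map w = WX.formal_map (v \<cdot> w)"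
    using vw by (intro cell2_eqI) simp_all
  show "v \<cdot> left_average \<B> F W j k w = left_average \<B> F W j l (v \<cdot> w)"
    if "v \<cdot> k = l \<cdot> (\<one> (carr F) \<otimes> v)"
  proof -
    have lin: "YX.formal_map v \<bullet> WY.X.la = YX.X.la \<bullet> (Id m \<star> YX.formal_map v)"
      using that by (intro cell2_eqI) simp_all
    have "YX.formal_map v \<bullet> WY.formal_average w = (YX.formal_map v \<bullet> WY.X.la) \<bullet> (Id m \<star> WY.formal_map w) \<bullet> WY.Y.formal_coaction"
      by (simp add: WY.formal_average_def vc_assoc)
    also have "\<dots> = YX.X.la \<bullet> (Id m \<star> (YX.formal_map v \<bullet> WY.formal_map w)) \<bullet> WY.Y.formal_coaction"
      unfolding lin by (simp add: whisker_vc vc_assoc)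
    also have "\<dots> = WX.formal_average (v \<cdot> w)"
      unfolding formal_map by (simp add: WX.formal_average_def vc_assoc)
    finally have "YX.formal_map v \<bullet> WY.formal_average w = WX.formal_average (v \<cdot> w)" .
    from arg_cong[OF this, of val2] show ?thesis
      using vw by simp
  qed
  show "left_average \<B> F Y k l v \<cdot> w = left_average \<B> F W j l (v \<cdot> w)"
    if "w \<cdot> j = k \<cdot> (\<one> (carr F) \<otimes> w)"
  proof -
    have nat: "WY.X.formal_coaction \<bullet> WY.formal_map w = (Id m \<star> WY.formal_map w) \<bullet> WY.Y.formal_coaction"
      using WY.coaction_natural[of w] that by (intro cell2_eqI) simp_all
    have "YX.formal_average v \<bullet> WY.formal_map w = YX.X.la \<bullet> (Id m \<star> YX.formal_map v) \<bullet> (WY.X.formal_coaction \<bullet> WY.formal_map w)"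
      by (simp add: YX.formal_average_def vc_assoc)
    also have "\<dots> = YX.X.la \<bullet> (Id m \<star> (YX.formal_map v \<bullet> WY.formal_map w)) \<bullet> WY.Y.formal_coaction"
      unfolding nat by (simp add: whisker_vc vc_assoc)
    also have "\<dots> = WX.formal_average (v \<cdot> w)"
      unfolding formal_map by (simp add: WX.formal_average_def vc_assoc)
    finally have "YX.formal_average v \<bullet> WY.formal_map w = WX.formal_average (v \<cdot> w)" .
    from arg_cong[OF this, of val2] show ?thesis
      using vw by simp
  qed
qed

text \<open>
  The associativity of a right action in the form that it takes in the mirror bicategory, where the inverse
  associator is the associator.
\<close>

lemma right_module_inverse_assoc:
  assumes a: "c \<in> Obj \<B>" and X: "X \<in> Hom1 \<B> b c" and r: "r \<in> Hom2 \<B> (X \<odot> carr F) X"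
    and eq: "r \<cdot> (r \<otimes> \<one> (carr F)) = r \<cdot> (\<one> X \<otimes> mul F) \<cdot> \<a> X (carr F) (carr F)"
  shows "r \<cdot> (\<one> X \<otimes> mul F) = r \<cdot> (r \<otimes> \<one> (carr F)) \<cdot> \<a>\<inverse> X (carr F) (carr F)"
proof -
  note [simp] = a b X
  let ?x = "Gen1 b c X"
  define ra where "ra = Cell2 (Prod1 ?x m) r ?x"
  have "has_type ra (Prod1 ?x m) ?x"
    using r by (simp add: ra_def has_type_Cell2 typed_def)
  note [simp] = has_typeD[OF this]
  have [simp]: "val2 ra = r" by (simp add: ra_def)
  have 1: "ra \<bullet> (ra \<star> Id m) = (ra \<bullet> (Id ?x \<star> mu)) \<bullet> AS ?x m m"
    using eq by (intro cell2_eqI) simp_all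
  have "(ra \<bullet> (ra \<star> Id m)) \<bullet> AI ?x m m = ra \<bullet> (Id ?x \<star> mu)"
    unfolding 1 by (simp add: vc_assoc)
  from arg_cong[OF this, of val2] show ?thesis
    by simp
qed

lemma frobenius_mirror_eqs:
  shows "mul F \<cdot> (\<one> (carr F) \<otimes> mul F) = mul F \<cdot> (mul F \<otimes> \<one> (carr F)) \<cdot> \<a>\<inverse> (carr F) (carr F) (carr F)"
    and "\<a>\<inverse> (carr F) (carr F) (carr F) \<cdot> (\<one> (carr F) \<otimes> comul F) \<cdot> comul F = (comul F \<otimes> \<one> (carr F)) \<cdot> comul F"
proof -
  show "mul F \<cdot> (\<one> (carr F) \<otimes> mul F) = mul F \<cdot> (mul F \<otimes> \<one> (carr F)) \<cdot> \<a>\<inverse> (carr F) (carr F) (carr F)"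
    using frob b by (intro right_module_inverse_assoc[where c = b]) simp_all
  have 1: "AS m m m \<bullet> (de \<star> Id m) \<bullet> de = (Id m \<star> de) \<bullet> de"
    unfolding vc_assoc[symmetric] using frob b by (intro cell2_eqI) simp_all
  have "(AI m m m \<bullet> (Id m \<star> de)) \<bullet> de = (de \<star> Id m) \<bullet> de"
    unfolding vc_assoc 1[symmetric] using b by (simp flip: vc_assoc)
  from arg_cong[OF this, of val2] show "\<a>\<inverse> (carr F) (carr F) (carr F) \<cdot> (\<one> (carr F) \<otimes> comul F) \<cdot> comul F = (comul F \<otimes> \<one> (carr F)) \<cdot> comul F"
    using b by simp
qed

end

context pivotal_bicategory
begin

lemma frobenius_mirror:
  assumes b: "b \<in> Obj \<B>" and F: "is_frobenius_algebra \<B> b F"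
  shows "is_frobenius_algebra (mirror \<B>) b F"
    and "is_separable \<B> F \<Longrightarrow> is_separable (mirror \<B>) F"
    and "is_symmetric \<B> F \<Longrightarrow> is_symmetric (mirror \<B>) F"
proof -
  interpret frobenius_diagram \<B> b F
    by unfold_locales (use assms in auto)
  show "is_frobenius_algebra (mirror \<B>) b F"
    using frob frobenius_mirror_eqs
    by (simp add: is_frobenius_algebra_def Let_def is_algebra_def is_coalgebra_def)
qed (simp_all add: is_separable_def is_symmetric_def Let_def)

lemma trace_left_mirror: "trace_left (mirror \<B>) X \<psi> = trace_right \<B> X \<psi>"
  by (simp add: trace_left_def trace_right_def)

lemma orb_Hom1_modules:
  assumes P: "(a, A) \<in> orb_Obj \<B>" and Q: "(b, B) \<in> orb_Obj \<B>" and M: "M \<in> orb_Hom1 \<B> (a, A) (b, B)"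
  shows "is_left_module \<B> B (mcarr M) (lact M)" "is_left_module (mirror \<B>) A (mcarr M) (ract M)"
proof -
  interpret A: frobenius_diagram \<B> a A
    by unfold_locales (use P in \<open>auto simp: orb_Obj_def\<close>)
  show "is_left_module \<B> B (mcarr M) (lact M)"
    using M by (simp add: orb_Hom1_def Let_def is_left_module_def)
  show "is_left_module (mirror \<B>) A (mcarr M) (ract M)"
    using M Q A.right_module_inverse_assoc[of b "mcarr M" "ract M"]
    by (simp add: orb_Hom1_def orb_Obj_def Let_def is_left_module_def)
qed

text \<open>
  Average over \<open>A\<close> from the right first and over \<open>B\<close> from the left afterwards. With this order it is enough to know that
  left averages preserve right linearity.
\<close>

definition average where
  "average A B Y X \<psi> = left_average \<B> B (mcarr Y) (lact Y) (lact X)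
    (left_average (mirror \<B>) A (mcarr Y) (ract Y) (ract X) \<psi>)"

lemma average:
  assumes P: "(a, A) \<in> orb_Obj \<B>" and Q: "(b, B) \<in> orb_Obj \<B>"
    and X: "X \<in> orb_Hom1 \<B> (a, A) (b, B)" and Y: "Y \<in> orb_Hom1 \<B> (a, A) (b, B)"
    and \<psi>: "\<psi> \<in> Hom2 \<B> (mcarr Y) (mcarr X)"
  shows "average A B Y X \<psi> \<in> orb_Hom2 \<B> (a, A) (b, B) Y X"
proof -
  have obj: "a \<in> Obj \<B>" "b \<in> Obj \<B>" using P Q by (auto simp: orb_Obj_def)
  interpret m: pivotal_bicategory "mirror \<B>" by (rule pivotal_mirror)
  interpret L: two_left_modules \<B> b B a "mcarr Y" "lact Y" "mcarr X" "lact X"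
    by unfold_locales
      (use Q X Y obj orb_Hom1_modules[OF P Q X] orb_Hom1_modules[OF P Q Y] in
        \<open>auto simp: orb_Obj_def orb_Hom1_def Let_def\<close>)
  interpret R: two_left_modules "mirror \<B>" a A b "mcarr Y" "ract Y" "mcarr X" "ract X"
    by unfold_locales
      (use P X Y obj orb_Hom1_modules[OF P Q X] orb_Hom1_modules[OF P Q Y] frobenius_mirror in
        \<open>auto simp: orb_Obj_def orb_Hom1_def Let_def\<close>)
  let ?\<rho> = "left_average (mirror \<B>) A (mcarr Y) (ract Y) (ract X) \<psi>"
  have \<rho>: "?\<rho> \<in> Hom2 \<B> (mcarr Y) (mcarr X)" "?\<rho> \<cdot> ract Y = ract X \<cdot> (?\<rho> \<otimes> \<one> (carr A))"
    using R.left_average_linear \<psi> by simp_all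
  have carrA: "carr A \<in> Hom1 \<B> a a"
    using P by (simp add: orb_Obj_def is_frobenius_algebra_def Let_def is_algebra_def)
  have "average A B Y X \<psi> \<cdot> ract Y = ract X \<cdot> (average A B Y X \<psi> \<otimes> \<one> (carr A))"
    unfolding average_def
    by (rule L.left_average_right_linear[OF carrA])
      (use X Y \<rho> in \<open>auto simp: orb_Hom1_def Let_def\<close>)
  then show ?thesis
    using L.left_average_linear[OF \<rho>(1)] by (simp add: orb_Hom2_def average_def)
qed

lemma average_comp:
  assumes P: "(a, A) \<in> orb_Obj \<B>" and Q: "(b, B) \<in> orb_Obj \<B>"
    and X: "X \<in> orb_Hom1 \<B> (a, A) (b, B)" and Y: "Y \<in> orb_Hom1 \<B> (a, A) (b, B)"
    and W: "W \<in> orb_Hom1 \<B> (a, A) (b, B)"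
  shows "\<lbrakk>v \<in> orb_Hom2 \<B> (a, A) (b, B) Y X; w \<in> Hom2 \<B> (mcarr W) (mcarr Y)\<rbrakk>
      \<Longrightarrow> v \<cdot> average A B W Y w = average A B W X (v \<cdot> w)"
    and "\<lbrakk>v \<in> Hom2 \<B> (mcarr Y) (mcarr X); w \<in> orb_Hom2 \<B> (a, A) (b, B) W Y\<rbrakk>
      \<Longrightarrow> average A B Y X v \<cdot> w = average A B W X (v \<cdot> w)"
proof -
  have obj: "a \<in> Obj \<B>" "b \<in> Obj \<B>" using P Q by (auto simp: orb_Obj_def)
  interpret m: pivotal_bicategory "mirror \<B>" by (rule pivotal_mirror)
  interpret L: frobenius_diagram \<B> b B
    by unfold_locales (use Q in \<open>auto simp: orb_Obj_def\<close>)
  interpret R: frobenius_diagram "mirror \<B>" a A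
    by unfold_locales (use P frobenius_mirror in \<open>auto simp: orb_Obj_def\<close>)
  have hom: "mcarr W \<in> Hom1 \<B> a b" "mcarr Y \<in> Hom1 \<B> a b" "mcarr X \<in> Hom1 \<B> a b"
    using W X Y by (auto simp: orb_Hom1_def Let_def)
  note modules = orb_Hom1_modules[OF P Q W] orb_Hom1_modules[OF P Q Y] orb_Hom1_modules[OF P Q X]
  note L = L.left_average_comp[OF obj(1) hom modules(1,3,5)]
  note R = R.left_average_comp[of b "mcarr W" "mcarr Y" "mcarr X" "ract W" "ract Y" "ract X", simplified, OF obj(2) hom modules(2,4,6)]
  have closed: "left_average (mirror \<B>) A (mcarr U) (ract U) (ract V) \<psi> \<in> Hom2 \<B> (mcarr U) (mcarr V)"
    if "U \<in> orb_Hom1 \<B> (a, A) (b, B)" "V \<in> orb_Hom1 \<B> (a, A) (b, B)"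
      "\<psi> \<in> Hom2 \<B> (mcarr U) (mcarr V)" for U V \<psi>
  proof -
    interpret UV: two_left_modules "mirror \<B>" a A b "mcarr U" "ract U" "mcarr V" "ract V"
      by unfold_locales
        (use that obj orb_Hom1_modules[OF P Q that(1)] orb_Hom1_modules[OF P Q that(2)] in
          \<open>auto simp: orb_Hom1_def Let_def\<close>)
    show ?thesis
      using UV.left_average_closed that by simp
  qed
  show "v \<cdot> average A B W Y w = average A B W X (v \<cdot> w)"
    if "v \<in> orb_Hom2 \<B> (a, A) (b, B) Y X" "w \<in> Hom2 \<B> (mcarr W) (mcarr Y)"
    using that closed[OF W Y] by (simp add: average_def orb_Hom2_def L(1) R(1))
  show "average A B Y X v \<cdot> w = average A B W X (v \<cdot> w)"
    if "v \<in> Hom2 \<B> (mcarr Y) (mcarr X)" "w \<in> orb_Hom2 \<B> (a, A) (b, B) W Y"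
    using that closed[OF Y X] by (simp add: average_def orb_Hom2_def L(2) R(2))
qed

text \<open>
  Averages over \<open>B\<close> preserve the left trace, averages over \<open>A\<close> the right trace; the hypothesis on \<open>X\<close> carries the
  second fact over to the left trace.
\<close>

lemma trace_average:
  assumes P: "(a, A) \<in> orb_Obj \<B>" and Q: "(b, B) \<in> orb_Obj \<B>"
    and X: "X \<in> orb_Hom1 \<B> (a, A) (b, B)" and \<psi>: "\<psi> \<in> Hom2 \<B> (mcarr X) (mcarr X)"
    and sphere: "\<And>\<psi>. \<psi> \<in> Hom2 \<B> (mcarr X) (mcarr X) \<Longrightarrow>
      t a (trace_left \<B> (mcarr X) \<psi>) = t b (trace_right \<B> (mcarr X) \<psi>)"
  shows "t a (trace_left \<B> (mcarr X) (average A B X X \<psi>)) = t a (trace_left \<B> (mcarr X) \<psi>)"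
proof -
  have obj: "a \<in> Obj \<B>" "b \<in> Obj \<B>" using P Q by (auto simp: orb_Obj_def)
  interpret m: pivotal_bicategory "mirror \<B>" by (rule pivotal_mirror)
  note modules = orb_Hom1_modules[OF P Q X]
  have hom: "mcarr X \<in> Hom1 \<B> a b"
    using X by (auto simp: orb_Hom1_def Let_def)
  interpret R: two_left_modules "mirror \<B>" a A b "mcarr X" "ract X" "mcarr X" "ract X"
    by unfold_locales (use P obj hom modules frobenius_mirror in \<open>auto simp: orb_Obj_def\<close>)
  let ?\<rho> = "left_average (mirror \<B>) A (mcarr X) (ract X) (ract X) \<psi>"
  have \<rho>: "?\<rho> \<in> Hom2 \<B> (mcarr X) (mcarr X)"
    using R.left_average_closed \<psi> by simp
  have "trace_left \<B> (mcarr X) (average A B X X \<psi>) = trace_left \<B> (mcarr X) ?\<rho>"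
    unfolding average_def
    using trace_left_average[OF obj hom _ _ _ modules(1) \<rho>] Q by (simp add: orb_Obj_def)
  moreover have "trace_right \<B> (mcarr X) ?\<rho> = trace_right \<B> (mcarr X) \<psi>"
    using m.trace_left_average[of b a "mcarr X" A "ract X" \<psi>] P obj hom modules(2) \<psi>
      frobenius_mirror[OF obj(1)]
    by (simp add: orb_Obj_def trace_left_mirror)
  ultimately show ?thesis
    using sphere \<rho> \<psi> by simp
qed

end

theorem corollary5p2:
  fixes \<B> :: "('o, 'x, 'f) linear_pivotal_data"
    and t :: "'o \<Rightarrow> 'f \<Rightarrow> complex"
    and a b :: 'o
    and A B :: "('x, 'f) frobenius_data"
    and X :: "('x, 'f) bimodule_data"
  assumes "linear_pivotal_bicategory \<B>"
    and "idempotent_complete_homs \<B>"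
    and "\<And>c. c \<in> Obj \<B> \<Longrightarrow> linear_on_End_unit \<B> c (t c)"
    and "(a, A) \<in> orb_Obj \<B>"
    and "(b, B) \<in> orb_Obj \<B>"
    and "X \<in> orb_Hom1 \<B> (a, A) (b, B)"
    and "\<And>\<Psi>. \<Psi> \<in> Hom2 \<B> (mcarr X) (mcarr X) \<Longrightarrow>
      t a (trace_left \<B> (mcarr X) \<Psi>) = t b (trace_right \<B> (mcarr X) \<Psi>)"
  shows "\<forall>Y \<in> orb_Hom1 \<B> (a, A) (b, B).
    nondegenerate_pairing
      (Hom2 \<B> (mcarr Y) (mcarr X)) (zero2 \<B> (mcarr Y) (mcarr X))
      (Hom2 \<B> (mcarr X) (mcarr Y)) (zero2 \<B> (mcarr X) (mcarr Y))
      (trace_pairing \<B> (t a) (mcarr X))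
    \<longrightarrow> nondegenerate_pairing
      (orb_Hom2 \<B> (a, A) (b, B) Y X) (zero2 \<B> (mcarr Y) (mcarr X))
      (orb_Hom2 \<B> (a, A) (b, B) X Y) (zero2 \<B> (mcarr X) (mcarr Y))
      (trace_pairing \<B> (t a) (mcarr X))"
proof (intro ballI impI)
  interpret linear_pivotal_bicategory \<B> by fact
  fix Y assume Y: "Y \<in> orb_Hom1 \<B> (a, A) (b, B)"
  assume nondeg: "nondegenerate_pairing
      (Hom2 \<B> (mcarr Y) (mcarr X)) (zero2 \<B> (mcarr Y) (mcarr X))
      (Hom2 \<B> (mcarr X) (mcarr Y)) (zero2 \<B> (mcarr X) (mcarr Y))
      (trace_pairing \<B> (t a) (mcarr X))"
  note P = assms(4) and Q = assms(5) and X = assms(6)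
  let ?p = "trace_pairing \<B> (t a) (mcarr X)"
  have obj: "a \<in> Obj \<B>" "b \<in> Obj \<B>" and hom: "mcarr X \<in> Hom1 \<B> a b" "mcarr Y \<in> Hom1 \<B> a b"
    using P Q X Y by (auto simp: orb_Obj_def orb_Hom1_def Let_def)
  have closed: "vcomp \<B> v w \<in> Hom2 \<B> (mcarr X) (mcarr X)"
    if "v \<in> Hom2 \<B> (mcarr Y) (mcarr X)" "w \<in> Hom2 \<B> (mcarr X) (mcarr Y)" for v w
    using vcomp_closed[OF obj hom(1,2,1) that(2,1)] .
  have right: "?p v (average A B X Y w) = ?p v w"
    if "v \<in> orb_Hom2 \<B> (a, A) (b, B) Y X" "w \<in> Hom2 \<B> (mcarr X) (mcarr Y)" for v w
    using that trace_average[OF P Q X closed[of v w] assms(7)] average_comp(1)[OF P Q X Y X that]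
    by (simp add: trace_pairing_def orb_Hom2_def)
  have left: "?p (average A B Y X v) w = ?p v w"
    if "v \<in> Hom2 \<B> (mcarr Y) (mcarr X)" "w \<in> orb_Hom2 \<B> (a, A) (b, B) X Y" for v w
    using that trace_average[OF P Q X closed[of v w] assms(7)] average_comp(2)[OF P Q X Y X that]
    by (simp add: trace_pairing_def orb_Hom2_def)
  show "nondegenerate_pairing
      (orb_Hom2 \<B> (a, A) (b, B) Y X) (zero2 \<B> (mcarr Y) (mcarr X))
      (orb_Hom2 \<B> (a, A) (b, B) X Y) (zero2 \<B> (mcarr X) (mcarr Y)) ?p"
    unfolding nondegenerate_pairing_def
  proof (intro conjI ballI impI)
    fix v assume v: "v \<in> orb_Hom2 \<B> (a, A) (b, B) Y X"
      and zero: "\<forall>w\<in>orb_Hom2 \<B> (a, A) (b, B) X Y. ?p v w = 0"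
    have "?p v w = 0" if "w \<in> Hom2 \<B> (mcarr X) (mcarr Y)" for w
      using zero average[OF P Q Y X that] right[OF v that] by auto
    then show "v = zero2 \<B> (mcarr Y) (mcarr X)"
      using nondeg v by (auto simp: nondegenerate_pairing_def orb_Hom2_def)
  next
    fix w assume w: "w \<in> orb_Hom2 \<B> (a, A) (b, B) X Y"
      and zero: "\<forall>v\<in>orb_Hom2 \<B> (a, A) (b, B) Y X. ?p v w = 0"
    have "?p v w = 0" if "v \<in> Hom2 \<B> (mcarr Y) (mcarr X)" for v
      using zero average[OF P Q X Y that] left[OF that w] by auto
    then show "w = zero2 \<B> (mcarr X) (mcarr Y)"
      using nondeg w by (auto simp: nondegenerate_pairing_def orb_Hom2_def)
  qed
qed

end
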